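(* Let $(u,p)\in W^{1,\phi}_0(\Omega)^d\times L^{\phi^*}_0(\Omega)$ be the solution of the nonlinear Stokes problem with $\mathcal D=\mathrm D$ and let $(u_h,p_h)\in\mathbf{CR}\times\widehat S^0_0$ be the solution of Method 2. Then $$\|F(\mathrm Du)-F(\mathrm DEu_h)\|_2\le C\inf_{v_h\in Z_h}\|F(\mathrm Du)-F(\mathrm DEv_h)\|_2,$$ where $Z_h=\{v_h\in\mathbf{CR}:\mathrm{div}_hv_h=0\}$ and $C$ depends only on $r^\pm$.
   Context: $\Omega\subset\mathbb R^d$, $d\in\{2,3\}$, bounded polygonal/polyhedral Lipschitz domain; $\mathcal T$ conforming shape-regular simplicial triangulation with face set $\mathcal F$. For $K\in\mathcal T$, $\omega_K$ is the interior of the union of all $K'\in\mathcal T$ with $K'\cap K\neq\emptyset$. Jumps $[v]_F=v|_{K_1}-v|_{K_2}$ on interior faces $F=K_1\cap K_2$, trace on boundary faces. $\mathrm{CR}$: piecewise affine functions with $\int_F[v]_F=0$ for all $F\in\mathcal F$; $\mathbf{CR}=\mathrm{CR}^d$; $\widehat S^0_0$: piecewise constants with zero mean. $\nabla_h,\mathrm D_h,\mathrm{div}_h$: element-wise gradient, symmetric gradient, divergence; $\mathrm Dv=\frac12(\nabla v+\nabla v^T)$. $\|\cdot\|_2$ is the $L^2(\Omega)$ norm. N-function: $\psi:[0,\infty)\to[0,\infty)$ continuous, convex, strictly increasing, $\psi(0)=0$, $\psi(t)/t\to0$ ($t\to0$), $\to\infty$ ($t\to\infty$); $\psi'$ right derivative;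 $\psi^*(t)=\sup_{s\ge0}(st-\psi(s))$. Uniformly convex with indices $r^\pm$: $\psi\in W^{2,1}_{loc}((0,\infty))$ and $1<r^-:=\inf_{t>0}\frac{t\psi''(t)}{\psi'(t)}+1\le\sup_{t>0}\frac{t\psi''(t)}{\psi'(t)}+1=:r^+<\infty$. Fix a uniformly convex N-function $\phi\in C^2((0,\infty))$ with indices $r^\pm$; $W^{1,\phi}_0(\Omega)$ Orlicz–Sobolev space with zero trace, $W^{-1,\phi^*}(\Omega)$ its dual, $L^{\phi^*}_0(\Omega)$ zero-mean functions of the Orlicz space $L^{\phi^*}$. $A:\mathbb R^{d\times d}\to\mathbb R^{d\times d}$ is continuous, $C^1$ on $\mathbb R^{d\times d}\setminus\{0\}$, $A(0)=0$, and has $\phi$-structure: there exist $C_0,C_1>0$ with $\sum_{i,j,k,l}\partial_{kl}A_{ij}(Q)P_{ij}P_{kl}\ge C_0\phi''(|Q|)|P|^2$ and $|\partial_{kl}A_{ij}(Q)|\le C_1\phi''(|Q|)$ for all $P$ and all $Q\ne0$. $F(Q)=\sqrt{\phi'(|Q|)|Q|}\,Q/|Q|$, $F(0)=0$. Continuous problem (for $\mathcal D\in\{\nabla,\mathrm D\}$): for $f\in W^{-1,\phi^*}(\Omega)^d$, $(u,p)\in W^{1,\phi}_0(\Omega)^d\times L^{\phi^*}_0(\Omega)$ is the unique solution of $\int_\Omega A(\mathcal Du):\mathcal Dv-\int_\Omega p\,\mathrm{div}v=\langle f,v\rangle$ for all $v\in W^{1,\phi}_0(\Omega)^d$ and $\int_\Omega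 q\,\mathrm{div}u=0$ for all $q\in L^{\phi^*}_0(\Omega)$. Smoothing operator: $E:\mathbf{CR}\to W^{1,\infty}_0(\Omega)^d$ is a linear operator satisfying, with constants depending only on the shape constant, for all $v_h,w_h\in\mathbf{CR}$, $K\in\mathcal T$, $\mathcal D\in\{\nabla,\mathrm D\}$: (E1) $\int_F Ev_h=\int_F v_h$ for all $F\in\mathcal F$; (E2) $\mathrm{div}\,Ev_h=\mathrm{div}_h v_h$; (E3) $\|\nabla Ev_h\|_{L^1(K)}\lesssim\|\nabla_hv_h\|_{L^1(\omega_K)}$; (E4) $\|\mathcal D_h(w_h+Ev_h)\|_{L^\infty(K)}\lesssim\frac1{|K|}\int_K|\mathcal D_h(w_h+Ev_h)|$; (E5) $\|\mathcal D_h(v_h-Ev_h)\|_{L^1(K)}\lesssim\sum_{F\in\mathcal F,F\cap K\neq\emptyset}\int_F|[v_h]_F|$. Method 2: given $f$, find $(u_h,p_h)\in\mathbf{CR}\times\widehat S^0_0$ with $\int_\Omega A(\mathrm DEu_h):\mathrm DEv_h-\int_\Omega p_h\,\mathrm{div}_hv_h=\langle f,Ev_h\rangle$ for all $v_h\in\mathbf{CR}$ and $\int_\Omega q_h\,\mathrm{div}_hu_h=0$ for all $q_h\in\widehat S^0_0$.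
   Formalization: The constant C is allowed to depend on the φ-structure constants C_0, C_1 of A (and on d in {2,3}) as well as on r^±; with dependence on r^± alone the claim fails, e.g. for φ(t)=t²/2 and A(Q)=Q+λ[W,Q] with W antisymmetric and λ large. *)

theory Defs
  imports "HOL-Analysis.Analysis"
begin

definition N_function :: "(real \<Rightarrow> real) \<Rightarrow> bool" where
  "N_function \<psi> \<longleftrightarrow> continuous_on {0..} \<psi> \<and> convex_on {0..} \<psi> \<and> strict_mono_on {0..} \<psi>
     \<and> \<psi> 0 = 0 \<and> ((\<lambda>t. \<psi> t / t) \<longlongrightarrow> 0) (at_right 0)
     \<and> filterlim (\<lambda>t. \<psi> t / t) at_top at_top"

definition C2_pos :: "(real \<Rightarrow> real) \<Rightarrow> bool" where
  "C2_pos \<psi> \<longleftrightarrow> (\<forall>t>0. \<psi> differentiable at t \<and> deriv \<psi> differentiable at t)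
     \<and> continuous_on {0<..} (deriv (deriv \<psi>))"

definition index_set :: "(real \<Rightarrow> real) \<Rightarrow> real set" where
  "index_set \<psi> = {t * deriv (deriv \<psi>) t / deriv \<psi> t + 1 | t. t > 0}"

definition unif_convex_N :: "(real \<Rightarrow> real) \<Rightarrow> real \<Rightarrow> real \<Rightarrow> bool" where
  "unif_convex_N \<psi> rm rp \<longleftrightarrow> N_function \<psi> \<and> C2_pos \<psi>
     \<and> bdd_below (index_set \<psi>) \<and> bdd_above (index_set \<psi>)
     \<and> rm = Inf (index_set \<psi>) \<and> rp = Sup (index_set \<psi>) \<and> 1 < rm"

definition conjN :: "(real \<Rightarrow> real) \<Rightarrow> real \<Rightarrow> real" where
  "conjN \<psi> t = Sup {s * t - \<psi> s | s. s \<ge> 0}"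

definition symm :: "real^'n^'n \<Rightarrow> real^'n^'n" where
  "symm M = (1/2) *\<^sub>R (M + transpose M)"

definition emat :: "'n \<Rightarrow> 'n \<Rightarrow> real^'n^'n" where
  "emat k l = (\<chi> i j. if i = k \<and> j = l then 1 else 0)"

text \<open>A has phi-structure with constants C0, C1 (partial derivatives via the Frechet derivative;
  the Frobenius product is the inner product on real^'n^'n).\<close>
definition phi_structure :: "(real \<Rightarrow> real) \<Rightarrow> (real^'n^'n \<Rightarrow> real^'n^'n) \<Rightarrow> real \<Rightarrow> real \<Rightarrow> bool" where
  "phi_structure \<psi> A C0 C1 \<longleftrightarrow> C0 > 0 \<and> C1 > 0 \<and> continuous_on UNIV A \<and> A 0 = 0
     \<and> (\<forall>Q. Q \<noteq> 0 \<longrightarrow> A differentiable at Q)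
     \<and> (\<forall>k l. continuous_on (UNIV - {0}) (\<lambda>Q. frechet_derivative A (at Q) (emat k l)))
     \<and> (\<forall>Q P. Q \<noteq> 0 \<longrightarrow>
          inner (frechet_derivative A (at Q) P) P \<ge> C0 * deriv (deriv \<psi>) (norm Q) * (norm P)^2)
     \<and> (\<forall>Q i j k l. Q \<noteq> 0 \<longrightarrow>
          \<bar>frechet_derivative A (at Q) (emat k l) $ i $ j\<bar> \<le> C1 * deriv (deriv \<psi>) (norm Q))"

definition Fmap :: "(real \<Rightarrow> real) \<Rightarrow> real^'n^'n \<Rightarrow> real^'n^'n" where
  "Fmap \<psi> Q = (if Q = 0 then 0 else (sqrt (deriv \<psi> (norm Q) * norm Q) / norm Q) *\<^sub>R Q)"

definition lipschitz_domain :: "(real^'n) set \<Rightarrow> bool" where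
  "lipschitz_domain \<Omega> \<longleftrightarrow> open \<Omega> \<and> bounded \<Omega> \<and> connected \<Omega> \<and> \<Omega> \<noteq> {}
     \<and> (\<forall>x\<in>frontier \<Omega>. \<exists>e r L g. norm e = 1 \<and> r > 0
          \<and> (\<forall>y z. inner y e = 0 \<longrightarrow> inner z e = 0 \<longrightarrow> \<bar>g y - g z\<bar> \<le> L * norm (y - z))
          \<and> \<Omega> \<inter> ball x r = {w \<in> ball x r. inner (w - x) e < g ((w - x) - inner (w - x) e *\<^sub>R e)})"

definition in_orlicz :: "(real \<Rightarrow> real) \<Rightarrow> (real^'n) set \<Rightarrow> (real^'n \<Rightarrow> 'b::euclidean_space) \<Rightarrow> bool" where
  "in_orlicz \<psi> \<Omega> f \<longleftrightarrow> f \<in> borel_measurable (lebesgue_on \<Omega>)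
     \<and> (\<exists>s>0. (\<lambda>x. \<psi> (norm (f x) / s)) integrable_on \<Omega>)"

definition lux :: "(real \<Rightarrow> real) \<Rightarrow> (real^'n) set \<Rightarrow> (real^'n \<Rightarrow> 'b::euclidean_space) \<Rightarrow> real" where
  "lux \<psi> \<Omega> f = Inf {s. s > 0 \<and> (\<lambda>x. \<psi> (norm (f x) / s)) integrable_on \<Omega>
                        \<and> integral \<Omega> (\<lambda>x. \<psi> (norm (f x) / s)) \<le> 1}"

definition testfn_g :: "(real^'n) set \<Rightarrow> (real^'n \<Rightarrow> real) \<Rightarrow> (real^'n \<Rightarrow> real^'n) \<Rightarrow> bool" where
  "testfn_g \<Omega> \<psi> g \<longleftrightarrow> (\<forall>x. (\<psi> has_derivative (\<lambda>h. inner (g x) h)) (at x))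
     \<and> continuous_on UNIV g \<and> compact (closure {x. \<psi> x \<noteq> 0}) \<and> closure {x. \<psi> x \<noteq> 0} \<subseteq> \<Omega>"

definition testfn :: "(real^'n) set \<Rightarrow> (real^'n \<Rightarrow> real) \<Rightarrow> bool" where
  "testfn \<Omega> \<psi> \<longleftrightarrow> (\<exists>g. testfn_g \<Omega> \<psi> g)"

definition loc_int :: "(real^'n) set \<Rightarrow> (real^'n \<Rightarrow> real) \<Rightarrow> bool" where
  "loc_int \<Omega> h \<longleftrightarrow> (\<forall>K. compact K \<and> K \<subseteq> \<Omega> \<longrightarrow> h absolutely_integrable_on K)"

definition weak_grad :: "(real^'n) set \<Rightarrow> (real^'n \<Rightarrow> real^'n) \<Rightarrow> (real^'n \<Rightarrow> real^'n^'n) \<Rightarrow> bool" where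
  "weak_grad \<Omega> u G \<longleftrightarrow> (\<forall>i. loc_int \<Omega> (\<lambda>x. u x $ i)) \<and> (\<forall>i j. loc_int \<Omega> (\<lambda>x. G x $ i $ j))
     \<and> (\<forall>\<psi> g. testfn_g \<Omega> \<psi> g \<longrightarrow> (\<forall>i j.
          integral \<Omega> (\<lambda>x. u x $ i * g x $ j) = - integral \<Omega> (\<lambda>x. G x $ i $ j * \<psi> x)))"

definition wgrad :: "(real^'n) set \<Rightarrow> (real^'n \<Rightarrow> real^'n) \<Rightarrow> real^'n \<Rightarrow> real^'n^'n" where
  "wgrad \<Omega> u = (SOME G. weak_grad \<Omega> u G)"

definition W0 :: "(real \<Rightarrow> real) \<Rightarrow> (real^'n) set \<Rightarrow> (real^'n \<Rightarrow> real^'n) \<Rightarrow> bool" where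
  "W0 \<psi> \<Omega> u \<longleftrightarrow> in_orlicz \<psi> \<Omega> u \<and> (\<exists>G. weak_grad \<Omega> u G \<and> in_orlicz \<psi> \<Omega> G
     \<and> (\<exists>w. (\<forall>k i. testfn \<Omega> (\<lambda>x. w k x $ i))
          \<and> (\<lambda>k. lux \<psi> \<Omega> (\<lambda>x. w k x - u x) + lux \<psi> \<Omega> (\<lambda>x. wgrad \<Omega> (w k) x - G x)) \<longlonglongrightarrow> 0))"

definition W_norm :: "(real \<Rightarrow> real) \<Rightarrow> (real^'n) set \<Rightarrow> (real^'n \<Rightarrow> real^'n) \<Rightarrow> real" where
  "W_norm \<psi> \<Omega> v = lux \<psi> \<Omega> v + lux \<psi> \<Omega> (wgrad \<Omega> v)"

definition in_dual :: "(real \<Rightarrow> real) \<Rightarrow> (real^'n) set \<Rightarrow> ((real^'n \<Rightarrow> real^'n) \<Rightarrow> real) \<Rightarrow> bool" where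
  "in_dual \<psi> \<Omega> f \<longleftrightarrow>
     (\<forall>v w a b. W0 \<psi> \<Omega> v \<longrightarrow> W0 \<psi> \<Omega> w \<longrightarrow> f (\<lambda>x. a *\<^sub>R v x + b *\<^sub>R w x) = a * f v + b * f w)
     \<and> (\<exists>M. \<forall>v. W0 \<psi> \<Omega> v \<longrightarrow> \<bar>f v\<bar> \<le> M * W_norm \<psi> \<Omega> v)"

definition stokes_sol :: "(real \<Rightarrow> real) \<Rightarrow> (real^'n^'n \<Rightarrow> real^'n^'n) \<Rightarrow> (real^'n) set
     \<Rightarrow> ((real^'n \<Rightarrow> real^'n) \<Rightarrow> real) \<Rightarrow> (real^'n \<Rightarrow> real^'n) \<Rightarrow> (real^'n \<Rightarrow> real) \<Rightarrow> bool" where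
  "stokes_sol \<psi> A \<Omega> f u p \<longleftrightarrow> W0 \<psi> \<Omega> u \<and> in_orlicz (conjN \<psi>) \<Omega> p \<and> integral \<Omega> p = 0
     \<and> (\<forall>v. W0 \<psi> \<Omega> v \<longrightarrow>
          integral \<Omega> (\<lambda>x. inner (A (symm (wgrad \<Omega> u x))) (symm (wgrad \<Omega> v x)))
          - integral \<Omega> (\<lambda>x. p x * trace (wgrad \<Omega> v x)) = f v)
     \<and> (\<forall>q. in_orlicz (conjN \<psi>) \<Omega> q \<and> integral \<Omega> q = 0 \<longrightarrow>
          integral \<Omega> (\<lambda>x. q x * trace (wgrad \<Omega> u x)) = 0)"

definition vertices :: "(real^'n) set \<Rightarrow> (real^'n) set" where
  "vertices K = {x. x extreme_point_of K}"

definition triangulation :: "(real^'n) set set \<Rightarrow> (real^'n) set \<Rightarrow> bool" where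
  "triangulation T \<Omega> \<longleftrightarrow> finite T \<and> T \<noteq> {}
     \<and> (\<forall>K\<in>T. \<exists>S. K = convex hull S \<and> \<not> affine_dependent S \<and> card S = CARD('n) + 1)
     \<and> \<Union>T = closure \<Omega>
     \<and> (\<forall>K\<in>T. \<forall>K'\<in>T. K \<inter> K' = convex hull (vertices K \<inter> vertices K'))"

definition faces :: "(real^'n) set set \<Rightarrow> (real^'n) set set" where
  "faces T = {convex hull (vertices K - {a}) | K a. K \<in> T \<and> a \<in> vertices K}"

text \<open>Surface integral over a flat (d-1)-simplex F: integrate g composed with the orthogonal
  projection onto aff(F) over the slab of width 1 above F (Fubini).\<close>
definition face_int :: "(real^'n) set \<Rightarrow> (real^'n \<Rightarrow> 'b::euclidean_space) \<Rightarrow> 'b" where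
  "face_int F g = integral {y. closest_point (affine hull F) y \<in> F
                              \<and> dist y (closest_point (affine hull F) y) \<le> 1/2}
                       (\<lambda>y. g (closest_point (affine hull F) y))"

text \<open>Piecewise functions are families indexed by the elements.\<close>
definition jump :: "(real^'n) set set \<Rightarrow> ((real^'n) set \<Rightarrow> real^'n \<Rightarrow> 'b::real_vector)
     \<Rightarrow> (real^'n) set \<Rightarrow> real^'n \<Rightarrow> 'b" where
  "jump T v F x = (if \<exists>K1 K2. K1 \<in> T \<and> K2 \<in> T \<and> K1 \<noteq> K2 \<and> F = K1 \<inter> K2
      then (case (SOME (K1, K2). K1 \<in> T \<and> K2 \<in> T \<and> K1 \<noteq> K2 \<and> F = K1 \<inter> K2) of
              (K1, K2) \<Rightarrow> v K1 x - v K2 x)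
      else v (SOME K. K \<in> T \<and> F \<subseteq> K) x)"

definition affine_map :: "(real^'n \<Rightarrow> real^'n) \<Rightarrow> bool" where
  "affine_map f \<longleftrightarrow> (\<exists>M c. \<forall>x. f x = M *v x + c)"

definition lingrad :: "(real^'n \<Rightarrow> real^'n) \<Rightarrow> real^'n^'n" where
  "lingrad f = (SOME M. \<exists>c. \<forall>x. f x = M *v x + c)"

definition CR :: "(real^'n) set set \<Rightarrow> ((real^'n) set \<Rightarrow> real^'n \<Rightarrow> real^'n) set" where
  "CR T = {v. (\<forall>K\<in>T. affine_map (v K)) \<and> (\<forall>K. K \<notin> T \<longrightarrow> v K = (\<lambda>_. 0))
             \<and> (\<forall>F\<in>faces T. face_int F (jump T v F) = 0)}"

definition S00 :: "(real^'n) set set \<Rightarrow> ((real^'n) set \<Rightarrow> real) set" where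
  "S00 T = {q. (\<forall>K. K \<notin> T \<longrightarrow> q K = 0) \<and> (\<Sum>K\<in>T. measure lebesgue K * q K) = 0}"

definition divh_int :: "(real^'n) set set \<Rightarrow> ((real^'n) set \<Rightarrow> real)
     \<Rightarrow> ((real^'n) set \<Rightarrow> real^'n \<Rightarrow> real^'n) \<Rightarrow> real" where
  "divh_int T q v = (\<Sum>K\<in>T. measure lebesgue K * q K * trace (lingrad (v K)))"

definition gradh :: "(real^'n) set set \<Rightarrow> ((real^'n) set \<Rightarrow> real^'n \<Rightarrow> real^'n) \<Rightarrow> real^'n \<Rightarrow> real^'n^'n" where
  "gradh T v x = (if \<exists>K\<in>T. x \<in> interior K
      then lingrad (v (SOME K. K \<in> T \<and> x \<in> interior K)) else 0)"

definition patch :: "(real^'n) set set \<Rightarrow> (real^'n) set \<Rightarrow> (real^'n) set" where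
  "patch T K = interior (\<Union>{K'\<in>T. K' \<inter> K \<noteq> {}})"

definition Zh :: "(real^'n) set set \<Rightarrow> ((real^'n) set \<Rightarrow> real^'n \<Rightarrow> real^'n) set" where
  "Zh T = {v \<in> CR T. \<forall>K\<in>T. trace (lingrad (v K)) = 0}"

definition smoothing :: "(real^'n) set set \<Rightarrow> (real^'n) set
     \<Rightarrow> (((real^'n) set \<Rightarrow> real^'n \<Rightarrow> real^'n) \<Rightarrow> real^'n \<Rightarrow> real^'n) \<Rightarrow> bool" where
  "smoothing T \<Omega> E \<longleftrightarrow>
     (\<forall>v\<in>CR T. \<forall>w\<in>CR T. \<forall>a b. E (\<lambda>K x. a *\<^sub>R v K x + b *\<^sub>R w K x) = (\<lambda>x. a *\<^sub>R E v x + b *\<^sub>R E w x))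
   \<and> (\<forall>v\<in>CR T. (\<exists>L. L-lipschitz_on UNIV (E v)) \<and> (\<forall>x. x \<notin> \<Omega> \<longrightarrow> E v x = 0))
   \<and> (\<forall>v\<in>CR T. \<forall>F\<in>faces T. face_int F (E v) = face_int F (v (SOME K. K \<in> T \<and> F \<subseteq> K)))
   \<and> (\<forall>v\<in>CR T. AE x in lebesgue. \<forall>K\<in>T. x \<in> interior K \<longrightarrow>
          trace (wgrad \<Omega> (E v) x) = trace (lingrad (v K)))
   \<and> (\<exists>c>0.
       (\<forall>v\<in>CR T. \<forall>K\<in>T. integral K (\<lambda>x. norm (wgrad \<Omega> (E v) x))
            \<le> c * integral (patch T K) (\<lambda>x. norm (gradh T v x)))
     \<and> (\<forall>v\<in>CR T. \<forall>w\<in>CR T. \<forall>K\<in>T. \<forall>Dop\<in>{id, symm}. AE x in lebesgue. x \<in> K \<longrightarrow>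
            norm (Dop (gradh T w x + wgrad \<Omega> (E v) x))
              \<le> c / measure lebesgue K * integral K (\<lambda>y. norm (Dop (gradh T w y + wgrad \<Omega> (E v) y))))
     \<and> (\<forall>v\<in>CR T. \<forall>K\<in>T. \<forall>Dop\<in>{id, symm}.
            integral K (\<lambda>x. norm (Dop (gradh T v x - wgrad \<Omega> (E v) x)))
              \<le> c * (\<Sum>F\<in>{F\<in>faces T. F \<inter> K \<noteq> {}}. face_int F (\<lambda>x. norm (jump T v F x)))))"

definition method2 :: "(real^'n^'n \<Rightarrow> real^'n^'n) \<Rightarrow> (real^'n) set \<Rightarrow> (real^'n) set set
     \<Rightarrow> (((real^'n) set \<Rightarrow> real^'n \<Rightarrow> real^'n) \<Rightarrow> real^'n \<Rightarrow> real^'n)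
     \<Rightarrow> ((real^'n \<Rightarrow> real^'n) \<Rightarrow> real)
     \<Rightarrow> ((real^'n) set \<Rightarrow> real^'n \<Rightarrow> real^'n) \<Rightarrow> ((real^'n) set \<Rightarrow> real) \<Rightarrow> bool" where
  "method2 A \<Omega> T E f uh ph \<longleftrightarrow> uh \<in> CR T \<and> ph \<in> S00 T
     \<and> (\<forall>vh\<in>CR T. integral \<Omega> (\<lambda>x. inner (A (symm (wgrad \<Omega> (E uh) x))) (symm (wgrad \<Omega> (E vh) x)))
                   - divh_int T ph vh = f (E vh))
     \<and> (\<forall>qh\<in>S00 T. divh_int T qh uh = 0)"

definition L2norm :: "(real^'n) set \<Rightarrow> (real^'n \<Rightarrow> real^'n^'n) \<Rightarrow> real" where
  "L2norm \<Omega> h = sqrt (integral \<Omega> (\<lambda>x. (norm (h x))^2))"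

end

theory Submission
  imports Defs
begin

text \<open>Write \<open>P = Du\<close>, \<open>Q = D(E u\<^sub>h)\<close> and \<open>R = D(E v\<^sub>h)\<close> for some \<open>v\<^sub>h \<in> Z\<^sub>h\<close>.
  The growth of \<open>\<phi>\<close> and the structure of \<open>A\<close> give
  \<open>|F P - F Q|\<^sup>2 \<le> B |F P - F R|\<^sup>2 + D (A P - A Q) : (R - Q)\<close> pointwise: all the quantities involved are
  comparable to the shifted function \<open>\<phi>'(p + x) / (p + x) x\<^sup>2\<close> with \<open>p = |P|\<close> and \<open>x = |P - Q|\<close>, which
  satisfies a Young inequality.  Since \<open>E\<close> preserves the divergence, \<open>E u\<^sub>h\<close> and \<open>E v\<^sub>h\<close> are divergence-free
  test functions for the continuous problem, the pressures disappear, and both problems have the same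
  right-hand side; hence the last term integrates to zero.

  That \<open>E v\<^sub>h\<close> is an admissible test function requires Lipschitz functions vanishing outside a bounded open
  set to lie in the closure of the test functions: truncate, mollify, and pass to an energy-minimising
  sequence to obtain strongly convergent gradients.\<close>

text \<open>Young's inequality can be applied only if the estimates for \<open>Q\<close> and for
  \<open>R\<close> carry the same shift. The natural estimates come out weighted at the larger of
  the two norms, so they are first rewritten with \<open>|P|\<close> and the distance to
  \<open>P\<close>. The coercive term is
  \<open>(A P - A Q) : (P - R) + (A P - A Q) : (R - Q)\<close>; Young splits the first summand so
  that half of the coercive term absorbs part of it. All constants come from \<open>rm - 1\<close>,
  \<open>nat \<lceil>rp\<rceil>\<close>, \<open>C0\<close>, \<open>C1\<close> and the dimension.

  Differentiability of \<open>A\<close> is given only off the origin, so segments through or near 0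
  need separate arguments. The discrete equation tests the divergence only with zero-mean pressures;
  that the discrete divergence is itself one of them needs the divergence theorem for
  \<open>E uh\<close>, obtained from the same approximation by test functions. Finally,
  \<open>wgrad\<close> is a choice, fixed only up to null sets, and \<open>integral\<close> is 0 for
  non-integrable functions, so linearity of the integral has to be earned through measurable
  representatives and explicit dominating functions.\<close>

section \<open>Structure functions of power growth\<close>

text \<open>\<open>d\<close> and \<open>dd\<close> stand for the first two derivatives of the
  N-function; \<open>lower\<close> and \<open>upper\<close> are the index bounds
  \<open>a \<le> t * dd t / d t \<le> N\<close>. The upper exponent is a natural number so that
  plain powers and Bernoulli's inequality are available.\<close>

locale power_growth =
  fixes d dd :: "real \<Rightarrow> real" and N :: nat and a :: real
  assumes deriv: "\<And>t. t > 0 \<Longrightarrow> (d has_real_derivative dd t) (at t)"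
    and pos: "\<And>t. t > 0 \<Longrightarrow> d t > 0"
    and a_pos: "a > 0"
    and lower: "\<And>t. t > 0 \<Longrightarrow> a * d t \<le> t * dd t"
    and upper: "\<And>t. t > 0 \<Longrightarrow> t * dd t \<le> real N * d t"
begin

lemma dd_nonneg: "t > 0 \<Longrightarrow> dd t > 0"
  using lower[of t] pos[of t] a_pos by (smt (verit, best) mult_pos_pos zero_less_mult_pos)

lemma mono: "0 < s \<Longrightarrow> s \<le> t \<Longrightarrow> d s \<le> d t"
  by (rule DERIV_nonneg_imp_nondecreasing) (auto intro!: exI[of _ "dd _"] deriv less_imp_le dd_nonneg)

lemma N_pos: "N > 0"
  using lower[of 1] upper[of 1] pos[of 1] a_pos
  by (smt (verit, best) mult_pos_pos gr0I mult_eq_0_iff of_nat_0)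

text \<open>The upper index bound makes \<open>d t / t ^ N\<close> nonincreasing: its derivative has
  the sign of \<open>t * dd t - N * d t\<close>.\<close>

lemma scaling:
  assumes "0 < q" "q \<le> p"
  shows "d p * q ^ N \<le> d q * p ^ N"
proof -
  have "d p / p ^ N \<le> d q / q ^ N"
  proof (rule DERIV_nonpos_imp_nonincreasing[OF assms(2)])
    fix x assume x: "q \<le> x" "x \<le> p"
    hence xp: "x > 0" using assms by auto
    have "((\<lambda>t. d t / t ^ N) has_real_derivative
       (dd x * x ^ N - d x * (real N * x ^ (N - 1))) / (x ^ N * x ^ N)) (at x)"
      using xp by (auto intro!: derivative_eq_intros deriv)
    moreover have "dd x * x ^ N - d x * (real N * x ^ (N - 1)) = (x * dd x - real N * d x) * x ^ (N - 1)"
      using N_pos by (cases N) (auto simp: algebra_simps)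
    hence "(dd x * x ^ N - d x * (real N * x ^ (N - 1))) / (x ^ N * x ^ N) \<le> 0"
      using upper[OF xp] xp by (simp add: divide_nonpos_nonneg mult_nonpos_nonneg)
    ultimately show "\<exists>y. ((\<lambda>t. d t / t ^ N) has_real_derivative y) (at x) \<and> y \<le> 0" by blast
  qed
  thus ?thesis using assms by (simp add: field_simps)
qed

text \<open>Monotonicity moves from \<open>p\<close> to \<open>c * q\<close>, and
  \<open>scaling\<close> from there to \<open>q\<close>; this is the doubling condition for
  \<open>d\<close>.\<close>

lemma scaling_le:
  assumes "0 < q" "1 \<le> c" "p \<le> c * q" "0 < p"
  shows "d p \<le> c ^ N * d q"
proof -
  have "d p \<le> d (c * q)" using assms by (intro mono) auto
  also have "d (c * q) * q ^ N \<le> d q * (c * q) ^ N"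
    using assms by (intro scaling) (auto intro: mult_right_mono[of 1 c q, simplified])
  hence "d (c * q) \<le> c ^ N * d q" using assms by (simp add: power_mult_distrib mult_ac)
  finally show ?thesis .
qed

text \<open>The scalar function behind \<open>F\<close>: \<open>|F P| = sqrt (d p * p)\<close> with \<open>p = |P|\<close>.\<close>

definition h :: "real \<Rightarrow> real" where "h t = sqrt (d t * t)"

text \<open>With \<open>r = q / p\<close> the function \<open>h\<close> is squeezed as
  \<open>r ^ N * h p \<le> h q \<le> sqrt r * h p\<close>: the right half is monotonicity of
  \<open>d\<close>, the left half is \<open>scaling\<close>. Increments are then compared through
  \<open>1 - r \<le> 2 * (1 - sqrt r)\<close> and Bernoulli's
  \<open>1 - r ^ N \<le> N * (1 - r)\<close>.\<close>

lemma h_bounds: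
  assumes "0 \<le> q" "q \<le> p" "0 < p"
  shows "0 \<le> h q" "h q \<le> h p" "h p * (1 - q / p) \<le> 2 * (h p - h q)"
    "h p - h q \<le> real N * h p * (1 - q / p)" "p \<le> 2 * q \<Longrightarrow> h p \<le> 2 ^ N * h q"
    "h p > 0" "(h p)\<^sup>2 = d p * p"
proof -
  have hq0: "h 0 = 0" by (simp add: h_def)
  show hq: "0 \<le> h q"
    using assms pos[of q] by (cases "q = 0") (auto simp: h_def)
  show hp: "h p > 0" using pos[of p] assms by (simp add: h_def)
  show h2: "(h p)\<^sup>2 = d p * p" using pos[of p] assms by (simp add: h_def)
  have Np: "real N \<ge> 1" using N_pos by simp
  have key: "h q \<le> h p \<and> h p * (1 - q / p) \<le> 2 * (h p - h q) \<and>
    h p - h q \<le> real N * h p * (1 - q / p) \<and> (p \<le> 2 * q \<longrightarrow> h p \<le> 2 ^ N * h q)"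
  proof (cases "q = 0")
    case True
    thus ?thesis using hp hq0 Np assms by simp
  next
    case False
    hence q: "q > 0" using assms by simp
    define r where "r = q / p"
    have r: "0 < r" "r \<le> 1" using q assms by (auto simp: r_def)
    have hq2: "(h q)\<^sup>2 = d q * q" using pos[of q] q by (simp add: h_def)
    have "d q * q \<le> d p * q" using mono[of q p] q assms by (intro mult_right_mono) auto
    also have "\<dots> = (h p)\<^sup>2 * r" using h2 assms by (simp add: r_def)
    finally have u: "(h q)\<^sup>2 \<le> (h p * sqrt r)\<^sup>2" using hq2 r by (simp add: power_mult_distrib)
    hence u': "h q \<le> h p * sqrt r" by (rule power2_le_imp_le) (use hp r in simp)
    have "d p * r ^ N \<le> d q"
      using scaling[of q p] q assms by (simp add: r_def power_divide field_simps)
    hence l0: "d p * r ^ N * q \<le> d q * q" using q by (intro mult_right_mono) auto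
    have "(h p * r ^ N)\<^sup>2 = d p * p * (r ^ N * r ^ N)" using h2
      by (simp add: power_mult_distrib power2_eq_square)
    \<comment> \<open>\<open>scaling\<close> yields the exponent \<open>N + 1\<close> under the
      square. Since \<open>N \<ge> 1\<close> and \<open>r \<le> 1\<close> it may be raised to
      \<open>2 * N\<close>, whose root is a plain power.\<close>
    also have rN: "r ^ N * r ^ N \<le> r ^ N * r"
      using r N_pos power_decreasing[of 1 N r] by (intro mult_left_mono) auto
    have "d p * p * (r ^ N * r ^ N) \<le> d p * p * (r ^ N * r)"
      using pos[of p] assms by (intro mult_left_mono[OF rN]) auto
    also have "\<dots> = d p * r ^ N * q" using assms by (simp add: r_def)
    finally have "(h p * r ^ N)\<^sup>2 \<le> (h q)\<^sup>2" using l0 hq2 by simp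
    hence l: "h p * r ^ N \<le> h q" using hq by (rule power2_le_imp_le)
    have s: "sqrt r \<le> 1" "0 \<le> sqrt r" "sqrt r * sqrt r = r" using r by auto
    have 1: "h q \<le> h p" using mult_left_le[OF s(1) less_imp_le[OF hp]] u' by linarith
    have "(1 - sqrt r) * (1 + sqrt r) \<le> (1 - sqrt r) * 2" using s by (intro mult_left_mono) auto
    moreover have "(1 - sqrt r) * (1 + sqrt r) = 1 - r" using s by (simp add: algebra_simps)
    ultimately have "1 - r \<le> 2 * (1 - sqrt r)" by simp
    hence "h p * (1 - r) \<le> h p * (2 * (1 - sqrt r))" using hp by (intro mult_left_mono) auto
    also have "\<dots> \<le> 2 * (h p - h q)" using u' by (simp add: algebra_simps)
    finally have 2: "h p * (1 - r) \<le> 2 * (h p - h q)" .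
    have "1 + real N * (r - 1) \<le> r ^ N"
      using Bernoulli_inequality[of "r - 1" N] r by simp
    hence "1 - r ^ N \<le> real N * (1 - r)" by (simp add: algebra_simps)
    hence "h p * (1 - r ^ N) \<le> h p * (real N * (1 - r))" using hp by (intro mult_left_mono) auto
    with l have 3: "h p - h q \<le> real N * h p * (1 - r)" by (simp add: algebra_simps)
    have 4: "h p \<le> 2 ^ N * h q" if "p \<le> 2 * q"
    proof -
      have "1 / 2 \<le> r" using that assms by (simp add: r_def field_simps)
      hence "(1 / 2) ^ N \<le> r ^ N" by (intro power_mono) auto
      hence "h p * (1 / 2) ^ N \<le> h p * r ^ N" using hp by (intro mult_left_mono) auto
      also have "\<dots> \<le> h q" by (rule l)
      finally show ?thesis by (simp add: power_divide field_simps)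
    qed
    show ?thesis using 1 2 3 4 by (auto simp: r_def)
  qed
  show "h q \<le> h p" "h p * (1 - q / p) \<le> 2 * (h p - h q)"
    "h p - h q \<le> real N * h p * (1 - q / p)" "p \<le> 2 * q \<Longrightarrow> h p \<le> 2 ^ N * h q"
    using key by auto
qed

end

section \<open>Comparison of F with a weighted quadratic form\<close>

lemma norm_diff_unit:
  fixes x y :: "'a::real_inner"
  assumes "norm x = 1" "norm y = 1"
  shows "(norm (a *\<^sub>R x - b *\<^sub>R y))\<^sup>2 = (a - b)\<^sup>2 + a * b * (norm (x - y))\<^sup>2"
proof -
  have "inner x x = 1" "inner y y = 1" using assms by (simp_all add: dot_square_norm)
  thus ?thesis
    unfolding power2_norm_eq_inner
    by (simp add: inner_diff_left inner_diff_right inner_commute[of y x] power2_eq_square algebra_simps)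
qed

text \<open>\<open>Fmap\<close> changes the length of a matrix and keeps its direction, so both
  expansions contain the same angular term \<open>w\<close>, the squared distance of the two
  directions. What remains is a comparison of scalars. If one matrix is zero, \<open>w\<close> is
  multiplied by zero and 0 is as good as any value.\<close>

lemma polar_expansion:
  fixes P Q :: "real^'n^'n"
  assumes "\<And>t. t > 0 \<Longrightarrow> deriv \<phi> t > 0"
  obtains w where "0 \<le> w" "w \<le> 4"
    "(norm (P - Q))\<^sup>2 = (norm P - norm Q)\<^sup>2 + norm P * norm Q * w"
    "(norm (Fmap \<phi> P - Fmap \<phi> Q))\<^sup>2 =
      (sqrt (deriv \<phi> (norm P) * norm P) - sqrt (deriv \<phi> (norm Q) * norm Q))\<^sup>2
      + sqrt (deriv \<phi> (norm P) * norm P) * sqrt (deriv \<phi> (norm Q) * norm Q) * w"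
proof (cases "P = 0 \<or> Q = 0")
  case True
  have "(norm (Fmap \<phi> X))\<^sup>2 = (sqrt (deriv \<phi> (norm X) * norm X))\<^sup>2" for X :: "real^'n^'n"
    using assms[of "norm X"] by (auto simp: Fmap_def)
  with True show ?thesis by (intro that[of 0]) (auto simp: Fmap_def)
next
  case False
  have F: "Fmap \<phi> X = sqrt (deriv \<phi> (norm X) * norm X) *\<^sub>R (X /\<^sub>R norm X)"
    and X: "X = norm X *\<^sub>R (X /\<^sub>R norm X)" and n: "norm (X /\<^sub>R norm X) = 1"
    if "X \<noteq> 0" for X :: "real^'n^'n"
    using that by (auto simp: Fmap_def divide_inverse)
  define w where "w = (norm (P /\<^sub>R norm P - Q /\<^sub>R norm Q))\<^sup>2"
  have "norm (P /\<^sub>R norm P - Q /\<^sub>R norm Q) \<le> 2"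
    using norm_triangle_ineq4[of "P /\<^sub>R norm P" "Q /\<^sub>R norm Q"] n False by auto
  hence w4: "w \<le> 4" using power_mono[of "norm (P /\<^sub>R norm P - Q /\<^sub>R norm Q)" 2 2] by (simp add: w_def)
  have "w \<ge> 0" by (simp add: w_def)
  moreover note w4
  moreover have "(norm (P - Q))\<^sup>2 = (norm P - norm Q)\<^sup>2 + norm P * norm Q * w"
    using norm_diff_unit[of "P /\<^sub>R norm P" "Q /\<^sub>R norm Q" "norm P" "norm Q"] n X False
    unfolding w_def by metis
  moreover have "(norm (Fmap \<phi> P - Fmap \<phi> Q))\<^sup>2 =
      (sqrt (deriv \<phi> (norm P) * norm P) - sqrt (deriv \<phi> (norm Q) * norm Q))\<^sup>2
      + sqrt (deriv \<phi> (norm P) * norm P) * sqrt (deriv \<phi> (norm Q) * norm Q) * w"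
    using norm_diff_unit[of "P /\<^sub>R norm P" "Q /\<^sub>R norm Q"
        "sqrt (deriv \<phi> (norm P) * norm P)" "sqrt (deriv \<phi> (norm Q) * norm Q)"] n F False
    unfolding w_def by metis
  ultimately show ?thesis by (rule that)
qed

text \<open>In polar form \<open>S\<close> is \<open>(h p)^2 * ((1 - r)^2 + r * w)\<close> and the
  squared distance of the images is \<open>(h p - h q)^2 + h p * h q * w\<close>.
  \<open>h_bounds\<close> compares the radial parts. For \<open>r \<le> 1/2\<close> the bound
  \<open>w \<le> 4\<close> lets the radial part dominate the angular one; for \<open>r > 1/2\<close>
  the angular weights are comparable, as \<open>h q\<close> lies between \<open>h p / 2 ^ N\<close>
  and \<open>h p\<close>.\<close>

lemma Fmap_diff_bounds:
  fixes P Q :: "real^'n^'n"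
  assumes "power_growth (deriv \<phi>) dd N a" "norm Q \<le> norm P" "P \<noteq> 0"
  defines "S \<equiv> deriv \<phi> (norm P) / norm P * (norm (P - Q))\<^sup>2"
  shows "(norm (Fmap \<phi> P - Fmap \<phi> Q))\<^sup>2 \<le> (real N ^ 2 + 16) * S"
    and "S \<le> (36 + 2 ^ N) * (norm (Fmap \<phi> P - Fmap \<phi> Q))\<^sup>2"
proof -
  interpret power_growth "deriv \<phi>" dd N a by fact
  define p where "p = norm P"
  define q where "q = norm Q"
  define r where "r = q / p"
  have pq: "0 \<le> q" "q \<le> p" "0 < p" using assms by (auto simp: p_def q_def)
  have r: "0 \<le> r" "r \<le> 1" "q = r * p" using pq by (auto simp: r_def)
  note H = h_bounds[OF pq, folded r_def]
  obtain w where w: "0 \<le> w" "w \<le> 4"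
    and e1: "(norm (P - Q))\<^sup>2 = (p - q)\<^sup>2 + p * q * w"
    and e2: "(norm (Fmap \<phi> P - Fmap \<phi> Q))\<^sup>2 = (h p - h q)\<^sup>2 + h p * h q * w"
    using polar_expansion[of \<phi> P Q] pos unfolding p_def q_def h_def by metis
  have S: "S = (h p)\<^sup>2 * ((1 - r)\<^sup>2 + r * w)"
    unfolding S_def e1 p_def[symmetric] H(7) using pq r
    by (simp add: power2_eq_square field_simps)
  have A: "(h p * (1 - r))\<^sup>2 \<le> (2 * (h p - h q))\<^sup>2"
    using H r by (intro power_mono) auto
  have B: "(h p - h q)\<^sup>2 \<le> (real N * h p * (1 - r))\<^sup>2"
    using H r by (intro power_mono) auto
  have hh: "h p * h q \<le> (h p)\<^sup>2" "0 \<le> h p * h q" using H(1,2,6)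
    by (auto simp: power2_eq_square intro!: mult_left_mono mult_nonneg_nonneg)
  show "(norm (Fmap \<phi> P - Fmap \<phi> Q))\<^sup>2 \<le> (real N ^ 2 + 16) * S"
  proof -
    \<comment> \<open>16 is 4 divided by 1/4: for \<open>r \<le> 1/2\<close> one has
      \<open>w \<le> 4\<close> and \<open>(1 - r)^2 \<ge> 1/4\<close>.\<close>
    have "h p * h q * w \<le> 16 * ((h p)\<^sup>2 * ((1 - r)\<^sup>2 + r * w))"
    proof (cases "r \<le> 1 / 2")
      case True
      have "h p * h q * w \<le> (h p)\<^sup>2 * 4" using hh w by (intro mult_mono) auto
      moreover have "(1 / 2)\<^sup>2 \<le> (1 - r)\<^sup>2" using True by (intro power_mono) auto
      hence "1 / 4 \<le> (1 - r)\<^sup>2 + r * w" using r w by (simp add: power2_eq_square add_increasing2)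
      hence "(h p)\<^sup>2 * (1 / 4) \<le> (h p)\<^sup>2 * ((1 - r)\<^sup>2 + r * w)" by (intro mult_left_mono) auto
      ultimately show ?thesis by linarith
    next
      case False
      have "h p * h q * w \<le> (h p)\<^sup>2 * w" using hh w by (intro mult_right_mono) auto
      moreover have "w \<le> 16 * ((1 - r)\<^sup>2 + r * w)"
        using False w(1) mult_right_mono[of "1/2" r w] zero_le_power2[of "1 - r"]
          mult_nonneg_nonneg[OF r(1) w(1)] unfolding distrib_left by linarith
      hence "(h p)\<^sup>2 * w \<le> (h p)\<^sup>2 * (16 * ((1 - r)\<^sup>2 + r * w))" by (intro mult_left_mono) auto
      ultimately show ?thesis by (simp add: algebra_simps)
    qed
    moreover have "(h p - h q)\<^sup>2 \<le> (real N)\<^sup>2 * ((h p)\<^sup>2 * ((1 - r)\<^sup>2 + r * w))"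
    proof -
      have "(h p - h q)\<^sup>2 \<le> (real N)\<^sup>2 * ((h p)\<^sup>2 * (1 - r)\<^sup>2)" using B by (simp add: power_mult_distrib mult_ac)
      also have "\<dots> \<le> (real N)\<^sup>2 * ((h p)\<^sup>2 * ((1 - r)\<^sup>2 + r * w))"
        using r w by (intro mult_left_mono) auto
      finally show ?thesis .
    qed
    ultimately show ?thesis unfolding e2 S by (simp add: algebra_simps)
  qed
  show "S \<le> (36 + 2 ^ N) * (norm (Fmap \<phi> P - Fmap \<phi> Q))\<^sup>2"
  proof (cases "r \<le> 1 / 2")
    case True
    have "r * w \<le> (1/2) * 4" using r w True by (intro mult_mono) auto
    moreover have "(1/2)\<^sup>2 \<le> (1 - r)\<^sup>2" using True by (intro power_mono) auto
    hence "1/4 \<le> (1 - r)\<^sup>2" by (simp add: power2_eq_square)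
    \<comment> \<open>\<open>r * w \<le> 2\<close> and \<open>(1 - r)^2 \<ge> 1/4\<close> give
      \<open>r * w \<le> 8 * (1 - r)^2\<close>; the square of the factor 2 in \<open>A\<close> then
      turns 9 into 36.\<close>
    ultimately have "(1 - r)\<^sup>2 + r * w \<le> 9 * (1 - r)\<^sup>2" by simp
    hence "S \<le> (h p)\<^sup>2 * (9 * (1 - r)\<^sup>2)" unfolding S by (intro mult_left_mono) auto
    also have "\<dots> = 9 * (h p * (1 - r))\<^sup>2" by (simp add: power_mult_distrib)
    also have "\<dots> \<le> 9 * (2 * (h p - h q))\<^sup>2" using A by simp
    also have "\<dots> = 36 * (h p - h q)\<^sup>2" by (simp only: power_mult_distrib) simp
    also have "\<dots> \<le> (36 + 2 ^ N) * ((h p - h q)\<^sup>2 + h p * h q * w)"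
      using hh w by (intro mult_mono) auto
    finally show ?thesis unfolding e2 .
  next
    case False
    hence "p \<le> 2 * q" using pq by (simp add: r_def field_simps)
    hence "h p * h p \<le> h p * (2 ^ N * h q)" using H by (intro mult_left_mono) auto
    hence "(h p)\<^sup>2 * (r * w) \<le> (2 ^ N * (h p * h q)) * (1 * w)" using r w hh
      by (intro mult_mono) (auto simp: power2_eq_square algebra_simps mult_left_le_one_le)
    moreover have "(h p)\<^sup>2 * (1 - r)\<^sup>2 \<le> 4 * (h p - h q)\<^sup>2" using A by (simp only: power_mult_distrib) simp
    ultimately have "S \<le> 4 * (h p - h q)\<^sup>2 + 2 ^ N * (h p * h q * w)"
      unfolding S by (simp add: algebra_simps)
    also have "\<dots> \<le> (36 + 2 ^ N) * (h p - h q)\<^sup>2 + (36 + 2 ^ N) * (h p * h q * w)"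
      using hh w by (intro add_mono mult_right_mono) auto
    finally show ?thesis unfolding e2 by (simp add: distrib_left)
  qed
qed

section \<open>Growth and strict monotonicity of the operator A\<close>

lemma norm_matrix_le:
  fixes M :: "real^'n^'n"
  assumes "\<And>i j. \<bar>M $ i $ j\<bar> \<le> B"
  shows "norm M \<le> real CARD('n) ^ 2 * B"
proof -
  have "norm M \<le> (\<Sum>i\<in>UNIV. norm (M $ i))" 
    by (simp add: norm_vec_def L2_set_le_sum)
  also have "\<dots> \<le> (\<Sum>i\<in>UNIV. \<Sum>j\<in>UNIV. norm (M $ i $ j))"
    by (intro sum_mono) (simp add: norm_vec_def[of "M $ _"] L2_set_le_sum)
  also have "\<dots> \<le> (\<Sum>i\<in>(UNIV::'n set). \<Sum>j\<in>(UNIV::'n set). B)"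
    using assms by (intro sum_mono) auto
  finally show ?thesis by (simp add: power2_eq_square)
qed

lemma matrix_eq_sum_emat:
  fixes M :: "real^'n^'n"
  shows "M = (\<Sum>k\<in>UNIV. \<Sum>l\<in>UNIV. (M $ k $ l) *\<^sub>R emat k l)"
proof -
  have "(\<Sum>k\<in>UNIV. \<Sum>l\<in>UNIV. (M $ k $ l) *\<^sub>R emat k l) $ i $ j = M $ i $ j" for i j
  proof -
    have "(\<Sum>k\<in>UNIV. \<Sum>l\<in>UNIV. (M $ k $ l) *\<^sub>R emat k l) $ i $ j
      = (\<Sum>k\<in>UNIV. if k = i then M $ k $ j else 0)"
      unfolding sum_component by (intro sum.cong) (auto simp: emat_def if_distrib[of "(*) _"] cong: if_cong)
    also have "\<dots> = M $ i $ j" by simp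
    finally show ?thesis .
  qed
  thus ?thesis by (simp add: vec_eq_iff)
qed

text \<open>One factor \<open>CARD('n) ^ 2\<close> comes from bounding each
  \<open>D (emat k l)\<close> by its entries, the other from expanding \<open>H\<close> in the basis
  \<open>emat\<close>; hence the fourth power.\<close>

lemma frechet_derivative_bound:
  fixes A :: "real^'n^'n \<Rightarrow> real^'n^'n"
  assumes "phi_structure \<psi> A C0 C1" "Q \<noteq> 0" "deriv (deriv \<psi>) (norm Q) \<ge> 0"
  shows "norm (frechet_derivative A (at Q) H) \<le> real CARD('n) ^ 4 * C1 * deriv (deriv \<psi>) (norm Q) * norm H"
proof -
  define D where "D = frechet_derivative A (at Q)"
  define s where "s = deriv (deriv \<psi>) (norm Q)"
  have "A differentiable at Q" using assms by (auto simp: phi_structure_def)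
  hence lin: "linear D" unfolding D_def by (rule linear_frechet_derivative)
  have C1: "C1 > 0" using assms by (auto simp: phi_structure_def)
  have b: "norm (D (emat k l)) \<le> real CARD('n) ^ 2 * (C1 * s)" for k l
    using assms unfolding D_def s_def by (intro norm_matrix_le) (auto simp: phi_structure_def)
  have "D H = D (\<Sum>k\<in>UNIV. \<Sum>l\<in>UNIV. (H $ k $ l) *\<^sub>R emat k l)"
    by (subst matrix_eq_sum_emat[of H]) simp
  also have "\<dots> = (\<Sum>k\<in>UNIV. \<Sum>l\<in>UNIV. (H $ k $ l) *\<^sub>R D (emat k l))"
    using lin by (simp add: linear_sum linear_cmul)
  finally have "norm (D H) \<le> (\<Sum>k\<in>UNIV. norm (\<Sum>l\<in>UNIV. (H $ k $ l) *\<^sub>R D (emat k l)))"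
    by (simp add: sum_norm_le)
  also have "\<dots> \<le> (\<Sum>k\<in>UNIV. \<Sum>l\<in>UNIV. norm ((H $ k $ l) *\<^sub>R D (emat k l)))"
    by (intro sum_mono norm_sum)
  also have "\<dots> \<le> (\<Sum>k\<in>(UNIV::'n set). \<Sum>l\<in>(UNIV::'n set). norm H * (real CARD('n) ^ 2 * (C1 * s)))"
  proof (intro sum_mono)
    fix k l
    have "\<bar>H $ k $ l\<bar> \<le> norm H"
      by (meson Finite_Cartesian_Product.norm_nth_le component_le_norm_cart order_trans)
    thus "norm ((H $ k $ l) *\<^sub>R D (emat k l)) \<le> norm H * (real CARD('n) ^ 2 * (C1 * s))"
      using b[of k l] by (simp add: mult_mono)
  qed
  also have "\<dots> = real CARD('n) ^ 4 * C1 * s * norm H" by (simp add: power2_eq_square power4_eq_xxxx)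
  finally show ?thesis by (simp add: D_def s_def)
qed

locale phi_operator = power_growth "deriv \<phi>" "deriv (deriv \<phi>)" N a
  for \<phi> N a +
  fixes A :: "real^'n^'n \<Rightarrow> real^'n^'n" and C0 C1 :: real
  assumes phi_struct: "phi_structure \<phi> A C0 C1"
begin

definition "K = real CARD('n) ^ 4 * C1"

lemma C_pos: "C0 > 0" "C1 > 0" "K > 0"
  using phi_struct by (auto simp: phi_structure_def K_def)

lemma A_derivative: "Q \<noteq> 0 \<Longrightarrow> (A has_derivative frechet_derivative A (at Q)) (at Q)"
  using phi_struct by (simp add: phi_structure_def frechet_derivative_works[symmetric])

lemma A_cont: "continuous_on UNIV A" and A_0: "A 0 = 0"
  using phi_struct by (auto simp: phi_structure_def)

lemma A_derivative_bound:
  "Q \<noteq> 0 \<Longrightarrow> norm (frechet_derivative A (at Q) H) \<le> K * deriv (deriv \<phi>) (norm Q) * norm H"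
  unfolding K_def using dd_nonneg[of "norm Q"] by (intro frechet_derivative_bound[OF phi_struct]) auto

text \<open>Along the ray through \<open>P\<close> the derivative of \<open>A\<close> is dominated
  by that of \<open>K * deriv \<phi> (t * norm P)\<close>, so the increments compare. As
  differentiability is given only off the origin, the segment starts at
  \<open>e *\<^sub>R P\<close>; the lower end enters the bound with a negative sign and is dropped,
  and \<open>e\<close> tends to 0 by continuity and \<open>A 0 = 0\<close>.\<close>

lemma A_growth:
  assumes "P \<noteq> 0"
  shows "norm (A P) \<le> K * deriv \<phi> (norm P)"
proof -
  have main: "norm (A P - A (e *\<^sub>R P)) \<le> K * deriv \<phi> (norm P)" if e: "0 < e" "e < 1" for e
  proof -
    have dA: "((\<lambda>t. A (t *\<^sub>R P)) has_vector_derivative frechet_derivative A (at (t *\<^sub>R P)) P) (at t)" if "0 < t" for t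
    proof -
      have "((\<lambda>t. A (t *\<^sub>R P)) has_derivative (\<lambda>h. frechet_derivative A (at (t *\<^sub>R P)) (h *\<^sub>R P))) (at t)"
        using that assms
        by (intro has_derivative_compose[of "\<lambda>t. t *\<^sub>R P" _ t UNIV A])
           (auto intro!: derivative_eq_intros A_derivative)
      moreover have "frechet_derivative A (at (t *\<^sub>R P)) (h *\<^sub>R P) = h *\<^sub>R frechet_derivative A (at (t *\<^sub>R P)) P" for h
        using A_derivative[of "t *\<^sub>R P"] that assms by (simp add: has_derivative_linear linear_cmul)
      ultimately show ?thesis by (simp add: has_vector_derivative_def)
    qed
    have dd: "((\<lambda>t. K * deriv \<phi> (t * norm P)) has_vector_derivative
        K * (deriv (deriv \<phi>) (t * norm P) * norm P)) (at t)" if "0 < t" for t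
      unfolding has_real_derivative_iff_has_vector_derivative[symmetric]
      using that assms by (auto intro!: derivative_eq_intros DERIV_chain2[OF deriv])
    have "norm (A (1 *\<^sub>R P) - A (e *\<^sub>R P)) \<le> K * deriv \<phi> (1 * norm P) - K * deriv \<phi> (e * norm P)"
    proof (rule differentiable_bound_general[OF e(2)])
      show "continuous_on {e..1} (\<lambda>t. A (t *\<^sub>R P))"
        using e has_vector_derivative_continuous[OF dA] by (intro continuous_at_imp_continuous_on) auto
      show "continuous_on {e..1} (\<lambda>t. K * deriv \<phi> (t * norm P))"
        using e has_vector_derivative_continuous[OF dd] by (intro continuous_at_imp_continuous_on) auto
      show "norm (frechet_derivative A (at (t *\<^sub>R P)) P) \<le> K * (deriv (deriv \<phi>) (t * norm P) * norm P)"
        if "e < t" "t < 1" for t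
        using A_derivative_bound[of "t *\<^sub>R P" P] that e assms by (simp add: mult_ac)
    qed (use e dA dd in auto)
    moreover have "deriv \<phi> (e * norm P) > 0" using e assms by (intro pos) auto
    ultimately show ?thesis using C_pos by simp (smt (verit) mult_pos_pos)
  qed
  have "isCont A 0" using A_cont by (simp add: continuous_on_eq_continuous_at)
  moreover have "((\<lambda>e. e *\<^sub>R P) \<longlongrightarrow> 0) (at_right 0)" by (auto intro!: tendsto_eq_intros)
  ultimately have "((\<lambda>e. A (e *\<^sub>R P)) \<longlongrightarrow> A 0) (at_right 0)" by (rule isCont_tendsto_compose)
  hence "((\<lambda>e. norm (A P - A (e *\<^sub>R P))) \<longlongrightarrow> norm (A P - A 0)) (at_right 0)"
    by (intro tendsto_intros)
  moreover have "eventually (\<lambda>e. norm (A P - A (e *\<^sub>R P)) \<le> K * deriv \<phi> (norm P)) (at_right 0)"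
    by (rule eventually_at_rightI[of 0 1]) (auto intro: main)
  ultimately have "norm (A P - A 0) \<le> K * deriv \<phi> (norm P)"
    by (intro tendsto_upperbound[of _ _ "at_right 0"]) auto
  thus ?thesis by (simp add: A_0)
qed

text \<open>If \<open>Q\<close> is close to \<open>P\<close>, the segment stays in the shell between
  \<open>norm P / 2\<close> and \<open>norm P\<close>, away from the origin, and the derivative
  bound there produces \<open>2 * N\<close>. If \<open>Q\<close> is far, \<open>A_growth\<close> for
  both matrices and \<open>norm P \<le> 2 * norm (P - Q)\<close> produce the 4.\<close>

lemma A_diff_upper:
  assumes "norm Q \<le> norm P" "P \<noteq> 0"
  shows "norm (A P - A Q) \<le> K * (2 * real N + 4) * (deriv \<phi> (norm P) / norm P) * norm (P - Q)"
proof (cases "norm (P - Q) \<le> norm P / 2")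
  case True
  have p: "norm P > 0" using assms by simp
  have seg: "norm P / 2 \<le> norm R \<and> norm R \<le> norm P" if R: "R \<in> closed_segment P Q" for R
  proof -
    have "norm (R - P) \<le> norm (Q - P)" using R segment_bound(1) by blast
    moreover have "norm P \<le> norm R + norm (R - P)" by (metis norm_minus_commute norm_triangle_sub)
    moreover have "closed_segment P Q \<subseteq> cball 0 (norm P)"
      using assms by (intro closed_segment_subset) auto
    hence "norm R \<le> norm P" using R by auto
    ultimately show ?thesis using True by (simp add: norm_minus_commute)
  qed
  have "norm (A P - A Q) \<le> (K * real N * (2 * deriv \<phi> (norm P) / norm P)) * norm (P - Q)"
  proof (rule differentiable_bound[OF convex_closed_segment[of P Q]])
    fix R assume R: "R \<in> closed_segment P Q"
    have R0: "norm R > 0" "R \<noteq> 0" using seg[OF R] p by auto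
    show "(A has_derivative frechet_derivative A (at R)) (at R within closed_segment P Q)"
      by (rule has_derivative_at_withinI[OF A_derivative[OF R0(2)]])
    have "deriv (deriv \<phi>) (norm R) \<le> real N * deriv \<phi> (norm R) / norm R"
      using upper[OF R0(1)] R0 by (simp add: field_simps)
    also have "\<dots> \<le> real N * deriv \<phi> (norm P) / (norm P / 2)"
      using seg[OF R] R0 p pos[of "norm P"] by (intro frac_le mult_left_mono mono mult_nonneg_nonneg) auto
    finally have *: "deriv (deriv \<phi>) (norm R) \<le> real N * (2 * deriv \<phi> (norm P) / norm P)" by (simp add: mult_ac)
    show "onorm (frechet_derivative A (at R)) \<le> K * real N * (2 * deriv \<phi> (norm P) / norm P)"
    proof (rule onorm_le)
      fix H
      have "norm (frechet_derivative A (at R) H) \<le> K * deriv (deriv \<phi>) (norm R) * norm H"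
        by (rule A_derivative_bound[OF R0(2)])
      also have "\<dots> \<le> K * (real N * (2 * deriv \<phi> (norm P) / norm P)) * norm H"
        using * C_pos by (intro mult_right_mono mult_left_mono) auto
      finally show "norm (frechet_derivative A (at R) H)
        \<le> K * real N * (2 * deriv \<phi> (norm P) / norm P) * norm H" by (simp add: mult_ac)
    qed
  qed auto
  also have "\<dots> \<le> K * (2 * real N + 4) * (deriv \<phi> (norm P) / norm P) * norm (P - Q)"
    using C_pos pos[OF p] p by (simp add: field_simps)
  finally show ?thesis .
next
  case False
  have p: "norm P > 0" using assms by simp
  have "norm (A Q) \<le> K * deriv \<phi> (norm P)"
  proof (cases "Q = 0")
    case False
    thus ?thesis using A_growth[of Q] mono[of "norm Q" "norm P"] assms C_pos
      by (smt (verit, best) mult_left_mono zero_less_norm_iff)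
  qed (use A_0 C_pos pos[OF p] in auto)
  hence "norm (A P - A Q) \<le> 2 * K * deriv \<phi> (norm P)"
    using A_growth[OF assms(2)] norm_triangle_ineq4[of "A P" "A Q"] by simp
  also have "\<dots> = K * 4 * (deriv \<phi> (norm P) / norm P) * (norm P / 2)" using p by simp
  also have "\<dots> \<le> K * (2 * real N + 4) * (deriv \<phi> (norm P) / norm P) * norm (P - Q)"
    using C_pos pos[OF p] p False by (intro mult_mono) auto
  finally show ?thesis .
qed

text \<open>Along the segment \<open>g t\<close> is nondecreasing, but ellipticity has a uniform
  lower bound only where \<open>R t\<close> is not small. On the last quarter
  \<open>norm (R t) \<ge> norm P / 2\<close> because \<open>norm Q \<le> norm P\<close>. That
  quarter alone supplies the estimate, hence the 4 in the denominator; doubling supplies the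
  \<open>2 ^ N\<close>.\<close>

lemma A_diff_lower:
  assumes "norm Q \<le> norm P" "P \<noteq> 0"
  shows "C0 * a / (4 * 2 ^ N) * (deriv \<phi> (norm P) / norm P * (norm (P - Q))\<^sup>2) \<le> inner (A P - A Q) (P - Q)"
proof (cases "P = Q")
  case False
  define H where "H = P - Q"
  define R where "R t = Q + t *\<^sub>R H" for t
  define g where "g t = inner (A (R t)) H" for t
  define c where "c = C0 * a / 2 ^ N * (deriv \<phi> (norm P) / norm P * (norm H)\<^sup>2)"
  have H: "H \<noteq> 0" using False by (simp add: H_def)
  have p: "norm P > 0" using assms by simp
  have gder: "(g has_real_derivative inner (frechet_derivative A (at (R t)) H) H) (at t)" if "R t \<noteq> 0" for t
  proof -
    have "((\<lambda>t. A (R t)) has_derivative (\<lambda>h. frechet_derivative A (at (R t)) (h *\<^sub>R H))) (at t)"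
      using that unfolding R_def
      by (intro has_derivative_compose[of "\<lambda>t. Q + t *\<^sub>R H" _ t UNIV A])
         (auto intro!: derivative_eq_intros A_derivative)
    moreover have "frechet_derivative A (at (R t)) (h *\<^sub>R H) = h *\<^sub>R frechet_derivative A (at (R t)) H" for h
      using A_derivative[of "R t"] that by (simp add: has_derivative_linear linear_cmul)
    ultimately have "((\<lambda>t. A (R t)) has_derivative (\<lambda>h. h *\<^sub>R frechet_derivative A (at (R t)) H)) (at t)" by simp
    from has_derivative_inner_left[OF this, of H] show ?thesis
      by (simp add: g_def[abs_def] has_field_derivative_def mult_commute_abs)
  qed
  have ell: "inner (frechet_derivative A (at (R t)) H) H \<ge> C0 * deriv (deriv \<phi>) (norm (R t)) * (norm H)\<^sup>2"
    if "R t \<noteq> 0" for t using phi_struct that by (auto simp: phi_structure_def)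
  have nonneg: "\<exists>y. (g has_real_derivative y) (at t) \<and> 0 \<le> y" if "R t \<noteq> 0" for t
  proof -
    have "0 \<le> C0 * deriv (deriv \<phi>) (norm (R t)) * (norm H)\<^sup>2"
      using dd_nonneg[of "norm (R t)"] C_pos that by simp
    thus ?thesis using gder[OF that] ell[OF that] by (blast intro: order_trans)
  qed
  have gcont: "continuous_on S g" for S
    unfolding g_def R_def
    by (intro continuous_intros continuous_on_compose2[OF A_cont]) auto
  have inc: "g s \<le> g t" if "s \<le> t" "\<And>x. s < x \<Longrightarrow> x < t \<Longrightarrow> R x \<noteq> 0" for s t
    using that(1) by (rule DERIV_nonneg_imp_increasing_open) (use that nonneg gcont in blast)+
  \<comment> \<open>The segment may hit the origin, where \<open>A\<close> need not be
    differentiable, but at most once since \<open>H \<noteq> 0\<close>. As \<open>g\<close> is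
    continuous there, the two monotone pieces can be joined.\<close>
  have "g 0 \<le> g (3/4)"
  proof (cases "\<exists>z. 0 < z \<and> z < 3/4 \<and> R z = 0")
    case True
    then obtain z where z: "0 < z" "z < 3/4" "R z = 0" by blast
    have uniq: "x = z" if "R x = 0" for x
    proof -
      have "(x - z) *\<^sub>R H = R x - R z" by (simp add: R_def algebra_simps)
      thus ?thesis using that z H by simp
    qed
    have "g 0 \<le> g z" by (rule inc) (use z in simp, use uniq in blast)
    also have "g z \<le> g (3/4)" by (rule inc) (use z in simp, use uniq in blast)
    finally show ?thesis .
  next
    case False
    show ?thesis by (rule inc) (simp, use False in blast)
  qed
  \<comment> \<open>\<open>c\<close> is the ellipticity bound valid on the last quarter, so
    \<open>g t - c * t\<close> is nondecreasing there and \<open>g\<close> gains at least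
    \<open>c / 4\<close>.\<close>
  moreover have "g (3/4) - c * (3/4) \<le> g 1 - c * 1"
  proof (rule DERIV_nonneg_imp_nondecreasing[of "3/4" 1 "\<lambda>t. g t - c * t"])
    fix t :: real assume t: "3/4 \<le> t" "t \<le> 1"
    have Rt: "R t = t *\<^sub>R P + (1 - t) *\<^sub>R Q" by (simp add: R_def H_def algebra_simps)
    have "t * norm P \<le> norm (R t) + (1 - t) * norm Q"
      using norm_triangle_ineq4[of "R t" "(1 - t) *\<^sub>R Q"] t by (simp add: Rt)
    moreover have "(1 - t) * norm Q \<le> (1/4) * norm P" using t assms by (intro mult_mono) auto
    moreover have "3/4 * norm P \<le> t * norm P" using t by (intro mult_right_mono) auto
    ultimately have lo: "norm P / 2 \<le> norm (R t)" by simp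
    have "norm (R t) \<le> t * norm P + (1 - t) * norm Q"
      using norm_triangle_ineq[of "t *\<^sub>R P" "(1 - t) *\<^sub>R Q"] t by (simp add: Rt)
    also have "\<dots> \<le> t * norm P + (1 - t) * norm P" using t assms by (intro add_left_mono mult_left_mono) auto
    finally have hi: "norm (R t) \<le> norm P" by (simp add: algebra_simps)
    have R0: "norm (R t) > 0" "R t \<noteq> 0" using lo p by auto
    have "deriv \<phi> (norm P) \<le> 2 ^ N * deriv \<phi> (norm (R t))"
      using lo p R0 by (intro scaling_le) auto
    hence "(deriv \<phi> (norm P) / 2 ^ N) / norm P \<le> deriv \<phi> (norm (R t)) / norm (R t)"
      using pos[OF R0(1)] hi R0 by (intro frac_le) (auto simp: field_simps)
    also have "a * \<dots> \<le> deriv (deriv \<phi>) (norm (R t))" using lower[OF R0(1)] R0 by (simp add: field_simps)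
    finally have "a * ((deriv \<phi> (norm P) / 2 ^ N) / norm P) \<le> deriv (deriv \<phi>) (norm (R t))"
      using a_pos by simp
    hence "C0 * (a * ((deriv \<phi> (norm P) / 2 ^ N) / norm P)) * (norm H)\<^sup>2
       \<le> C0 * deriv (deriv \<phi>) (norm (R t)) * (norm H)\<^sup>2"
      using C_pos by (intro mult_right_mono mult_left_mono) auto
    hence "c \<le> inner (frechet_derivative A (at (R t)) H) H"
      using ell[OF R0(2)] by (simp add: c_def)
    thus "\<exists>y. ((\<lambda>t. g t - c * t) has_real_derivative y) (at t) \<and> 0 \<le> y"
      using gder[OF R0(2)]
      by (intro exI[of _ "inner (frechet_derivative A (at (R t)) H) H - c"])
         (auto intro!: derivative_eq_intros)
  qed auto
  ultimately have "c / 4 \<le> g 1 - g 0" by simp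
  moreover have "g 1 - g 0 = inner (A P - A Q) (P - Q)" by (simp add: g_def R_def H_def inner_diff_left)
  ultimately show ?thesis by (simp add: c_def H_def)
qed auto

end

section \<open>Shifted functions and the pointwise quasi-optimality estimate\<close>

context power_growth begin

text \<open>Up to constants the shifted N-function \<open>\<phi>\<^sub>p(x)\<close>; \<open>W 0 0 = 0\<close> because division by zero gives zero.\<close>

definition W :: "real \<Rightarrow> real \<Rightarrow> real" where "W p x = d (p + x) / (p + x) * x\<^sup>2"

lemma W_zero [simp]: "W p 0 = 0" by (simp add: W_def)

lemma W_nonneg: "0 \<le> p \<Longrightarrow> 0 \<le> x \<Longrightarrow> 0 \<le> W p x"
  using pos[of "p + x"] by (cases "p + x = 0") (auto simp: W_def)

text \<open>If \<open>c * y \<le> x\<close>, then \<open>y\<close> is replaced by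
  \<open>x / c\<close>. Otherwise \<open>p + x \<le> c * (p + y)\<close>, so doubling costs
  \<open>c ^ N\<close>, and monotonicity of \<open>t / (p + t)\<close> costs one more factor; hence
  \<open>c ^ Suc N\<close>.\<close>

lemma shifted_young:
  assumes "0 \<le> p" "0 < x" "0 \<le> y" "1 \<le> c"
  shows "d (p + x) / (p + x) * x * y \<le> W p x / c + c ^ Suc N * W p y"
proof (cases "c * y \<le> x")
  case True
  have "d (p + x) / (p + x) * x * y \<le> d (p + x) / (p + x) * x * (x / c)"
    using True assms pos[of "p + x"] by (intro mult_left_mono) (auto simp: field_simps)
  also have "\<dots> = W p x / c" by (simp add: W_def power2_eq_square)
  finally show ?thesis using W_nonneg[of p y] assms by (simp add: add_increasing2)
next
  case False
  hence y: "y > 0" using assms by (smt (verit) mult_nonneg_nonpos)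
  have "p + x \<le> c * (p + y)"
    using False assms mult_right_mono[of 1 c p] by (simp add: distrib_left)
  hence 1: "d (p + x) \<le> c ^ N * d (p + y)" using assms y by (intro scaling_le) auto
  have cy: "c * y > 0" "y \<le> c * y" using y assms by auto
  have "x / (p + x) \<le> c * y / (p + c * y)"
    using False assms cy mult_left_mono[of x "c * y" p] by (simp add: divide_simps algebra_simps)
  also have "\<dots> \<le> c * y / (p + y)" using cy y assms by (intro divide_left_mono) (auto intro!: mult_pos_pos add_nonneg_pos)
  finally have 2: "x / (p + x) \<le> c * y / (p + y)" .
  have "d (p + x) / (p + x) * x * y = d (p + x) * (x / (p + x)) * y" by simp
  also have "\<dots> \<le> (c ^ N * d (p + y)) * (c * y / (p + y)) * y"
    using 1 2 assms y pos[of "p + y"] by (intro mult_right_mono mult_mono) auto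
  also have "\<dots> = c ^ Suc N * W p y" by (simp add: W_def power2_eq_square)
  finally show ?thesis using W_nonneg[of p x] assms by (simp add: add_increasing)
qed

end

context phi_operator begin

text \<open>The weight at the larger norm \<open>m\<close> is traded for the one at
  \<open>s = norm P + norm (P - Q)\<close>. Since \<open>m \<le> s \<le> 3 * m\<close>, this costs 3
  in one direction, from the denominator, and \<open>3 ^ N\<close> in the other, from
  doubling.\<close>

lemma shifted_bounds:
  fixes P Q :: "real^'n^'n"
  defines "x \<equiv> norm (P - Q)"
  shows "C0 * a / (4 * 2 ^ N * 3 ^ N) * W (norm P) x \<le> inner (A P - A Q) (P - Q)"
    and "norm (A P - A Q) \<le> 3 * K * (2 * real N + 4) * (deriv \<phi> (norm P + x) / (norm P + x) * x)"
    and "(norm (Fmap \<phi> P - Fmap \<phi> Q))\<^sup>2 \<le> 3 * (real N ^ 2 + 16) * W (norm P) x"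
    and "W (norm P) x \<le> 3 ^ N * (36 + 2 ^ N) * (norm (Fmap \<phi> P - Fmap \<phi> Q))\<^sup>2"
proof -
  have pg: "power_growth (deriv \<phi>) (deriv (deriv \<phi>)) N a" by unfold_locales
  define m where "m = max (norm P) (norm Q)"
  define s where "s = norm P + x"
  have "m = 0 \<or> m > 0" by (auto simp: m_def max_def)
  thus "C0 * a / (4 * 2 ^ N * 3 ^ N) * W (norm P) x \<le> inner (A P - A Q) (P - Q)"
    "norm (A P - A Q) \<le> 3 * K * (2 * real N + 4) * (deriv \<phi> (norm P + x) / (norm P + x) * x)"
    "(norm (Fmap \<phi> P - Fmap \<phi> Q))\<^sup>2 \<le> 3 * (real N ^ 2 + 16) * W (norm P) x"
    "W (norm P) x \<le> 3 ^ N * (36 + 2 ^ N) * (norm (Fmap \<phi> P - Fmap \<phi> Q))\<^sup>2"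
  proof (atomize(full), elim disjE, goal_cases)
    case 1
    hence "P = 0" "Q = 0" by (auto simp: m_def max_def split: if_splits)
    thus ?case by (simp add: x_def)
  next
    case 2
    define G where "G = deriv \<phi> m / m"
    have raw: "C0 * a / (4 * 2 ^ N) * (G * x\<^sup>2) \<le> inner (A P - A Q) (P - Q)"
      "norm (A P - A Q) \<le> K * (2 * real N + 4) * G * x"
      "(norm (Fmap \<phi> P - Fmap \<phi> Q))\<^sup>2 \<le> (real N ^ 2 + 16) * (G * x\<^sup>2)"
      "G * x\<^sup>2 \<le> (36 + 2 ^ N) * (norm (Fmap \<phi> P - Fmap \<phi> Q))\<^sup>2"
    proof (atomize(full), cases "norm Q \<le> norm P", goal_cases)
      case 1
      hence m: "m = norm P" "P \<noteq> 0" using \<open>m > 0\<close> by (auto simp: m_def)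
      show ?case unfolding G_def m(1) x_def
        using A_diff_lower[OF 1 m(2)] A_diff_upper[OF 1 m(2)] Fmap_diff_bounds[OF pg 1 m(2)] by blast
    next
      case 2
      hence *: "norm P \<le> norm Q" by simp
      hence m: "m = norm Q" "Q \<noteq> 0" using \<open>m > 0\<close> by (auto simp: m_def)
      have "inner (A P - A Q) (P - Q) = inner (A Q - A P) (Q - P)"
        by (simp add: inner_diff_left inner_diff_right)
      thus ?case unfolding G_def m(1) x_def
        using A_diff_lower[OF * m(2)] A_diff_upper[OF * m(2)] Fmap_diff_bounds[OF pg * m(2)]
        by (simp only: norm_minus_commute)
    qed
    have tri: "norm Q \<le> norm P + x" "x \<le> norm P + norm Q" "norm P \<le> norm P + x"
      using norm_triangle_sub[of Q P] norm_triangle_ineq4[of P Q] by (auto simp: x_def norm_minus_commute)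
    have s: "m \<le> s" "s \<le> 3 * m" "s > 0" "x \<ge> 0" 
    proof -
      show "m \<le> s" "x \<ge> 0" using tri by (auto simp: m_def s_def x_def)
      thus "s > 0" using \<open>m > 0\<close> by simp
      show "s \<le> 3 * m" using tri by (auto simp: m_def s_def max_def)
    qed
    have dm: "deriv \<phi> m > 0" "deriv \<phi> s > 0" using pos s \<open>m > 0\<close> by auto
    have "deriv \<phi> m / (3 * m) \<le> deriv \<phi> s / s"
      using mono[of m s] s \<open>m > 0\<close> dm by (intro frac_le) auto
    hence lo: "G \<le> 3 * (deriv \<phi> s / s)" using \<open>m > 0\<close> by (simp add: G_def)
    have "deriv \<phi> s \<le> 3 ^ N * deriv \<phi> m" using s \<open>m > 0\<close> by (intro scaling_le) auto
    hence "deriv \<phi> s / s \<le> 3 ^ N * deriv \<phi> m / m" using s \<open>m > 0\<close> dm by (intro frac_le) auto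
    hence hi: "deriv \<phi> s / s \<le> 3 ^ N * G" by (simp add: G_def)
    have W: "W (norm P) x = deriv \<phi> s / s * x\<^sup>2" by (simp add: W_def s_def)
    have loW: "G * x\<^sup>2 \<le> 3 * W (norm P) x" unfolding W using mult_right_mono[OF lo, of "x\<^sup>2"] by simp
    have hiW: "W (norm P) x \<le> 3 ^ N * (G * x\<^sup>2)" unfolding W using mult_right_mono[OF hi, of "x\<^sup>2"] by simp
    have "C0 * a / (4 * 2 ^ N * 3 ^ N) * W (norm P) x \<le> C0 * a / (4 * 2 ^ N * 3 ^ N) * (3 ^ N * (G * x\<^sup>2))"
      using C_pos a_pos by (intro mult_left_mono hiW) auto
    also have "\<dots> = C0 * a / (4 * 2 ^ N) * (G * x\<^sup>2)" by simp
    also note raw(1)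
    finally have 1: "C0 * a / (4 * 2 ^ N * 3 ^ N) * W (norm P) x \<le> inner (A P - A Q) (P - Q)" .
    have "K * (2 * real N + 4) * G * x \<le> K * (2 * real N + 4) * (3 * (deriv \<phi> s / s)) * x"
      using C_pos s by (intro mult_right_mono mult_left_mono lo) auto
    also have "\<dots> = 3 * K * (2 * real N + 4) * (deriv \<phi> s / s * x)" by simp
    finally have 2: "norm (A P - A Q) \<le> 3 * K * (2 * real N + 4) * (deriv \<phi> s / s * x)"
      using raw(2) by linarith
    have "(real N ^ 2 + 16) * (G * x\<^sup>2) \<le> (real N ^ 2 + 16) * (3 * W (norm P) x)"
      by (intro mult_left_mono loW) auto
    with raw(3) have 3: "(norm (Fmap \<phi> P - Fmap \<phi> Q))\<^sup>2 \<le> 3 * (real N ^ 2 + 16) * W (norm P) x" by linarith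
    have "3 ^ N * (G * x\<^sup>2) \<le> 3 ^ N * ((36 + 2 ^ N) * (norm (Fmap \<phi> P - Fmap \<phi> Q))\<^sup>2)"
      by (intro mult_left_mono raw(4)) auto
    with hiW have 4: "W (norm P) x \<le> 3 ^ N * (36 + 2 ^ N) * (norm (Fmap \<phi> P - Fmap \<phi> Q))\<^sup>2"
      by (simp only: mult.assoc)
    show ?case using 1 2 3 4 by (simp only: s_def)
  qed
qed

end

text \<open>The constants are found before \<open>\<phi>\<close> and \<open>A\<close> are given,
  which makes the final bound uniform over them. \<open>e\<close>, \<open>k\<close>,
  \<open>f\<close> and \<open>M\<close> are the four constants of \<open>shifted_bounds\<close>, in
  its order.\<close>

lemma monotone_operator_quasi_optimality:
  fixes N :: nat and a C0 C1 :: real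
  assumes "a > 0" "C0 > 0" "C1 > 0"
  shows "\<exists>B>0. \<exists>D>0. \<forall>\<phi> (A :: real^'n^'n \<Rightarrow> real^'n^'n) P Q R. phi_operator \<phi> N a A C0 C1 \<longrightarrow>
    (norm (Fmap \<phi> P - Fmap \<phi> Q))\<^sup>2 \<le> B * (norm (Fmap \<phi> P - Fmap \<phi> R))\<^sup>2 + D * inner (A P - A Q) (R - Q)"
proof -
  define K0 where "K0 = real CARD('n) ^ 4 * C1"
  define k where "k = 3 * K0 * (2 * real N + 4)"
  define e where "e = C0 * a / (4 * 2 ^ N * 3 ^ N)"
  \<comment> \<open>The Young parameter: large enough for \<open>k / l \<le> e / 2\<close>, so that
    half of the coercive term survives the absorption, and at least 1 as
    \<open>shifted_young\<close> demands.\<close>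
  define l where "l = max 1 (2 * k / e)"
  define f where "f = 3 * (real N ^ 2 + 16)"
  define M where "M = (3::real) ^ N * (36 + 2 ^ N)"
  have K0: "K0 > 0" using assms by (simp add: K0_def)
  hence k: "k > 0" by (simp add: k_def add_nonneg_pos)
  have e: "e > 0" using assms by (simp add: e_def)
  have l: "l \<ge> 1" "k / l \<le> e / 2"
    using e k by (auto simp: l_def divide_simps max_def)
  have f: "f > 0" by (simp add: f_def add_nonneg_pos)
  have M: "M > 0" by (simp add: M_def add_pos_pos)
  \<comment> \<open>Multiplying the surviving \<open>e / 2 * w\<close> by \<open>D\<close> gives
    exactly \<open>f * w\<close>, the upper bound for the left-hand side.\<close>
  define D where "D = 2 * f / e"
  define B where "B = D * (k * l ^ Suc N * M)"
  have D: "D > 0" using f e by (simp add: D_def)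
  have B: "B > 0" using D k l M by (simp add: B_def)
  have "(norm (Fmap \<phi> P - Fmap \<phi> Q))\<^sup>2 \<le> B * (norm (Fmap \<phi> P - Fmap \<phi> R))\<^sup>2 + D * inner (A P - A Q) (R - Q)"
    if "phi_operator \<phi> N a A C0 C1" for \<phi> and A :: "real^'n^'n \<Rightarrow> real^'n^'n" and P Q R
  proof -
    interpret phi_operator \<phi> N a A C0 C1 by fact
    have Keq: "K = K0" unfolding K0_def K_def by (rule refl)
    define w where "w = W (norm P) (norm (P - Q))"
    define v where "v = W (norm P) (norm (P - R))"
    note b = shifted_bounds[of P Q, folded w_def e_def f_def]
    have "inner (A P - A Q) (P - R) \<le> norm (A P - A Q) * norm (P - R)" by (rule norm_cauchy_schwarz)
    also have "\<dots> \<le> k * (w / l + l ^ Suc N * v)"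
    proof (cases "P = Q")
      case True
      thus ?thesis using k l W_nonneg[of "norm P" "norm (P - R)"] by (simp add: w_def v_def)
    next
      case False
      have "norm (A P - A Q) * norm (P - R) \<le>
        (k * (deriv \<phi> (norm P + norm (P - Q)) / (norm P + norm (P - Q)) * norm (P - Q))) * norm (P - R)"
        using b(2) by (intro mult_right_mono) (auto simp: k_def Keq)
      also have "\<dots> = k * (deriv \<phi> (norm P + norm (P - Q)) / (norm P + norm (P - Q)) * norm (P - Q) * norm (P - R))"
        by (simp only: mult.assoc)
      also have "\<dots> \<le> k * (w / l + l ^ Suc N * v)" unfolding w_def v_def
        using False l k by (intro mult_left_mono shifted_young) auto
      finally show ?thesis .
    qed
    also have "\<dots> = k / l * w + k * l ^ Suc N * v" by (simp add: algebra_simps)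
    also have "k / l * w \<le> e / 2 * w"
      using l W_nonneg[of "norm P" "norm (P - Q)"] by (intro mult_right_mono) (auto simp: w_def)
    also have "k * l ^ Suc N * v \<le> k * l ^ Suc N * (M * (norm (Fmap \<phi> P - Fmap \<phi> R))\<^sup>2)"
      using shifted_bounds(4)[of P R] k l unfolding v_def M_def by (intro mult_left_mono) auto
    finally have 1: "inner (A P - A Q) (P - R) \<le> e / 2 * w + k * l ^ Suc N * (M * (norm (Fmap \<phi> P - Fmap \<phi> R))\<^sup>2)"
      by simp
    have "inner (A P - A Q) (P - Q) = inner (A P - A Q) (P - R) + inner (A P - A Q) (R - Q)"
      by (simp add: inner_diff_right)
    with 1 b(1) have "e / 2 * w \<le> k * l ^ Suc N * (M * (norm (Fmap \<phi> P - Fmap \<phi> R))\<^sup>2) + inner (A P - A Q) (R - Q)"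
      by simp
    hence "D * (e / 2 * w) \<le> D * (k * l ^ Suc N * (M * (norm (Fmap \<phi> P - Fmap \<phi> R))\<^sup>2) + inner (A P - A Q) (R - Q))"
      using D by (intro mult_left_mono) auto
    moreover have "D * (e / 2 * w) = f * w" using e by (simp add: D_def)
    ultimately have "f * w \<le> B * (norm (Fmap \<phi> P - Fmap \<phi> R))\<^sup>2 + D * inner (A P - A Q) (R - Q)"
      by (simp only: B_def distrib_left mult.assoc)
    thus ?thesis using b(3) by linarith
  qed
  thus ?thesis using B D by blast
qed

section \<open>Mollification of Lipschitz functions\<close>

lemma max0_square_has_derivative: "((\<lambda>s::real. (max 0 s)\<^sup>2) has_real_derivative 2 * max 0 s) (at s)"
proof -
  consider "s > 0" | "s < 0" | "s = 0" by linarith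
  thus ?thesis
  proof cases
    case 1
    have "((\<lambda>s::real. s\<^sup>2) has_real_derivative 2 * max 0 s) (at s)"
      using 1 by (auto intro!: derivative_eq_intros)
    thus ?thesis
      by (rule has_field_derivative_transform_within_open[of _ _ _ "{0<..}"]) (use 1 in auto)
  next
    case 2
    have "((\<lambda>s::real. 0) has_real_derivative 2 * max 0 s) (at s)"
      using 2 by (auto intro!: derivative_eq_intros)
    thus ?thesis
      by (rule has_field_derivative_transform_within_open[of _ _ _ "{..<0}"]) (use 2 in auto)
  next
    case 3
    have "((\<lambda>h::real. (max 0 h)\<^sup>2 / h) \<longlongrightarrow> 0) (at 0)"
    proof (rule Lim_null_comparison)
      show "eventually (\<lambda>h::real. norm ((max 0 h)\<^sup>2 / h) \<le> \<bar>h\<bar>) (at 0)"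
        by (auto simp: eventually_at_filter max_def power2_eq_square)
      show "((\<lambda>h::real. \<bar>h\<bar>) \<longlongrightarrow> 0) (at 0)" by (auto intro!: tendsto_eq_intros)
    qed
    thus ?thesis using 3 by (simp add: DERIV_def)
  qed
qed

text \<open>In the direction \<open>g\<close> itself the slope of \<open>v\<close> is the square of
  \<open>norm g\<close>, while the difference quotients are at most
  \<open>L * norm g\<close>.\<close>

lemma gradient_bound_of_lipschitz:
  fixes v :: "'a::euclidean_space \<Rightarrow> real"
  assumes "(v has_derivative (\<lambda>h. inner g h)) (at x)" "L-lipschitz_on UNIV v"
  shows "norm g \<le> L"
proof (cases "g = 0")
  case False
  have "((\<lambda>t::real. v (x + t *\<^sub>R g)) has_derivative (\<lambda>t. inner g (t *\<^sub>R g))) (at 0)"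
    using assms(1) by (intro has_derivative_compose[of "\<lambda>t. x + t *\<^sub>R g" _ 0 UNIV v]) (auto intro!: derivative_eq_intros)
  hence "((\<lambda>t::real. v (x + t *\<^sub>R g)) has_real_derivative (norm g)\<^sup>2) (at 0)"
    by (simp add: has_field_derivative_def power2_norm_eq_inner mult_commute_abs)
  hence "((\<lambda>t. (v (x + t *\<^sub>R g) - v x) / t) \<longlongrightarrow> (norm g)\<^sup>2) (at 0)"
    by (simp add: DERIV_def)
  moreover have "(v (x + t *\<^sub>R g) - v x) / t \<le> L * norm g" if "t \<noteq> 0" for t
  proof -
    have "\<bar>v (x + t *\<^sub>R g) - v x\<bar> \<le> L * (\<bar>t\<bar> * norm g)"
      using lipschitz_onD[OF assms(2), of "x + t *\<^sub>R g" x] by (simp add: dist_norm)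
    hence "\<bar>(v (x + t *\<^sub>R g) - v x) / t\<bar> \<le> L * norm g"
      using that by (simp add: abs_divide field_simps)
    thus ?thesis by linarith
  qed
  ultimately have "(norm g)\<^sup>2 \<le> L * norm g"
    by (intro tendsto_upperbound[of _ _ "at 0"]) (auto simp: eventually_at_filter)
  thus ?thesis using False by (simp add: power2_eq_square)
qed (use lipschitz_on_nonneg[OF assms(2)] in simp)

lemma lborel_integral_translation:
  fixes f :: "'a::euclidean_space \<Rightarrow> 'b::{banach, second_countable_topology}"
  assumes [measurable]: "f \<in> borel_measurable borel"
  shows "(\<integral>x. f (c + x) \<partial>lborel) = (\<integral>x. f x \<partial>lborel)"
proof -
  have "(\<integral>x. f x \<partial>lborel) = (\<integral>x. f x \<partial>distr lborel borel ((+) c))"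
    by (simp add: lborel_distr_plus)
  also have "\<dots> = (\<integral>x. f (c + x) \<partial>lborel)" by (subst integral_distr) auto
  finally show ?thesis by simp
qed

lemma integrable_continuous_compact_support:
  fixes f :: "'a::euclidean_space \<Rightarrow> 'b::euclidean_space"
  assumes "continuous_on UNIV f" "compact K" "\<And>x. x \<notin> K \<Longrightarrow> f x = 0"
  shows "integrable lborel f"
proof -
  have "set_integrable lborel K f"
    unfolding set_integrable_def using assms by (intro borel_integrable_compact continuous_on_subset[OF assms(1)]) auto
  moreover have "indicator K x *\<^sub>R f x = f x" for x using assms(3)[of x] by (auto simp: indicator_def)
  ultimately show ?thesis by (simp add: set_integrable_def)
qed

text \<open>\<open>testfn_g\<close> asks only for a continuous gradient, so the square of a positive
  part is regular enough as a mollifier, and its derivative is explicit. It is not normalised; users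
  divide by its integral.\<close>

definition bump :: "real \<Rightarrow> 'a::euclidean_space \<Rightarrow> real" where
  "bump \<eta> z = (max 0 (\<eta>\<^sup>2 - inner z z))\<^sup>2"

lemma bump_has_derivative:
  "((\<lambda>x. bump \<eta> (y - x)) has_derivative (\<lambda>h. 4 * max 0 (\<eta>\<^sup>2 - inner (y - x) (y - x)) * inner (y - x) h)) (at x)"
proof -
  have "((\<lambda>x. \<eta>\<^sup>2 - inner (y - x) (y - x)) has_derivative (\<lambda>h. 2 * inner (y - x) h)) (at x)"
    by (auto intro!: derivative_eq_intros simp: inner_commute)
  from has_derivative_compose[OF this, of "\<lambda>s. (max 0 s)\<^sup>2" "(*) (2 * max 0 (\<eta>\<^sup>2 - inner (y - x) (y - x)))"]
  show ?thesis using max0_square_has_derivative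
    by (simp add: bump_def[abs_def] has_field_derivative_def mult_ac)
qed

lemma bump_zero: "\<eta> > 0 \<Longrightarrow> norm z \<ge> \<eta> \<Longrightarrow> bump \<eta> z = 0"
  using power_mono[of \<eta> "norm z" 2] by (simp add: bump_def power2_norm_eq_inner[symmetric])

lemma bump_nonneg: "bump \<eta> z \<ge> 0" by (simp add: bump_def)

lemma bump_cont: "continuous_on S (bump \<eta>)"
  unfolding bump_def[abs_def] by (intro continuous_intros)

lemma bump_integral:
  fixes \<eta> :: real
  assumes "\<eta> > 0"
  shows "integrable lborel (bump \<eta> :: 'a::euclidean_space \<Rightarrow> real)"
    and "(\<integral>z. bump \<eta> (z::'a) \<partial>lborel) > 0"
proof -
  show *: "integrable lborel (bump \<eta> :: 'a \<Rightarrow> real)"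
    using assms by (intro integrable_continuous_compact_support[OF bump_cont, of "cball 0 \<eta>"])
      (auto intro!: bump_zero)
  have "(\<integral>z. bump \<eta> (z::'a) \<partial>lborel) \<noteq> 0"
  proof
    assume "(\<integral>z. bump \<eta> (z::'a) \<partial>lborel) = 0"
    hence "AE z in lborel. bump \<eta> (z::'a) = 0"
      using * by (subst (asm) integral_nonneg_eq_0_iff_AE) (auto simp: bump_nonneg)
    hence "AE z in lborel. (z::'a) \<notin> ball 0 \<eta>"
    proof eventually_elim
      case (elim z)
      show ?case
      proof
        assume "z \<in> ball 0 \<eta>"
        hence "(norm z)\<^sup>2 < \<eta>\<^sup>2" using assms by (intro power_strict_mono) auto
        thus False using elim by (simp add: bump_def power2_norm_eq_inner max_def split: if_splits)
      qed
    qed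
    hence "ball (0::'a) \<eta> \<in> null_sets lborel" by (subst AE_iff_null_sets) auto
    hence "negligible (ball (0::'a) \<eta>)" by (simp add: negligible_iff_null_sets null_sets_completionI)
    thus False using assms open_not_negligible[of "ball (0::'a) \<eta>"] by auto
  qed
  moreover have "(\<integral>z. bump \<eta> (z::'a) \<partial>lborel) \<ge> 0" by (intro integral_nonneg_AE) (auto simp: bump_nonneg)
  ultimately show "(\<integral>z. bump \<eta> (z::'a) \<partial>lborel) > 0" by simp
qed

text \<open>The mollified function is used in two forms. As an integral over a fixed box against
  \<open>bump \<eta> (y - x)\<close> it can be differentiated under the integral sign. As an average
  of \<open>w (x + z)\<close> with the weight \<open>bump \<eta> z / Z\<close> it inherits the
  Lipschitz constant, and with it the gradient bound, and stays close to \<open>w\<close>.\<close>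

lemma lipschitz_mollification:
  fixes w :: "'a::euclidean_space \<Rightarrow> real"
  assumes L: "L-lipschitz_on UNIV w" and K: "compact K" "\<And>x. x \<notin> K \<Longrightarrow> w x = 0" and "\<eta> > 0"
  obtains v g where "\<And>x. (v has_derivative (\<lambda>h. inner (g x) h)) (at x)" "continuous_on UNIV g"
    "\<And>x. \<bar>v x - w x\<bar> \<le> L * \<eta>" "\<And>x. norm (g x) \<le> L"
    "\<And>x. (\<And>y. y \<in> K \<Longrightarrow> \<eta> \<le> dist x y) \<Longrightarrow> v x = 0"
proof -
  obtain b where b: "K \<subseteq> cbox (-b) b" using bounded_subset_cbox_symmetric[OF compact_imp_bounded[OF K(1)]] by blast
  define Z where "Z = (\<integral>z. bump \<eta> (z::'a) \<partial>lborel)"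
  have Z: "Z > 0" and ib: "integrable lborel (bump \<eta> :: 'a \<Rightarrow> real)" using bump_integral[OF \<open>\<eta> > 0\<close>] by (auto simp: Z_def)
  have wc: "continuous_on S w" for S
    using lipschitz_on_continuous_on[OF L] continuous_on_subset by blast
  define k where "k x y = w y / Z * 4 * max 0 (\<eta>\<^sup>2 - inner (y - x) (y - x))" for x y
  define v where "v x = integral (cbox (-b) b) (\<lambda>y. w y / Z * bump \<eta> (y - x))" for x
  define g where "g x = integral (cbox (-b) b) (\<lambda>y. k x y *\<^sub>R (y - x))" for x
  have kc: "continuous_on S (\<lambda>(x, y). k x y *\<^sub>R (y - x))" for S
    unfolding k_def using Z by (auto simp: split_def intro!: continuous_intros continuous_on_compose2[OF wc])
  have der: "(v has_derivative (\<lambda>h. inner (g x) h)) (at x)" for x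
  proof -
    define fx where "fx x y = blinfun_inner_right (k x y *\<^sub>R (y - x))" for x y
    have int: "fx x integrable_on cbox (-b) b"
      unfolding fx_def k_def using Z
      by (intro integrable_continuous) (auto intro!: continuous_intros wc bounded_linear.continuous_on[OF bounded_linear_blinfun_inner_right])
    have "((\<lambda>x. integral (cbox (-b) b) (\<lambda>y. w y / Z * bump \<eta> (y - x))) has_derivative
        blinfun_apply (integral (cbox (-b) b) (fx x))) (at x within UNIV)"
    proof (rule leibniz_rule[where U = UNIV and fx = fx])
      fix x y
      show "((\<lambda>x. w y / Z * bump \<eta> (y - x)) has_derivative blinfun_apply (fx x y)) (at x within UNIV)"
        by (rule has_derivative_eq_rhs[OF has_derivative_mult_right[OF bump_has_derivative]])
           (auto simp: fx_def k_def fun_eq_iff)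
      show "(\<lambda>y. w y / Z * bump \<eta> (y - x)) integrable_on cbox (-b) b"
        using Z by (intro integrable_continuous continuous_intros wc continuous_on_compose2[OF bump_cont]) auto
    next
      show "continuous_on (UNIV \<times> cbox (- b) b) (\<lambda>(x, t). fx x t)"
        unfolding fx_def split_def using kc[unfolded split_def]
        by (intro bounded_linear.continuous_on[OF bounded_linear_blinfun_inner_right])
    qed auto
    moreover have "blinfun_apply (integral (cbox (-b) b) (fx x)) = (\<lambda>h. inner (g x) h)"
    proof
      fix h
      show "blinfun_apply (integral (cbox (-b) b) (fx x)) h = inner (g x) h"
      proof -
        have "(\<lambda>y. k x y *\<^sub>R (y - x)) integrable_on cbox (-b) b" unfolding k_def using Z
          by (intro integrable_continuous) (auto intro!: continuous_intros wc)
        from integral_linear[OF this bounded_linear_inner_left[of h]]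
        show ?thesis using blinfun_apply_integral[OF int, of h]
          by (simp add: fx_def g_def o_def)
      qed
    qed
    ultimately show ?thesis by (simp add: v_def[abs_def])
  qed
  have gc: "continuous_on UNIV g"
    unfolding g_def using kc by (intro integral_continuous_on_param) auto
  have conv: "v x = (\<integral>z. w (x + z) * (bump \<eta> z / Z) \<partial>lborel)" and
    iconv: "integrable lborel (\<lambda>z. w (x + z) * (bump \<eta> z / Z))" for x
  proof -
    have c: "continuous_on S (\<lambda>y. w y * (bump \<eta> (y - x) / Z))" for S
      using Z by (intro continuous_intros wc continuous_on_compose2[OF bump_cont]) auto
    have [measurable]: "(\<lambda>y. w y * (bump \<eta> (y - x) / Z)) \<in> borel_measurable borel"
      by (intro borel_measurable_continuous_onI c)
    have "v x = integral UNIV (\<lambda>y. w y * (bump \<eta> (y - x) / Z))"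
    proof -
      have "(if y \<in> cbox (-b) b then w y / Z * bump \<eta> (y - x) else 0) = w y * (bump \<eta> (y - x) / Z)" for y
        using K(2)[of y] b by auto
      thus ?thesis unfolding v_def by (subst integral_restrict_UNIV[symmetric]) (simp only:)
    qed
    also have "\<dots> = (\<integral>y. w y * (bump \<eta> (y - x) / Z) \<partial>lborel)"
      using K by (intro integral_lborel integrable_continuous_compact_support[OF c K(1)]) auto
    also have "\<dots> = (\<integral>z. w (x + z) * (bump \<eta> (x + z - x) / Z) \<partial>lborel)"
      by (rule lborel_integral_translation[symmetric]) measurable
    finally show "v x = (\<integral>z. w (x + z) * (bump \<eta> z / Z) \<partial>lborel)" by simp
    have "continuous_on UNIV (\<lambda>z. w (x + z) * (bump \<eta> z / Z))"
      using Z by (intro continuous_intros continuous_on_compose2[OF wc] bump_cont) auto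
    thus "integrable lborel (\<lambda>z. w (x + z) * (bump \<eta> z / Z))"
      by (rule integrable_continuous_compact_support[OF _ compact_cball[of 0 \<eta>]])
         (use \<open>\<eta> > 0\<close> in \<open>auto intro!: bump_zero\<close>)
  qed
  have one: "(\<integral>z. bump \<eta> (z::'a) / Z \<partial>lborel) = 1" using Z by (simp add: Z_def)
  \<comment> \<open>The weight has mass 1 and lives on the ball of radius \<open>\<eta>\<close>.
    This is applied to \<open>w (x + z) - w (x' + z)\<close> for the Lipschitz bound and to
    \<open>w (x + z) - w x\<close> for the distance to \<open>w\<close>.\<close>
  have est: "\<bar>\<integral>z. u z * (bump \<eta> z / Z) \<partial>lborel\<bar> \<le> B"
    if "integrable lborel (\<lambda>z. u z * (bump \<eta> z / Z))" "\<And>z. norm z < \<eta> \<Longrightarrow> \<bar>u z\<bar> \<le> B" for u :: "'a \<Rightarrow> real" and B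
  proof -
    have "\<bar>\<integral>z. u z * (bump \<eta> z / Z) \<partial>lborel\<bar> \<le> (\<integral>z. B * (bump \<eta> (z::'a) / Z) \<partial>lborel)"
      unfolding real_norm_def[symmetric]
    proof (rule Bochner_Integration.integral_norm_bound_integral[OF that(1)])
      show "integrable lborel (\<lambda>z::'a. B * (bump \<eta> z / Z))" using ib by auto
      fix z :: 'a
      show "norm (u z * (bump \<eta> z / Z)) \<le> B * (bump \<eta> z / Z)"
        using that(2)[of z] bump_zero[OF \<open>\<eta> > 0\<close>, of z] bump_nonneg[of \<eta> z] Z
        by (cases "norm z < \<eta>") (auto simp: abs_mult intro!: divide_right_mono mult_right_mono)
    qed
    also have "\<dots> = B" using one by (subst integral_mult_right_zero) simp
    finally show ?thesis .
  qed
  have vdiff: "\<bar>v x - v x'\<bar> \<le> L * dist x x'" for x x'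
  proof -
    have "v x - v x' = (\<integral>z. (w (x + z) - w (x' + z)) * (bump \<eta> z / Z) \<partial>lborel)"
      unfolding conv left_diff_distrib by (rule Bochner_Integration.integral_diff[symmetric]; rule iconv)
    also have "\<bar>\<dots>\<bar> \<le> L * dist x x'"
    proof (rule est)
      show "integrable lborel (\<lambda>z. (w (x + z) - w (x' + z)) * (bump \<eta> z / Z))"
        unfolding left_diff_distrib by (intro Bochner_Integration.integrable_diff iconv)
      show "\<bar>w (x + z) - w (x' + z)\<bar> \<le> L * dist x x'" for z
        using lipschitz_onD[OF L, of "x + z" "x' + z"] by (simp add: dist_norm)
    qed
    finally show ?thesis .
  qed
  have vL: "L-lipschitz_on UNIV v"
    using vdiff lipschitz_on_nonneg[OF L] by (intro lipschitz_onI) (auto simp: dist_real_def)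
  show ?thesis
  proof (rule that[OF der gc _ gradient_bound_of_lipschitz[OF der vL]])
    fix x
    have iw: "integrable lborel (\<lambda>z::'a. w x * (bump \<eta> z / Z))"
      by (intro integrable_mult_right integrable_divide ib)
    have "v x - w x = (\<integral>z. (w (x + z) - w x) * (bump \<eta> z / Z) \<partial>lborel)"
      unfolding conv left_diff_distrib
      by (subst Bochner_Integration.integral_diff[OF iconv iw], subst integral_mult_right_zero)
         (simp only: one mult_1_right)
    also have "\<bar>\<dots>\<bar> \<le> L * \<eta>"
    proof (rule est)
      show "integrable lborel (\<lambda>z. (w (x + z) - w x) * (bump \<eta> z / Z))"
        unfolding left_diff_distrib by (intro Bochner_Integration.integrable_diff iconv iw)
      fix z :: 'a assume "norm z < \<eta>"
      thus "\<bar>w (x + z) - w x\<bar> \<le> L * \<eta>"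
        using lipschitz_onD[OF L, of "x + z" x] mult_left_mono[of "norm z" \<eta> L] lipschitz_on_nonneg[OF L]
        by (simp add: dist_norm)
    qed
    finally show "\<bar>v x - w x\<bar> \<le> L * \<eta>" .
  next
    fix x assume far: "\<And>y. y \<in> K \<Longrightarrow> \<eta> \<le> dist x y"
    have z: "w y / Z * bump \<eta> (y - x) = 0" for y
      using far[of y] K(2)[of y] bump_zero[OF \<open>\<eta> > 0\<close>, of "y - x"] by (cases "y \<in> K") (auto simp: dist_norm norm_minus_commute)
    show "v x = 0" unfolding v_def z by simp
  qed
qed

text \<open>\<open>w\<close> vanishes outside \<open>\<Omega>\<close>, but its support may reach the
  boundary. Subtracting the part clipped at height \<open>e\<close> leaves a function supported in
  the compact subset \<open>K\<close> of \<open>\<Omega>\<close>, within \<open>e\<close> of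
  \<open>w\<close> and with the same Lipschitz constant; only this function is mollified.\<close>

lemma lipschitz_testfn_approx:
  fixes w :: "real^'n \<Rightarrow> real"
  assumes \<Omega>: "open \<Omega>" "bounded \<Omega>" and L: "L-lipschitz_on UNIV w" and z: "\<And>x. x \<notin> \<Omega> \<Longrightarrow> w x = 0" and "\<epsilon> > 0"
  obtains \<psi> g where "testfn_g \<Omega> \<psi> g" "\<And>x. \<bar>\<psi> x - w x\<bar> \<le> \<epsilon>" "\<And>x. norm (g x) \<le> L"
proof -
  define e where "e = \<epsilon> / 2"
  have e: "e > 0" using \<open>\<epsilon> > 0\<close> by (simp add: e_def)
  define t where "t x = w x - max (- e) (min e (w x))" for x
  define K where "K = {x. e \<le> \<bar>w x\<bar>}"
  have wc: "continuous_on UNIV w" by (rule lipschitz_on_continuous_on[OF L])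
  have "closed K" unfolding K_def by (intro closed_Collect_le continuous_intros wc)
  moreover have K\<Omega>: "K \<subseteq> \<Omega>" using z e by (force simp: K_def)
  ultimately have K: "compact K" using \<Omega> bounded_subset compact_eq_bounded_closed by blast
  obtain r where r: "r > 0" "(\<Union>x\<in>K. cball x r) \<subseteq> \<Omega>"
    using compact_subset_open_imp_cball_epsilon_subset[OF K \<Omega>(1) K\<Omega>] by blast
  have L0: "L \<ge> 0" by (rule lipschitz_on_nonneg[OF L])
  \<comment> \<open>\<open>\<eta> \<le> r\<close> keeps the support of the mollification in
    \<open>\<Omega>\<close>; \<open>e / (L + 1)\<close> makes its error at most \<open>e\<close>,
    where the 1 avoids a division by zero.\<close>
  define \<eta> where "\<eta> = min r (e / (L + 1))"
  have \<eta>: "\<eta> > 0" using r e L0 by (simp add: \<eta>_def)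
  have "L * \<eta> \<le> (L + 1) * (e / (L + 1))" using L0 e using r(1) by (intro mult_mono) (auto simp: \<eta>_def)
  hence L\<eta>: "L * \<eta> \<le> e" using L0 by simp
  have tL: "L-lipschitz_on UNIV t"
  proof (rule lipschitz_onI[OF _ L0])
    fix x y
    have "\<bar>t x - t y\<bar> \<le> \<bar>w x - w y\<bar>" unfolding t_def max_def min_def using e by auto
    also have "\<dots> \<le> L * dist x y" using lipschitz_onD[OF L, of x y] by (simp add: dist_real_def)
    finally show "dist (t x) (t y) \<le> L * dist x y" by (simp add: dist_real_def)
  qed
  have t0: "t x = 0" if "x \<notin> K" for x using that by (auto simp: t_def K_def)
  have tw: "\<bar>t x - w x\<bar> \<le> e" for x using e by (auto simp: t_def)
  obtain v g where v: "\<And>x. (v has_derivative (\<lambda>h. inner (g x) h)) (at x)" "continuous_on UNIV g"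
    "\<And>x. \<bar>v x - t x\<bar> \<le> L * \<eta>" "\<And>x. norm (g x) \<le> L"
    "\<And>x. (\<And>y. y \<in> K \<Longrightarrow> \<eta> \<le> dist x y) \<Longrightarrow> v x = 0"
    using lipschitz_mollification[OF tL K t0 \<eta>] by blast
  \<comment> \<open>\<open>infdist\<close> to the empty set is 0, so without the first conjunct
    \<open>S\<close> would be the whole space when \<open>K\<close> is empty.\<close>
  define S where "S = {x. K \<noteq> {} \<and> infdist x K \<le> r}"
  have S\<Omega>: "S \<subseteq> \<Omega>"
  proof
    fix x assume "x \<in> S"
    then obtain y where "y \<in> K" "infdist x K = dist x y" "infdist x K \<le> r"
      using infdist_attains_inf[OF compact_imp_closed[OF K]] by (auto simp: S_def)
    hence "x \<in> cball y r" by (simp add: dist_commute)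
    thus "x \<in> \<Omega>" using r(2) \<open>y \<in> K\<close> by blast
  qed
  have "closed S"
    unfolding S_def by (cases "K = {}") (auto intro!: closed_Collect_le continuous_intros)
  moreover have "{x. v x \<noteq> 0} \<subseteq> S"
  proof
    fix x assume "x \<in> {x. v x \<noteq> 0}"
    then obtain y where y: "y \<in> K" "dist x y < \<eta>" using v(5)[of x] by force
    hence "infdist x K \<le> r" using infdist_le[OF y(1), of x] by (simp add: \<eta>_def)
    thus "x \<in> S" using y by (auto simp: S_def)
  qed
  ultimately have cl: "closure {x. v x \<noteq> 0} \<subseteq> S" by (simp add: closure_minimal)
  have "compact (closure {x. v x \<noteq> 0})"
    using cl S\<Omega> \<Omega>(2) by (metis bounded_subset closed_closure compact_eq_bounded_closed subset_trans)
  hence "testfn_g \<Omega> v g" using v(1,2) cl S\<Omega> by (auto simp: testfn_g_def)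
  moreover have "\<bar>v x - w x\<bar> \<le> \<epsilon>" for x using v(3)[of x] tw[of x] L\<eta> unfolding e_def by linarith
  ultimately show ?thesis using v(4) that by blast
qed

section \<open>Test functions and weak gradients\<close>

lemma compact_support_integral:
  fixes f :: "'a::euclidean_space \<Rightarrow> 'b::euclidean_space"
  assumes "continuous_on UNIV f" "compact K" "\<And>x. x \<notin> K \<Longrightarrow> f x = 0" "K \<subseteq> S"
  shows "f absolutely_integrable_on S" "integral S f = (\<integral>x. f x \<partial>lborel)"
proof -
  have i: "integrable lborel f" by (rule integrable_continuous_compact_support[OF assms(1-3)])
  have eq: "(\<lambda>x. if x \<in> S then f x else 0) = f" using assms(3,4) by fastforce
  have "f \<in> borel_measurable lborel" using assms(1) by (simp add: borel_measurable_continuous_onI)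
  hence "integrable lebesgue f" using i by (simp add: integrable_completion)
  hence "f absolutely_integrable_on UNIV" by (simp add: set_integrable_def)
  thus "f absolutely_integrable_on S"
    using absolutely_integrable_restrict_UNIV[of S f] eq by simp
  show "integral S f = (\<integral>x. f x \<partial>lborel)"
    using Henstock_Kurzweil_Integration.integral_restrict_UNIV[of S f] integral_lborel[OF i] eq by simp
qed

lemma testfn_g_facts:
  fixes \<psi> :: "real^'n \<Rightarrow> real"
  assumes "testfn_g \<Omega> \<psi> g"
  shows "continuous_on UNIV \<psi>" "continuous_on UNIV g"
    "\<exists>K. compact K \<and> K \<subseteq> \<Omega> \<and> (\<forall>x. x \<notin> K \<longrightarrow> \<psi> x = 0 \<and> g x = 0)"
proof -
  define K where "K = closure {x. \<psi> x \<noteq> 0}"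
  have K: "compact K" "K \<subseteq> \<Omega>" using assms by (auto simp: testfn_g_def K_def)
  show "continuous_on UNIV g" using assms by (auto simp: testfn_g_def)
  have d: "(\<psi> has_derivative (\<lambda>h. inner (g x) h)) (at x)" for x using assms by (auto simp: testfn_g_def)
  show "continuous_on UNIV \<psi>"
    using d has_derivative_continuous by (fastforce intro: continuous_at_imp_continuous_on)
  have z: "\<psi> x = 0" if "x \<notin> K" for x using that closure_subset[of "{x. \<psi> x \<noteq> 0}"] by (auto simp: K_def)
  have "g x = 0" if "x \<notin> K" for x
  proof -
    have "open (- K)" unfolding K_def by (intro open_Compl closed_closure)
    have "((\<lambda>_. 0) has_derivative (\<lambda>h. inner (g x) h)) (at x)"
      by (rule has_derivative_transform_within_open[OF d \<open>open (- K)\<close>]) (use that z in auto)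
    hence "(\<lambda>h. inner (g x) h) = (\<lambda>_. 0)" using has_derivative_unique has_derivative_const by blast
    thus ?thesis by (metis inner_eq_zero_iff)
  qed
  with K z show "\<exists>K. compact K \<and> K \<subseteq> \<Omega> \<and> (\<forall>x. x \<notin> K \<longrightarrow> \<psi> x = 0 \<and> g x = 0)" by blast
qed

lemma testfn_g_bounded:
  fixes \<psi> :: "real^'n \<Rightarrow> real"
  assumes "testfn_g \<Omega> \<psi> g"
  shows "\<exists>B>0. \<forall>x. \<bar>\<psi> x\<bar> \<le> B \<and> norm (g x) \<le> B"
proof -
  obtain K where K: "compact K" "K \<subseteq> \<Omega>" "\<And>x. x \<notin> K \<Longrightarrow> \<psi> x = 0" "\<And>x. x \<notin> K \<Longrightarrow> g x = 0"
    "continuous_on UNIV \<psi>" "continuous_on UNIV g" using testfn_g_facts[OF assms] by blast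
  have "bounded (\<psi> ` K)" "bounded (g ` K)"
    using K by (meson compact_continuous_image compact_imp_bounded continuous_on_subset subset_UNIV)+
  then obtain B1 B2 where B: "B1 > 0" "\<And>x. x \<in> K \<Longrightarrow> norm (\<psi> x) \<le> B1" "B2 > 0" "\<And>x. x \<in> K \<Longrightarrow> norm (g x) \<le> B2"
    unfolding bounded_pos by blast
  show ?thesis
  proof (intro exI[of _ "max B1 B2"] conjI allI)
    show "max B1 B2 > 0" using B by simp
    fix x
    show "\<bar>\<psi> x\<bar> \<le> max B1 B2" using B K(3)[of x] by (cases "x \<in> K") (auto simp: le_max_iff_disj)
    show "norm (g x) \<le> max B1 B2" using B K(4)[of x] by (cases "x \<in> K") (auto simp: le_max_iff_disj)
  qed
qed

text \<open>Difference quotients integrate to zero by translation invariance. They are dominated by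
  the Lipschitz bound \<open>B\<close> on a common ball and converge to the partial
  derivative.\<close>

lemma testfn_grad_integral:
  fixes \<psi> :: "real^'n \<Rightarrow> real"
  assumes "testfn_g \<Omega> \<psi> g"
  shows "integral \<Omega> (\<lambda>x. g x $ j) = 0"
proof -
  obtain K where K: "compact K" "K \<subseteq> \<Omega>" "\<And>x. x \<notin> K \<Longrightarrow> \<psi> x = 0" "\<And>x. x \<notin> K \<Longrightarrow> g x = 0"
    and c: "continuous_on UNIV \<psi>" "continuous_on UNIV g" using testfn_g_facts[OF assms] by blast
  obtain B where B: "\<And>x. norm (g x) \<le> B" "B > 0" using testfn_g_bounded[OF assms] by blast
  have d: "(\<psi> has_derivative (\<lambda>h. inner (g x) h)) (at x)" for x using assms by (auto simp: testfn_g_def)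
  have lip: "\<bar>\<psi> x - \<psi> y\<bar> \<le> B * norm (x - y)" for x y
  proof -
    have "norm (\<psi> x - \<psi> y) \<le> B * norm (x - y)"
    proof (rule differentiable_bound[of UNIV _ "\<lambda>x h. inner (g x) h"])
      fix z show "onorm (\<lambda>h. inner (g z) h) \<le> B"
        using B(1)[of z] B(2) by (intro onorm_bound) (auto intro!: order_trans[OF Cauchy_Schwarz_ineq2] mult_right_mono)
    qed (use d in auto)
    thus ?thesis by simp
  qed
  obtain r where "\<forall>y\<in>K. dist 0 y \<le> r"
    using compact_imp_bounded[OF K(1)] bounded_any_center[of K 0] by blast
  hence r: "K \<subseteq> cball 0 r" by auto
  define e :: "real^'n" where "e = axis j 1"
  have ne: "norm e = 1" by (simp add: e_def)
  define D where "D n x = (\<psi> (x + (1 / real (Suc n)) *\<^sub>R e) - \<psi> x) * real (Suc n)" for n x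
  \<comment> \<open>The shifts have length at most 1, so enlarging the radius by 1 covers the
    support of every quotient.\<close>
  have supp: "D n x = 0 \<and> g x $ j = 0" if "x \<notin> cball 0 (r + 1)" for n x
  proof -
    define v where "v = (1 / real (Suc n)) *\<^sub>R e"
    have "norm v \<le> 1" using ne by (simp add: v_def)
    hence "x + v \<notin> cball 0 r"
      using that norm_triangle_ineq4[of "x + v" v] by auto
    hence "x + (1 / real (Suc n)) *\<^sub>R e \<notin> cball 0 r" by (simp add: v_def)
    moreover have "x \<notin> cball 0 r" using that by auto
    ultimately show ?thesis using K(3,4) r unfolding D_def by (metis diff_self mult_zero_left subsetD zero_index)
  qed
  have cD: "continuous_on UNIV (D n)" for n
    unfolding D_def by (intro continuous_intros continuous_on_compose2[OF c(1)]) auto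
  have Dint: "D n absolutely_integrable_on UNIV" "integral UNIV (D n) = 0" for n
  proof -
    show "D n absolutely_integrable_on UNIV"
      by (rule compact_support_integral[OF cD compact_cball[of 0 "r + 1"]]) (use supp in auto)
    have i: "integrable lborel \<psi>" by (rule integrable_continuous_compact_support[OF c(1) K(1,3)])
    have m: "\<psi> \<in> borel_measurable borel" using c(1) by (rule borel_measurable_continuous_onI)
    have t: "(\<integral>x. \<psi> ((1 / real (Suc n)) *\<^sub>R e + x) \<partial>lborel) = (\<integral>x. \<psi> x \<partial>lborel)"
      by (rule lborel_integral_translation[OF m])
    have i': "integrable lborel (\<lambda>x. \<psi> (x + (1 / real (Suc n)) *\<^sub>R e))"
    proof (rule integrable_continuous_compact_support[OF _ compact_cball[of 0 "r + 1"]])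
      show "continuous_on UNIV (\<lambda>x. \<psi> (x + (1 / real (Suc n)) *\<^sub>R e))"
        by (intro continuous_on_compose2[OF c(1)] continuous_intros) auto
      show "\<psi> (x + (1 / real (Suc n)) *\<^sub>R e) = 0" if "x \<notin> cball 0 (r + 1)" for x
        using supp[OF that, of n] K(3)[of x] that r by (force simp: D_def)
    qed
    have "integral UNIV (D n) = (\<integral>x. D n x \<partial>lborel)"
      by (rule compact_support_integral[OF cD compact_cball[of 0 "r + 1"]]) (use supp in auto)
    also have "\<dots> = 0" unfolding D_def using i i' t by (simp add: add.commute)
    finally show "integral UNIV (D n) = 0" .
  qed
  have "(\<lambda>n. integral UNIV (D n)) \<longlonglongrightarrow> integral UNIV (\<lambda>x. g x $ j)"
  proof (rule dominated_convergence)
    show "D n integrable_on UNIV" for n using Dint(1) absolutely_integrable_on_def by blast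
    have "(\<lambda>x. B :: real) integrable_on cball 0 (r + 1)"
      by (intro integrable_on_const) (simp add: lmeasurable_cball)
    thus "(\<lambda>x. if x \<in> cball 0 (r + 1) then B else 0) integrable_on UNIV"
      by (simp only: Henstock_Kurzweil_Integration.integrable_restrict_UNIV)
    fix x
    show "norm (D n x) \<le> (if x \<in> cball 0 (r + 1) then B else 0)" for n
    proof (cases "x \<in> cball 0 (r + 1)")
      case True
      have "\<bar>D n x\<bar> \<le> B * norm ((1 / real (Suc n)) *\<^sub>R e) * real (Suc n)"
        using lip[of "x + (1 / real (Suc n)) *\<^sub>R e" x] unfolding D_def abs_mult by (intro mult_mono) auto
      also have "\<dots> = B" using ne by simp
      finally show ?thesis using True by simp
    qed (use supp in auto)
    have "((\<lambda>t. \<psi> (x + t *\<^sub>R e)) has_derivative (\<lambda>t. inner (g x) (t *\<^sub>R e))) (at 0)"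
      using d by (intro has_derivative_compose[of "\<lambda>t. x + t *\<^sub>R e" _ 0 UNIV \<psi>]) (auto intro!: derivative_eq_intros)
    hence "((\<lambda>t. \<psi> (x + t *\<^sub>R e)) has_real_derivative g x $ j) (at 0)"
      by (simp add: has_field_derivative_def e_def inner_axis mult_commute_abs)
    hence "((\<lambda>t. (\<psi> (x + t *\<^sub>R e) - \<psi> x) / t) \<longlongrightarrow> g x $ j) (at 0)" by (simp add: DERIV_def)
    moreover have "filterlim (\<lambda>n. 1 / real (Suc n)) (at 0) sequentially"
      unfolding filterlim_at using LIMSEQ_inverse_real_of_nat by (simp add: inverse_eq_divide)
    ultimately have "((\<lambda>n. (\<psi> (x + (1 / real (Suc n)) *\<^sub>R e) - \<psi> x) / (1 / real (Suc n))) \<longlongrightarrow> g x $ j) sequentially"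
      by (rule filterlim_compose)
    thus "(\<lambda>n. D n x) \<longlonglongrightarrow> g x $ j" by (simp add: D_def)
  qed
  hence "integral UNIV (\<lambda>x. g x $ j) = 0" by (simp add: Dint(2) LIMSEQ_const_iff)
  moreover have "(\<lambda>x. if x \<in> \<Omega> then g x $ j else 0) = (\<lambda>x. g x $ j)" using K(2,4) by (metis subsetD zero_index)
  ultimately show ?thesis
    using Henstock_Kurzweil_Integration.integral_restrict_UNIV[of \<Omega> "\<lambda>x. g x $ j"] by simp
qed

lemma testfn_g_mult:
  fixes \<psi> v :: "real^'n \<Rightarrow> real"
  assumes "testfn_g \<Omega> \<psi> g" "testfn_g \<Omega> v gv"
  shows "testfn_g \<Omega> (\<lambda>x. v x * \<psi> x) (\<lambda>x. v x *\<^sub>R g x + \<psi> x *\<^sub>R gv x)"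
proof -
  have d: "(\<psi> has_derivative (\<lambda>h. inner (g x) h)) (at x)" "(v has_derivative (\<lambda>h. inner (gv x) h)) (at x)" for x
    using assms by (auto simp: testfn_g_def)
  have c: "continuous_on UNIV \<psi>" "continuous_on UNIV v" "continuous_on UNIV g" "continuous_on UNIV gv"
    using testfn_g_facts[OF assms(1)] testfn_g_facts[OF assms(2)] by blast+
  have "((\<lambda>x. v x * \<psi> x) has_derivative (\<lambda>h. inner (v x *\<^sub>R g x + \<psi> x *\<^sub>R gv x) h)) (at x)" for x
    by (rule has_derivative_eq_rhs[OF has_derivative_mult[OF d(2) d(1)]])
       (simp add: fun_eq_iff inner_add_left algebra_simps)
  moreover have sub: "closure {x. v x * \<psi> x \<noteq> 0} \<subseteq> closure {x. \<psi> x \<noteq> 0}" by (intro closure_mono) auto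
  moreover have \<psi>: "compact (closure {x. \<psi> x \<noteq> 0})" "closure {x. \<psi> x \<noteq> 0} \<subseteq> \<Omega>"
    using assms(1) by (simp_all add: testfn_g_def)
  moreover have "compact (closure {x. v x * \<psi> x \<noteq> 0})"
    using compact_Int_closed[OF \<psi>(1) closed_closure[of "{x. v x * \<psi> x \<noteq> 0}"]] sub by (simp add: inf.absorb2)
  moreover have "continuous_on UNIV (\<lambda>x. v x *\<^sub>R g x + \<psi> x *\<^sub>R gv x)"
    by (intro continuous_intros c)
  ultimately show ?thesis unfolding testfn_g_def by blast
qed

text \<open>Integration by parts: the product of a component of \<open>w\<close> with a test
  function is again a test function, and its gradient integrates to zero.\<close>

lemma weak_grad_testfn:
  fixes w :: "real^'n \<Rightarrow> real^'n" and G :: "real^'n \<Rightarrow> real^'n^'n"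
  assumes "\<And>i. testfn_g \<Omega> (\<lambda>x. w x $ i) (\<lambda>x. G x $ i)"
  shows "weak_grad \<Omega> w G"
  unfolding weak_grad_def
proof (intro conjI allI impI)
  fix i j
  obtain K where K: "continuous_on UNIV (\<lambda>x. w x $ i)" "continuous_on UNIV (\<lambda>x. G x $ i)"
    using testfn_g_facts[OF assms[of i]] by blast
  have *: "f absolutely_integrable_on C" if "compact C" "continuous_on UNIV f" for f :: "real^'n \<Rightarrow> real" and C
    using that by (metis borel_integrable_compact continuous_on_subset integrable_completion set_integrable_def
      subset_UNIV borel_measurable_integrable absolutely_integrable_on_def)
  show "loc_int \<Omega> (\<lambda>x. w x $ i)" unfolding loc_int_def using K * by blast
  have "continuous_on UNIV (\<lambda>x. G x $ i $ j)" by (intro continuous_intros K)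
  thus "loc_int \<Omega> (\<lambda>x. G x $ i $ j)" unfolding loc_int_def using * by blast
next
  fix \<psi> g i j assume t: "testfn_g \<Omega> \<psi> g"
  obtain K where K: "compact K" "K \<subseteq> \<Omega>" "\<And>x. x \<notin> K \<Longrightarrow> \<psi> x = 0" "\<And>x. x \<notin> K \<Longrightarrow> g x = 0"
    "continuous_on UNIV \<psi>" "continuous_on UNIV g" using testfn_g_facts[OF t] by blast
  have c: "continuous_on UNIV (\<lambda>x. w x $ i)" "continuous_on UNIV (\<lambda>x. G x $ i)"
    using testfn_g_facts[OF assms[of i]] by blast+
  have i1: "(\<lambda>x. w x $ i * g x $ j) integrable_on \<Omega>"
    by (rule absolutely_integrable_on_def[THEN iffD1, THEN conjunct1], rule compact_support_integral[OF _ K(1)])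
       (use K c in \<open>auto intro!: continuous_intros\<close>)
  have i2: "(\<lambda>x. G x $ i $ j * \<psi> x) integrable_on \<Omega>"
    by (rule absolutely_integrable_on_def[THEN iffD1, THEN conjunct1], rule compact_support_integral[OF _ K(1)])
       (use K c in \<open>auto intro!: continuous_intros\<close>)
  have "integral \<Omega> (\<lambda>x. (w x $ i *\<^sub>R g x + \<psi> x *\<^sub>R G x $ i) $ j) = 0"
    by (rule testfn_grad_integral[OF testfn_g_mult[OF t assms]])
  also have "(\<lambda>x. (w x $ i *\<^sub>R g x + \<psi> x *\<^sub>R G x $ i) $ j) = (\<lambda>x. w x $ i * g x $ j + G x $ i $ j * \<psi> x)"
    by (simp add: fun_eq_iff mult.commute)
  finally show "integral \<Omega> (\<lambda>x. w x $ i * g x $ j) = - integral \<Omega> (\<lambda>x. G x $ i $ j * \<psi> x)"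
    using Henstock_Kurzweil_Integration.integral_add[OF i1 i2] by simp
qed

lemma integral_eq_on_support:
  fixes f :: "'a::euclidean_space \<Rightarrow> 'b::banach"
  assumes "\<And>x. x \<notin> K \<Longrightarrow> f x = 0" "K \<subseteq> S"
  shows "integral S f = integral K f"
proof -
  have "(\<lambda>x. if x \<in> S then f x else 0) = (\<lambda>x. if x \<in> K then f x else 0)" using assms by fastforce
  thus ?thesis by (metis Henstock_Kurzweil_Integration.integral_restrict_UNIV)
qed

lemma integrable_iff_on_support:
  fixes f :: "'a::euclidean_space \<Rightarrow> 'b::banach"
  assumes "\<And>x. x \<notin> K \<Longrightarrow> f x = 0" "K \<subseteq> S"
  shows "f integrable_on S \<longleftrightarrow> f integrable_on K"
proof -
  have eq: "(\<lambda>x. if x \<in> S then f x else 0) = (\<lambda>x. if x \<in> K then f x else 0)" using assms by fastforce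
  show ?thesis
    using Henstock_Kurzweil_Integration.integrable_restrict_UNIV[of S f]
      Henstock_Kurzweil_Integration.integrable_restrict_UNIV[of K f] unfolding eq by blast
qed

text \<open>The indicator of the open box is the limit of the Lipschitz functions
  \<open>w k\<close>, which rise with slope at most \<open>k\<close> from the complement and stop at
  1. Each is replaced by a test function with error at most \<open>1 / (k + 1)\<close>, and the
  frontier of the box is negligible.\<close>

lemma box_integral_zero:
  fixes h :: "real^'n \<Rightarrow> real"
  assumes "loc_int \<Omega> h" "\<And>\<psi> g. testfn_g \<Omega> \<psi> g \<Longrightarrow> integral \<Omega> (\<lambda>x. h x * \<psi> x) = 0"
    and ab: "cbox a b \<subseteq> \<Omega>"
  shows "integral (cbox a b) h = 0"
proof -
  define U where "U = box a b"
  have U: "open U" "bounded U" "- U \<noteq> {}" "closed (- U)" "U \<subseteq> cbox a b"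
  proof -
    show "open U" "closed (- U)" "U \<subseteq> cbox a b" using open_box[of a b] box_subset_cbox[of a b] by (auto simp: U_def)
    show b: "bounded U" unfolding U_def by (rule bounded_box)
    \<comment> \<open>Required for \<open>infdist\<close> to separate points of \<open>U\<close>
      from the complement: the distance to the empty set is 0 by convention.\<close>
    show "- U \<noteq> {}" 
    proof
      assume "- U = {}"
      hence "U = UNIV" by blast
      thus False using b not_bounded_UNIV[where 'a = "real^'n"] by simp
    qed
  qed
  have hi: "h absolutely_integrable_on cbox a b" using assms by (auto simp: loc_int_def)
  define w where "w k x = min 1 (real k * infdist x (- U))" for k :: nat and x
  have wL: "(real k)-lipschitz_on UNIV (w k)" for k
  proof (rule lipschitz_onI)
    fix x y
    have "\<bar>infdist x (- U) - infdist y (- U)\<bar> \<le> dist x y"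
      using infdist_triangle[of x "- U" y] infdist_triangle[of y "- U" x] by (simp add: dist_commute)
    hence "real k * \<bar>infdist x (- U) - infdist y (- U)\<bar> \<le> real k * dist x y" by (intro mult_left_mono) auto
    moreover have "\<bar>w k x - w k y\<bar> \<le> \<bar>real k * infdist x (- U) - real k * infdist y (- U)\<bar>"
      by (auto simp: w_def)
    moreover have "\<bar>real k * infdist x (- U) - real k * infdist y (- U)\<bar> = real k * \<bar>infdist x (- U) - infdist y (- U)\<bar>"
      by (simp add: right_diff_distrib[symmetric] abs_mult)
    ultimately show "dist (w k x) (w k y) \<le> real k * dist x y" by (simp add: dist_real_def)
  qed auto
  have w0: "w k x = 0" if "x \<notin> U" for k x using that by (simp add: w_def)
  have w1: "\<bar>w k x\<bar> \<le> 1" for k x using infdist_nonneg[of x "- U"] by (auto simp: w_def)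
  have "\<exists>\<psi>. (\<exists>g. testfn_g U \<psi> g) \<and> (\<forall>x. \<bar>\<psi> x - w k x\<bar> \<le> 1 / real (Suc k))" for k
  proof -
    have p: "1 / real (Suc k) > 0" by simp
    show ?thesis by (rule lipschitz_testfn_approx[OF U(1,2) wL w0 p]) blast+
  qed
  then obtain \<psi> where \<psi>: "\<And>k. \<exists>g. testfn_g U (\<psi> k) g" "\<And>k x. \<bar>\<psi> k x - w k x\<bar> \<le> 1 / real (Suc k)" by metis
  have U\<Omega>: "U \<subseteq> \<Omega>" using U ab by blast
  have tz: "integral (cbox a b) (\<lambda>x. h x * \<psi> k x) = 0" for k
  proof -
    obtain g where g: "testfn_g U (\<psi> k) g" using \<psi> by blast
    hence "testfn_g \<Omega> (\<psi> k) g" using U\<Omega> by (auto simp: testfn_g_def)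
    moreover have "\<psi> k x = 0" if "x \<notin> cbox a b" for x
      using testfn_g_facts(3)[OF g] U(5) that by blast
    hence "integral \<Omega> (\<lambda>x. h x * \<psi> k x) = integral (cbox a b) (\<lambda>x. h x * \<psi> k x)"
      by (intro integral_eq_on_support ab) auto
    ultimately show ?thesis using assms(2) by metis
  qed
  have "(\<lambda>k. integral (cbox a b) (\<lambda>x. h x * \<psi> k x)) \<longlonglongrightarrow> integral (cbox a b) (\<lambda>x. h x * indicator U x)"
  proof (rule dominated_convergence)
    show "(\<lambda>x. 2 * \<bar>h x\<bar>) integrable_on cbox a b"
      using absolutely_integrable_abs[OF hi] by (intro integrable_on_mult_right) (simp add: absolutely_integrable_on_def)
    show "(\<lambda>x. h x * \<psi> k x) integrable_on cbox a b" for k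
    proof -
      obtain g where g: "testfn_g U (\<psi> k) g" using \<psi> by blast
      obtain B where B: "\<And>x. \<bar>\<psi> k x\<bar> \<le> B" using testfn_g_bounded[OF g] by blast
      have "continuous_on UNIV (\<psi> k)" using testfn_g_facts[OF g] by blast
      hence "\<psi> k \<in> borel_measurable (lebesgue_on (cbox a b))"
        by (meson continuous_imp_measurable_on_sets_lebesgue continuous_on_subset lmeasurable_cbox fmeasurableD subset_UNIV)
      hence "(\<lambda>x. \<psi> k x * h x) absolutely_integrable_on cbox a b"
        using B hi by (intro absolutely_integrable_bounded_measurable_product[OF bilinear_times]) (auto simp: bounded_iff)
      thus ?thesis by (simp add: mult.commute absolutely_integrable_on_def)
    qed
    fix x
    show "norm (h x * \<psi> k x) \<le> 2 * \<bar>h x\<bar>" for k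
    proof -
      have "1 / real (Suc k) \<le> 1" by simp
      hence "\<bar>\<psi> k x\<bar> \<le> 2" using \<psi>(2)[of k x] w1[of k x] by linarith
      thus ?thesis using mult_left_mono[of "\<bar>\<psi> k x\<bar>" 2 "\<bar>h x\<bar>"] by (simp add: abs_mult mult.commute)
    qed
    have "(\<lambda>k. w k x) \<longlonglongrightarrow> indicator U x"
    proof (cases "x \<in> U")
      case True
      have "infdist x (- U) > 0" using U True infdist_nonneg[of x "- U"] in_closed_iff_infdist_zero[OF U(4,3), of x] by force
      then obtain k0 :: nat where k0: "1 < real k0 * infdist x (- U)" using ex_less_of_nat_mult by blast
      have "eventually (\<lambda>k. 1 < real k * infdist x (- U)) sequentially"
        using eventually_ge_at_top[of k0]
      proof eventually_elim
        case (elim k)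
        have "real k0 * infdist x (- U) \<le> real k * infdist x (- U)"
          using elim infdist_nonneg[of x "- U"] by (intro mult_right_mono) auto
        with k0 show ?case by linarith
      qed
      hence "eventually (\<lambda>k. w k x = indicator U x) sequentially"
        by eventually_elim (use True in \<open>simp add: w_def\<close>)
      thus ?thesis by (rule tendsto_eventually)
    qed (use w0 in auto)
    moreover have "(\<lambda>k. \<psi> k x - w k x) \<longlonglongrightarrow> 0"
    proof (rule Lim_null_comparison)
      show "eventually (\<lambda>k. norm (\<psi> k x - w k x) \<le> 1 / real (Suc k)) sequentially" using \<psi>(2) by simp
      show "(\<lambda>k. 1 / real (Suc k)) \<longlonglongrightarrow> 0" using LIMSEQ_inverse_real_of_nat by (simp add: inverse_eq_divide)
    qed
    ultimately have "(\<lambda>k. (\<psi> k x - w k x) + w k x) \<longlonglongrightarrow> 0 + indicator U x" by (intro tendsto_add)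
    thus "(\<lambda>k. h x * \<psi> k x) \<longlonglongrightarrow> h x * indicator U x" by (intro tendsto_mult_left) simp
  qed
  hence "integral (cbox a b) (\<lambda>x. h x * indicator U x) = 0" by (simp only: tz LIMSEQ_const_iff)
  moreover have "integral (cbox a b) (\<lambda>x. h x * indicator U x) = integral (cbox a b) h"
    by (rule integral_spike[OF negligible_frontier_interval[of a b]]) (auto simp: U_def)
  ultimately show ?thesis by simp
qed

text \<open>By Lebesgue differentiation almost every value \<open>h x\<close> is a limit of averages
  over cubes with lower corner \<open>x\<close>, and these vanish by
  \<open>box_integral_zero\<close>. Negligibility is a local property, so one small box around each
  point suffices.\<close>

lemma fundamental_lemma_of_variations:
  fixes h :: "real^'n \<Rightarrow> real"
  assumes "open \<Omega>" "loc_int \<Omega> h" "\<And>\<psi> g. testfn_g \<Omega> \<psi> g \<Longrightarrow> integral \<Omega> (\<lambda>x. h x * \<psi> x) = 0"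
  shows "negligible {x \<in> \<Omega>. h x \<noteq> 0}"
proof (subst locally_negligible_alt, intro ballI)
  fix x0 assume x0: "x0 \<in> {x \<in> \<Omega>. h x \<noteq> 0}"
  have "x0 \<in> \<Omega>" using x0 by simp
  then obtain c d where cd: "cbox c d \<subseteq> \<Omega>" "x0 \<in> box c d" and "\<forall>i\<in>Basis. c \<bullet> i < d \<bullet> i"
    by (rule open_contains_cbox[OF assms(1)])
  \<comment> \<open>The cut-off makes the function integrable on every box, whereas \<open>h\<close>
    is controlled only on compact subsets of \<open>\<Omega>\<close>.\<close>
  define f where "f t = (if t \<in> cbox c d then h t else 0)" for t
  have "h absolutely_integrable_on cbox c d" using assms cd by (auto simp: loc_int_def)
  hence "h integrable_on cbox c d" by (simp add: absolutely_integrable_on_def)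
  hence "f integrable_on UNIV" unfolding f_def by (simp only: Henstock_Kurzweil_Integration.integrable_restrict_UNIV)
  hence "f integrable_on cbox a b" for a b using integrable_on_subcbox by blast
  then obtain N where N: "negligible N" "\<And>x e. x \<notin> N \<Longrightarrow> 0 < e \<Longrightarrow>
    \<exists>d>0. \<forall>t. 0 < t \<and> t < d \<longrightarrow> norm (integral (cbox x (x + t *\<^sub>R One)) f /\<^sub>R t ^ DIM(real^'n) - f x) < e"
    using integrable_ccontinuous_explicit[of f] by blast
  have "h x = 0" if xc: "x \<in> box c d" and xN: "x \<notin> N" for x
  proof (rule ccontr)
    assume nz: "h x \<noteq> 0"
    hence "\<bar>h x\<bar> > 0" by simp
    then obtain \<delta> where \<delta>: "\<delta> > 0" "\<And>t. 0 < t \<Longrightarrow> t < \<delta> \<Longrightarrow>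
      norm (integral (cbox x (x + t *\<^sub>R One)) f /\<^sub>R t ^ DIM(real^'n) - f x) < \<bar>h x\<bar>"
      using N(2)[OF xN] by blast
    obtain e where e: "e > 0" "ball x e \<subseteq> box c d" using xc open_box open_contains_ball by blast
    \<comment> \<open>Small enough for the differentiation estimate to apply and for the opposite
      corner of the cube to stay in \<open>box c d\<close>.\<close>
    define t where "t = min (\<delta> / 2) (e / (2 * norm (One :: real^'n)))"
    have nO: "norm (One :: real^'n) > 0" by simp
    have t: "0 < t" "t < \<delta>" using \<delta> e nO by (auto simp: t_def)
    have "t * norm (One :: real^'n) \<le> e / 2" using nO by (simp add: t_def min_def field_simps split: if_splits)
    moreover have "norm (x + t *\<^sub>R One - x) = t * norm (One :: real^'n)" using t by simp
    ultimately have "x + t *\<^sub>R One \<in> ball x e" using e(1) by (simp add: dist_norm norm_minus_commute)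
    hence "x + t *\<^sub>R One \<in> box c d" using e by blast
    hence sub: "cbox x (x + t *\<^sub>R One) \<subseteq> cbox c d"
      using xc unfolding subset_box mem_box by (auto intro: less_imp_le)
    have "integral (cbox x (x + t *\<^sub>R One)) f = integral (cbox x (x + t *\<^sub>R One)) h"
      by (rule integral_cong) (use sub in \<open>auto simp: f_def\<close>)
    also have "\<dots> = 0" by (rule box_integral_zero[OF assms(2,3)]) (use sub cd in auto)
    finally have "norm (f x) < \<bar>h x\<bar>" using \<delta>(2)[OF t] by simp
    thus False using xc box_subset_cbox[of c d] by (auto simp: f_def)
  qed
  hence "box c d \<inter> {x \<in> \<Omega>. h x \<noteq> 0} \<subseteq> N" by blast
  hence "negligible (box c d \<inter> {x \<in> \<Omega>. h x \<noteq> 0})" using N(1) negligible_subset by blast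
  moreover have "openin (top_of_set {x \<in> \<Omega>. h x \<noteq> 0}) (box c d \<inter> {x \<in> \<Omega>. h x \<noteq> 0})"
    unfolding openin_open by (intro exI[of _ "box c d"]) auto
  ultimately show "\<exists>U. openin (top_of_set {x \<in> \<Omega>. h x \<noteq> 0}) U \<and> x0 \<in> U \<and> negligible U"
    using x0 cd by blast
qed

lemma weak_grad_unique:
  fixes u :: "real^'n \<Rightarrow> real^'n"
  assumes "open \<Omega>" "weak_grad \<Omega> u G" "weak_grad \<Omega> u G'"
  shows "negligible {x \<in> \<Omega>. G x \<noteq> G' x}"
proof -
  have "negligible {x \<in> \<Omega>. G x $ i $ j - G' x $ i $ j \<noteq> 0}" for i j
  proof (rule fundamental_lemma_of_variations[OF assms(1)])
    note wG = assms(2)[unfolded weak_grad_def] and wG' = assms(3)[unfolded weak_grad_def]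
    note l = wG[THEN conjunct2, THEN conjunct1, THEN spec, THEN spec, of i j]
      wG'[THEN conjunct2, THEN conjunct1, THEN spec, THEN spec, of i j]
    show "loc_int \<Omega> (\<lambda>x. G x $ i $ j - G' x $ i $ j)" unfolding loc_int_def
    proof (intro allI impI)
      fix K assume K: "compact K \<and> K \<subseteq> \<Omega>"
      show "(\<lambda>x. G x $ i $ j - G' x $ i $ j) absolutely_integrable_on K"
        by (rule set_integral_diff(1)[OF l(1)[unfolded loc_int_def, rule_format, OF K] l(2)[unfolded loc_int_def, rule_format, OF K]])
    qed
    fix \<psi> g assume t: "testfn_g \<Omega> \<psi> g"
    obtain K where K: "compact K" "K \<subseteq> \<Omega>" "\<And>x. x \<notin> K \<Longrightarrow> \<psi> x = 0" "continuous_on UNIV \<psi>"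
      using testfn_g_facts[OF t] by blast
    obtain B where B: "\<And>x. \<bar>\<psi> x\<bar> \<le> B" using testfn_g_bounded[OF t] by blast
    have Ks: "K \<in> sets lebesgue" using K(1) by (simp add: lmeasurable_compact fmeasurableD)
    have int: "(\<lambda>x. H x $ i $ j * \<psi> x) integrable_on \<Omega>" if "loc_int \<Omega> (\<lambda>x. H x $ i $ j)" for H :: "real^'n \<Rightarrow> real^'n^'n"
    proof -
      have "\<psi> \<in> borel_measurable (lebesgue_on K)"
        by (meson K(4) Ks continuous_imp_measurable_on_sets_lebesgue continuous_on_subset subset_UNIV)
      moreover have "(\<lambda>x. H x $ i $ j) absolutely_integrable_on K" using that K by (auto simp: loc_int_def)
      ultimately have "(\<lambda>x. \<psi> x * H x $ i $ j) absolutely_integrable_on K"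
        using B Ks by (intro absolutely_integrable_bounded_measurable_product[OF bilinear_times]) (auto simp: bounded_iff)
      hence "(\<lambda>x. H x $ i $ j * \<psi> x) integrable_on K" by (simp add: mult.commute absolutely_integrable_on_def)
      thus ?thesis by (rule iffD2[OF integrable_iff_on_support, rotated 2]) (use K(2,3) in auto)
    qed
    have "integral \<Omega> (\<lambda>x. G x $ i $ j * \<psi> x) = integral \<Omega> (\<lambda>x. G' x $ i $ j * \<psi> x)"
      using wG[THEN conjunct2, THEN conjunct2, rule_format, OF t, of i j]
        wG'[THEN conjunct2, THEN conjunct2, rule_format, OF t, of i j] by simp
    thus "integral \<Omega> (\<lambda>x. (G x $ i $ j - G' x $ i $ j) * \<psi> x) = 0"
      using Henstock_Kurzweil_Integration.integral_diff[OF int[OF l(1)] int[OF l(2)]] by (simp add: left_diff_distrib)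
  qed
  hence "negligible (\<Union>i. \<Union>j. {x \<in> \<Omega>. G x $ i $ j - G' x $ i $ j \<noteq> 0})" by (intro negligible_Union) auto
  moreover have "{x \<in> \<Omega>. G x \<noteq> G' x} \<subseteq> (\<Union>i. \<Union>j. {x \<in> \<Omega>. G x $ i $ j - G' x $ i $ j \<noteq> 0})"
    by (auto simp: vec_eq_iff)
  ultimately show ?thesis using negligible_subset by blast
qed

text \<open>\<open>wgrad\<close> is chosen by \<open>SOME\<close>, so it can be identified only up
  to a null set; this is how an explicitly known weak gradient is substituted for it.\<close>

lemma wgrad_eq:
  assumes "open \<Omega>" "weak_grad \<Omega> u G"
  shows "negligible {x \<in> \<Omega>. wgrad \<Omega> u x \<noteq> G x}"
proof (rule weak_grad_unique[OF assms(1) _ assms(2)])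
  show "weak_grad \<Omega> u (wgrad \<Omega> u)" unfolding wgrad_def by (rule someI[of "weak_grad \<Omega> u", OF assms(2)])
qed

section \<open>Strong approximation of Lipschitz gradients\<close>

text \<open>Resetting all functions to 0 on \<open>N\<close> turns convergence off a null set into
  pointwise convergence and changes no integral.\<close>

lemma dominated_convergence_ae:
  fixes f :: "nat \<Rightarrow> 'n::euclidean_space \<Rightarrow> 'm::euclidean_space"
  assumes f: "\<And>k. f k integrable_on S" and h: "h integrable_on S" and N: "negligible N"
    and le: "\<And>k x. x \<in> S \<Longrightarrow> norm (f k x) \<le> h x"
    and conv: "\<And>x. x \<in> S - N \<Longrightarrow> (\<lambda>k. f k x) \<longlonglongrightarrow> g x"
  shows "g integrable_on S" "(\<lambda>k. integral S (f k)) \<longlonglongrightarrow> integral S g"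
proof -
  define f' where "f' k x = (if x \<in> N then 0 else f k x)" for k x
  define g' where "g' x = (if x \<in> N then 0 else g x)" for x
  have f': "f' k integrable_on S" for k
    by (rule integrable_spike[OF f N]) (simp add: f'_def)
  have le': "norm (f' k x) \<le> h x" if "x \<in> S" for k x
    using le[OF that, of k] by (auto simp: f'_def intro: order_trans[OF norm_ge_zero])
  have conv': "(\<lambda>k. f' k x) \<longlonglongrightarrow> g' x" if "x \<in> S" for x
    using conv[of x] that by (cases "x \<in> N") (auto simp: f'_def g'_def)
  have "g' integrable_on S" by (rule dominated_convergence(1)[OF f' h le' conv'])
  thus "g integrable_on S" by (rule integrable_spike[OF _ N]) (simp add: g'_def)
  have "integral S (f' k) = integral S (f k)" for k
    by (rule integral_spike[OF N]) (simp add: f'_def)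
  moreover have "integral S g' = integral S g" by (rule integral_spike[OF N]) (simp add: g'_def)
  ultimately show "(\<lambda>k. integral S (f k)) \<longlonglongrightarrow> integral S g"
    using dominated_convergence(2)[OF f' h le' conv'] by simp
qed

text \<open>This covers non-integrable functions too, since their integral is 0 by
  convention.\<close>

lemma integral_nonneg_real:
  fixes f :: "'a::euclidean_space \<Rightarrow> real"
  assumes "\<And>x. x \<in> S \<Longrightarrow> 0 \<le> f x"
  shows "0 \<le> integral S f"
  using assms by (cases "f integrable_on S") (auto simp: Henstock_Kurzweil_Integration.integral_nonneg not_integrable_integral)

lemma matrix_entry_le: "\<bar>(M::real^'n^'m) $ i $ j\<bar> \<le> norm M"
  by (meson Finite_Cartesian_Product.norm_nth_le component_le_norm_cart order_trans)

lemma norm_rows_le: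
  fixes M :: "real^'n^'m"
  assumes "\<And>i. norm (M $ i) \<le> L"
  shows "norm M \<le> real CARD('m) * L"
proof -
  have "norm M \<le> (\<Sum>i\<in>UNIV. norm (M $ i))" by (simp add: norm_vec_def L2_set_le_sum)
  also have "\<dots> \<le> (\<Sum>i\<in>(UNIV::'m set). L)" by (intro sum_mono assms)
  finally show ?thesis by simp
qed

lemma testfn_matrix_compact_support:
  fixes v :: "real^'n \<Rightarrow> real^'n" and G :: "real^'n \<Rightarrow> real^'n^'n"
  assumes "\<And>i. testfn_g \<Omega> (\<lambda>x. v x $ i) (\<lambda>x. G x $ i)"
  shows "continuous_on UNIV v" "continuous_on UNIV G"
    "\<exists>K. compact K \<and> K \<subseteq> \<Omega> \<and> (\<forall>x. x \<notin> K \<longrightarrow> v x = 0 \<and> G x = 0)"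
proof -
  note f = testfn_g_facts[OF assms]
  show "continuous_on UNIV v" using f(1) 
  proof -
    assume *: "\<And>i. continuous_on UNIV (\<lambda>x. v x $ i)"
    have "continuous_on UNIV (\<lambda>x. \<chi> i. v x $ i)" by (intro continuous_on_vec_lambda *)
    thus ?thesis by simp
  qed
  have "continuous_on UNIV (\<lambda>x. \<chi> i. G x $ i)" using f(2) by (intro continuous_on_vec_lambda) blast
  thus "continuous_on UNIV G" by simp
  obtain K where K: "\<And>i. compact (K i) \<and> K i \<subseteq> \<Omega> \<and> (\<forall>x. x \<notin> K i \<longrightarrow> v x $ i = 0 \<and> G x $ i = 0)"
    using f(3) by metis
  hence "compact (\<Union>i. K i)" "(\<Union>i. K i) \<subseteq> \<Omega>" by (auto intro: compact_UN)
  moreover have "v x = 0 \<and> G x = 0" if "x \<notin> (\<Union>i. K i)" for x using K that by (auto simp: vec_eq_iff)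
  ultimately show "\<exists>K. compact K \<and> K \<subseteq> \<Omega> \<and> (\<forall>x. x \<notin> K \<longrightarrow> v x = 0 \<and> G x = 0)" by blast
qed

text \<open>The gradient is carried along with the function so that its energy can be minimised. All
  conditions are stable under midpoints and weaken as \<open>\<delta>\<close> grows, and the row
  bound \<open>L\<close> keeps the energies bounded.\<close>

definition testfn_near :: "(real^'n) set \<Rightarrow> real \<Rightarrow> (real^'n \<Rightarrow> real^'n) \<Rightarrow> real
    \<Rightarrow> ((real^'n \<Rightarrow> real^'n) \<times> (real^'n \<Rightarrow> real^'n^'n)) set" where
  "testfn_near \<Omega> L w \<delta> = {(v, G). (\<forall>i. testfn_g \<Omega> (\<lambda>x. v x $ i) (\<lambda>x. G x $ i))
     \<and> (\<forall>i x. \<bar>v x $ i - w x $ i\<bar> \<le> \<delta>) \<and> (\<forall>i x. norm (G x $ i) \<le> L)}"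

lemma testfn_near_nonempty:
  assumes "open \<Omega>" "bounded \<Omega>" "L-lipschitz_on UNIV w" "\<And>x. x \<notin> \<Omega> \<Longrightarrow> w x = 0" "\<delta> > 0"
  shows "testfn_near \<Omega> L w \<delta> \<noteq> {}"
proof -
  have "\<exists>\<psi> g. testfn_g \<Omega> \<psi> g \<and> (\<forall>x. \<bar>\<psi> x - w x $ i\<bar> \<le> \<delta>) \<and> (\<forall>x. norm (g x) \<le> L)" for i
  proof -
    have L: "L-lipschitz_on UNIV (\<lambda>x. w x $ i)"
    proof (rule lipschitz_onI)
      fix x y
      have "\<bar>(w x - w y) $ i\<bar> \<le> norm (w x - w y)" by (rule component_le_norm_cart)
      also have "\<dots> \<le> L * dist x y" using lipschitz_onD[OF assms(3), of x y] by (simp add: dist_norm)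
      finally show "dist (w x $ i) (w y $ i) \<le> L * dist x y" by (simp add: dist_real_def)
    qed (rule lipschitz_on_nonneg[OF assms(3)])
    have z: "w x $ i = 0" if "x \<notin> \<Omega>" for x using assms(4)[OF that] by simp
    show ?thesis by (rule lipschitz_testfn_approx[OF assms(1,2) L z assms(5)]) blast+
  qed
  then obtain \<psi> g where *: "\<And>i. testfn_g \<Omega> (\<psi> i) (g i)" "\<And>i x. \<bar>\<psi> i x - w x $ i\<bar> \<le> \<delta>" "\<And>i x. norm (g i x) \<le> L"
    by metis
  have "((\<lambda>x. \<chi> i. \<psi> i x), (\<lambda>x. \<chi> i. g i x)) \<in> testfn_near \<Omega> L w \<delta>"
    using * by (simp add: testfn_near_def)
  thus ?thesis by blast
qed

lemma parallelogram:
  fixes a b :: "'a::real_inner"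
  shows "(norm (a - b))\<^sup>2 = 2 * (norm a)\<^sup>2 + 2 * (norm b)\<^sup>2 - 4 * (norm ((a + b) /\<^sub>R 2))\<^sup>2"
proof -
  have "4 * (norm ((a + b) /\<^sub>R 2))\<^sup>2 = (norm (a + b))\<^sup>2" by (simp add: power_mult_distrib power2_eq_square)
  moreover have "(norm (a - b))\<^sup>2 + (norm (a + b))\<^sup>2 = 2 * (norm a)\<^sup>2 + 2 * (norm b)\<^sup>2"
    unfolding power2_norm_eq_inner by (simp add: inner_diff_left inner_diff_right inner_add_left inner_add_right)
  ultimately show ?thesis by linarith
qed

lemma testfn_g_midpoint:
  fixes \<psi> v :: "real^'n \<Rightarrow> real"
  assumes "testfn_g \<Omega> \<psi> g" "testfn_g \<Omega> v gv"
  shows "testfn_g \<Omega> (\<lambda>x. (\<psi> x + v x) / 2) (\<lambda>x. (g x + gv x) /\<^sub>R 2)"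
proof -
  have d: "(\<psi> has_derivative (\<lambda>h. inner (g x) h)) (at x)" "(v has_derivative (\<lambda>h. inner (gv x) h)) (at x)" for x
    using assms by (auto simp: testfn_g_def)
  have c: "continuous_on UNIV g" "continuous_on UNIV gv"
    using assms by (auto simp: testfn_g_def)
  have "((\<lambda>x. (\<psi> x + v x) / 2) has_derivative (\<lambda>h. inner ((g x + gv x) /\<^sub>R 2) h)) (at x)" for x
  proof -
    have e: "inner ((g x + gv x) /\<^sub>R 2) h = (inner (g x) h + inner (gv x) h) / 2" for h
      by (simp add: inner_add_left)
    show ?thesis unfolding e
      by (rule bounded_linear.has_derivative[OF bounded_linear_divide has_derivative_add[OF d(1) d(2)]])
  qed
  moreover have cl: "closure {x. (\<psi> x + v x) / 2 \<noteq> 0} \<subseteq> closure {x. \<psi> x \<noteq> 0} \<union> closure {x. v x \<noteq> 0}"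
  proof -
    have "closure {x. (\<psi> x + v x) / 2 \<noteq> 0} \<subseteq> closure ({x. \<psi> x \<noteq> 0} \<union> {x. v x \<noteq> 0})"
      by (rule closure_mono, rule subsetI, rule ccontr) simp
    thus ?thesis unfolding closure_Un .
  qed
  have "compact (closure {x. \<psi> x \<noteq> 0})" "compact (closure {x. v x \<noteq> 0})"
    "closure {x. \<psi> x \<noteq> 0} \<subseteq> \<Omega>" "closure {x. v x \<noteq> 0} \<subseteq> \<Omega>"
    using assms by (simp_all add: testfn_g_def)
  hence k: "compact (closure {x. \<psi> x \<noteq> 0} \<union> closure {x. v x \<noteq> 0})"
    "closure {x. \<psi> x \<noteq> 0} \<union> closure {x. v x \<noteq> 0} \<subseteq> \<Omega>"
    by (simp_all add: compact_Un)
  note cl k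
  moreover have "compact (closure {x. (\<psi> x + v x) / 2 \<noteq> 0})"
    using compact_Int_closed[OF k(1) closed_closure[of "{x. (\<psi> x + v x) / 2 \<noteq> 0}"]] cl by (simp add: inf.absorb2)
  moreover have "continuous_on UNIV (\<lambda>x. (g x + gv x) /\<^sub>R 2)" by (intro continuous_intros c)
  ultimately show ?thesis unfolding testfn_g_def by blast
qed

lemma testfn_nearD:
  assumes "(v, G) \<in> testfn_near \<Omega> L w \<delta>"
  shows "testfn_g \<Omega> (\<lambda>x. v x $ i) (\<lambda>x. G x $ i)" "\<bar>v x $ i - w x $ i\<bar> \<le> \<delta>" "norm (G x $ i) \<le> L"
  using assms by (simp_all add: testfn_near_def)

lemma testfn_near_midpoint:
  assumes "(v, G) \<in> testfn_near \<Omega> L w \<delta>" "(v', G') \<in> testfn_near \<Omega> L w \<delta>"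
  shows "((\<lambda>x. (v x + v' x) /\<^sub>R 2), (\<lambda>x. (G x + G' x) /\<^sub>R 2)) \<in> testfn_near \<Omega> L w \<delta>"
proof -
  note D = testfn_nearD[OF assms(1)] and D' = testfn_nearD[OF assms(2)]
  have e: "((v x + v' x) /\<^sub>R 2) $ i = (v x $ i + v' x $ i) / 2" for x i by simp
  have e': "((G x + G' x) /\<^sub>R 2) $ i = (G x $ i + G' x $ i) /\<^sub>R 2" for x i by simp
  have 1: "testfn_g \<Omega> (\<lambda>x. ((v x + v' x) /\<^sub>R 2) $ i) (\<lambda>x. ((G x + G' x) /\<^sub>R 2) $ i)" for i
    unfolding e e' by (rule testfn_g_midpoint[OF D(1) D'(1)])
  have 2: "\<bar>((v x + v' x) /\<^sub>R 2) $ i - w x $ i\<bar> \<le> \<delta>" for i x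
    unfolding e using D(2)[of x i] D'(2)[of x i] by (simp add: abs_le_iff field_simps)
  have 3: "norm (((G x + G' x) /\<^sub>R 2) $ i) \<le> L" for i x
    unfolding e' using D(3)[of x i] D'(3)[of x i] norm_triangle_ineq[of "G x $ i" "G' x $ i"] by simp
  show ?thesis unfolding testfn_near_def using 1 2 3 by simp
qed

lemma testfn_near_integrable:
  assumes "(v, G) \<in> testfn_near \<Omega> L w \<delta>" "(v', G') \<in> testfn_near \<Omega> L w \<delta>'" "continuous_on UNIV f" "f 0 = (0::real)"
  shows "(\<lambda>x. f (a *\<^sub>R G x + b *\<^sub>R G' x)) absolutely_integrable_on \<Omega>"
proof -
  have t: "testfn_g \<Omega> (\<lambda>x. v x $ i) (\<lambda>x. G x $ i)" "testfn_g \<Omega> (\<lambda>x. v' x $ i) (\<lambda>x. G' x $ i)" for i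
    using testfn_nearD(1)[OF assms(1)] testfn_nearD(1)[OF assms(2)] by blast+
  note c = testfn_matrix_compact_support[of \<Omega> v G, OF t(1)]
  note c' = testfn_matrix_compact_support[of \<Omega> v' G', OF t(2)]
  obtain K where K: "compact K" "K \<subseteq> \<Omega>" "\<And>x. x \<notin> K \<Longrightarrow> G x = 0" using c(3) by blast
  obtain K' where K': "compact K'" "K' \<subseteq> \<Omega>" "\<And>x. x \<notin> K' \<Longrightarrow> G' x = 0" using c'(3) by blast
  show ?thesis
  proof (rule compact_support_integral(1)[of _ "K \<union> K'"])
    show "continuous_on UNIV (\<lambda>x. f (a *\<^sub>R G x + b *\<^sub>R G' x))"
      by (intro continuous_on_compose2[OF assms(3)] continuous_intros c(2) c'(2)) auto
  qed (use K K' assms(4) in auto)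
qed

text \<open>Gradients that almost minimise the Dirichlet energy over the nested convex sets
  \<open>testfn_near \<Omega> L w (1 / (k + 1))\<close> are Cauchy in \<open>L\<^sup>2\<close> by the parallelogram identity, so
  neither Rademacher's theorem nor the convergence of mollified gradients is needed.\<close>

lemma testfn_near_cauchy:
  fixes w :: "real^'n \<Rightarrow> real^'n"
  assumes \<Omega>: "open \<Omega>" "bounded \<Omega>" and L: "L-lipschitz_on UNIV w" and w0: "\<And>x. x \<notin> \<Omega> \<Longrightarrow> w x = 0"
  obtains v G where "\<And>k. (v k, G k) \<in> testfn_near \<Omega> L w (1 / real (Suc k))"
    "\<And>e. e > 0 \<Longrightarrow> \<exists>N. \<forall>i\<ge>N. \<forall>j\<ge>N. integral \<Omega> (\<lambda>x. (norm (G i x - G j x))\<^sup>2) < e"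
proof -
  define C where "C k = testfn_near \<Omega> L w (1 / real (Suc k))" for k
  define En where "En G = integral \<Omega> (\<lambda>x. (norm (G x))\<^sup>2)" for G :: "real^'n \<Rightarrow> real^'n^'n"
  define m where "m k = (INF p\<in>C k. En (snd p))" for k
  have anti: "C j \<subseteq> C k" if "k \<le> j" for k j
  proof -
    have "1 / real (Suc j) \<le> 1 / real (Suc k)" using that by (intro divide_left_mono) auto
    thus ?thesis unfolding C_def testfn_near_def by (auto intro: order_trans)
  qed
  have ne: "C k \<noteq> {}" for k unfolding C_def by (intro testfn_near_nonempty[OF \<Omega> L w0]) auto
  have cn: "continuous_on UNIV (\<lambda>M::real^'n^'n. (norm M)\<^sup>2)" by (intro continuous_intros)
  have int: "(\<lambda>x. (norm (a *\<^sub>R G x + b *\<^sub>R G' x))\<^sup>2) integrable_on \<Omega>"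
    if "(v, G) \<in> C k" "(v', G') \<in> C j" for v G v' G' k j a b
    using testfn_near_integrable[OF that[unfolded C_def] cn, of a b] by (simp add: absolutely_integrable_on_def)
  have int1: "(\<lambda>x. (norm (G x))\<^sup>2) integrable_on \<Omega>" if "(v, G) \<in> C k" for v G k
    using int[OF that that, of 1 0] by simp
  have En0: "0 \<le> En G" for G unfolding En_def by (rule integral_nonneg_real) simp
  have \<Omega>m: "\<Omega> \<in> lmeasurable" by (rule lmeasurable_open[OF \<Omega>(2,1)])
  have bdd: "bdd_below ((\<lambda>p. En (snd p)) ` C k)" for k using En0 by (intro bdd_belowI[of _ 0]) auto
  have mle: "m k \<le> En G" if "(v, G) \<in> C k" for k v G
    unfolding m_def using cINF_lower[OF bdd that] by simp
  define M where "M = integral \<Omega> (\<lambda>x. (real CARD('n) * L)\<^sup>2)"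
  have mM: "m k \<le> M" for k
  proof -
    obtain v G where vG: "(v, G) \<in> C k" using ne[of k] by auto
    have "En G \<le> M" unfolding En_def M_def
    proof (rule integral_le[OF int1[OF vG]])
      show "(\<lambda>x. (real CARD('n) * L)\<^sup>2) integrable_on \<Omega>" by (rule integrable_on_const[OF \<Omega>m])
      fix x
      have "norm (G x) \<le> real CARD('n) * L" by (rule norm_rows_le[OF testfn_nearD(3)[OF vG[unfolded C_def]]])
      thus "(norm (G x))\<^sup>2 \<le> (real CARD('n) * L)\<^sup>2" by (intro power_mono) auto
    qed
    with mle[OF vG] show ?thesis by linarith
  qed
  \<comment> \<open>The sets \<open>C k\<close> shrink, so their infima increase; the uniform
    gradient bound keeps them below \<open>M\<close>, and therefore they converge.\<close>
  have m_mono: "incseq m"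
    unfolding incseq_def m_def
  proof (intro allI impI)
    fix i j :: nat assume "i \<le> j"
    show "(INF p\<in>C i. En (snd p)) \<le> (INF p\<in>C j. En (snd p))"
      by (rule cINF_superset_mono[OF ne bdd anti[OF \<open>i \<le> j\<close>]]) simp
  qed
  obtain l where l: "m \<longlonglongrightarrow> l" by (rule incseq_convergent[OF m_mono, of M]) (use mM in auto)
  have "\<exists>p. p \<in> C k \<and> En (snd p) < m k + 1 / real (Suc k)" for k
  proof -
    have "(INF p\<in>C k. En (snd p)) < m k + 1 / real (Suc k)" by (simp add: m_def)
    thus ?thesis using cINF_less_iff[OF ne bdd] by blast
  qed
  then obtain p where p: "\<And>k. p k \<in> C k" "\<And>k. En (snd (p k)) < m k + 1 / real (Suc k)" by metis
  define v where "v k = fst (p k)" for k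
  define G where "G k = snd (p k)" for k
  have vG: "(v k, G k) \<in> C k" and EnG: "En (G k) < m k + 1 / real (Suc k)" for k
    using p[of k] by (simp_all add: v_def G_def)
  \<comment> \<open>Both pairs lie in \<open>C i\<close>, hence so does their midpoint, whose energy
    is at least \<open>m i\<close>. Near-minimality then bounds the parallelogram expression by
    \<open>2 * (m i + 1/(i+1)) + 2 * (m j + 1/(j+1)) - 4 * m i\<close>.\<close>
  have key: "integral \<Omega> (\<lambda>x. (norm (G i x - G j x))\<^sup>2) \<le> 2 * (m j - m i) + 4 * (1 / real (Suc i))" if ij: "i \<le> j" for i j
  proof -
    have j: "(v j, G j) \<in> C i" using vG[of j] anti[OF ij] by blast
    note I = int[OF vG[of i] j]
    have "((\<lambda>x. (v i x + v j x) /\<^sub>R 2), (\<lambda>x. (G i x + G j x) /\<^sub>R 2)) \<in> C i"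
      unfolding C_def by (rule testfn_near_midpoint[OF vG[unfolded C_def] j[unfolded C_def]])
    hence mid: "m i \<le> integral \<Omega> (\<lambda>x. (norm ((G i x + G j x) /\<^sub>R 2))\<^sup>2)" using mle unfolding En_def by blast
    have para: "(norm (G i x - G j x))\<^sup>2 = 2 * (norm (G i x))\<^sup>2 + 2 * (norm (G j x))\<^sup>2 - 4 * (norm ((G i x + G j x) /\<^sub>R 2))\<^sup>2" for x
      by (rule parallelogram)
    have imid: "(\<lambda>x. (norm ((G i x + G j x) /\<^sub>R 2))\<^sup>2) integrable_on \<Omega>"
    proof -
      have e: "(G i x + G j x) /\<^sub>R 2 = (1 / 2) *\<^sub>R G i x + (1 / 2) *\<^sub>R G j x" for x
        by (simp add: scaleR_right_distrib inverse_eq_divide)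
      show ?thesis unfolding e by (rule I)
    qed
    have "integral \<Omega> (\<lambda>x. (norm (G i x - G j x))\<^sup>2) = 2 * En (G i) + 2 * En (G j) - 4 * integral \<Omega> (\<lambda>x. (norm ((G i x + G j x) /\<^sub>R 2))\<^sup>2)"
      unfolding para En_def
      by (simp only: integral_mult_right
          Henstock_Kurzweil_Integration.integral_diff[OF Henstock_Kurzweil_Integration.integrable_add[OF integrable_on_mult_right[OF int1[OF vG[of i]], of 2] integrable_on_mult_right[OF int1[OF vG[of j]], of 2]] integrable_on_mult_right[OF imid, of 4]]
          Henstock_Kurzweil_Integration.integral_add[OF integrable_on_mult_right[OF int1[OF vG[of i]], of 2] integrable_on_mult_right[OF int1[OF vG[of j]], of 2]])
    moreover have "1 / real (Suc j) \<le> 1 / real (Suc i)" using ij by (intro divide_left_mono) auto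
    moreover have "X \<le> 2 * (mj - mi) + 4 * ri"
      if "X = 2 * A + 2 * B - 4 * Z" "rj \<le> ri" "mi \<le> Z" "A < mi + ri" "B < mj + rj"
      for X A B Z ri rj mi mj :: real using that by simp
    ultimately show ?thesis using mid EnG[of i] EnG[of j] by blast
  qed
  show ?thesis
  proof (rule that)
    show "(v k, G k) \<in> testfn_near \<Omega> L w (1 / real (Suc k))" for k using vG by (simp add: C_def)
    fix e :: real assume e: "e > 0"
    \<comment> \<open>The tolerance \<open>e / 8\<close> gives \<open>m j - m i < e / 4\<close>, and
      \<open>2 * (e / 4) + 4 * (e / 8) = e\<close>.\<close>
    have "eventually (\<lambda>k. dist (m k) l < e / 8) sequentially" using l e by (intro tendstoD) auto
    moreover have "(\<lambda>k. 1 / real (Suc k)) \<longlonglongrightarrow> 0" using LIMSEQ_inverse_real_of_nat by (simp add: inverse_eq_divide)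
    hence "eventually (\<lambda>k. dist (1 / real (Suc k)) 0 < e / 8) sequentially" using e by (intro tendstoD) auto
    ultimately have "eventually (\<lambda>k. dist (m k) l < e / 8 \<and> dist (1 / real (Suc k)) 0 < e / 8) sequentially"
      by (rule eventually_conj)
    then obtain N where N: "\<And>k. k \<ge> N \<Longrightarrow> \<bar>m k - l\<bar> < e / 8 \<and> 1 / real (Suc k) < e / 8"
      unfolding eventually_sequentially dist_real_def by auto
    have main: "integral \<Omega> (\<lambda>x. (norm (G i x - G j x))\<^sup>2) < e" if "N \<le> i" "i \<le> j" for i j
    proof -
      have "N \<le> j" using that by simp
      have "l - e / 8 < m i" "m j < l + e / 8" "1 / real (Suc i) < e / 8"
        using N[OF that(1)] N[OF \<open>N \<le> j\<close>] unfolding abs_diff_less_iff by blast+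
      moreover have "X < e" if "l - e / 8 < mi" "mj < l + e / 8" "ri < e / 8" "X \<le> 2 * (mj - mi) + 4 * ri"
        for X mi mj ri :: real using that by argo
      ultimately show ?thesis using key[OF that(2)] by blast
    qed
    show "\<exists>N. \<forall>i\<ge>N. \<forall>j\<ge>N. integral \<Omega> (\<lambda>x. (norm (G i x - G j x))\<^sup>2) < e"
    proof (intro exI[of _ N] allI impI)
      fix i j assume "N \<le> i" "N \<le> j"
      thus "integral \<Omega> (\<lambda>x. (norm (G i x - G j x))\<^sup>2) < e"
        using main[of i j] main[of j i] by (cases "i \<le> j") (auto simp: norm_minus_commute)
    qed
  qed
qed


text \<open>On a set of finite measure a Cauchy sequence in L2 is Cauchy in L1, and a subsequence is
  then Cauchy almost everywhere. Its limit \<open>G0\<close> keeps the uniform bound, which is what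
  later limit passages by dominated convergence rely on.\<close>

lemma lipschitz_gradient_approximation:
  fixes w :: "real^'n \<Rightarrow> real^'n"
  assumes \<Omega>: "open \<Omega>" "bounded \<Omega>" and L: "L-lipschitz_on UNIV w" and w0: "\<And>x. x \<notin> \<Omega> \<Longrightarrow> w x = 0"
  obtains v G B G0 N where "\<And>k i. testfn_g \<Omega> (\<lambda>x. v k x $ i) (\<lambda>x. G k x $ i)"
    "\<And>k x i. \<bar>v k x $ i - w x $ i\<bar> \<le> 1 / real (Suc k)"
    "\<And>k x. norm (G k x) \<le> B" "G0 \<in> borel_measurable (lebesgue_on \<Omega>)" "\<And>x. x \<in> \<Omega> \<Longrightarrow> norm (G0 x) \<le> B"
    "negligible N" "\<And>x. x \<in> \<Omega> - N \<Longrightarrow> (\<lambda>k. G k x) \<longlonglongrightarrow> G0 x"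
proof -
  obtain v G where vG: "\<And>k. (v k, G k) \<in> testfn_near \<Omega> L w (1 / real (Suc k))"
    and ca: "\<And>e. e > 0 \<Longrightarrow> \<exists>N. \<forall>i\<ge>N. \<forall>j\<ge>N. integral \<Omega> (\<lambda>x. (norm (G i x - G j x))\<^sup>2) < e"
    using testfn_near_cauchy[OF \<Omega> L w0] by blast
  define B where "B = real CARD('n) * L"
  have GB: "norm (G k x) \<le> B" for k x
    unfolding B_def by (rule norm_rows_le[OF testfn_nearD(3)[OF vG]])
  have \<Omega>m: "\<Omega> \<in> lmeasurable" by (rule lmeasurable_open[OF \<Omega>(2,1)])
  hence \<Omega>s: "\<Omega> \<in> sets lebesgue" by (rule fmeasurableD)
  define M where "M = lebesgue_on \<Omega>"
  note fv = testfn_matrix_compact_support[OF testfn_nearD(1)[OF vG]]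
  obtain K where K: "compact (K k)" "K k \<subseteq> \<Omega>" "\<And>x. x \<notin> K k \<Longrightarrow> G k x = 0" for k
    using fv(3) by metis
  have Gabs: "G k absolutely_integrable_on \<Omega>" for k
    by (rule compact_support_integral(1)[OF fv(2) K(1) K(3) K(2)])
  have Gint: "integrable M (G k)" for k
    unfolding M_def by (rule absolutely_integrable_imp_integrable[OF Gabs \<Omega>s])
  define c where "c = measure lebesgue \<Omega> + 1"
  have c: "c > 0" by (simp add: c_def add_nonneg_pos)
  have cauchy: "\<exists>N. \<forall>i\<ge>N. \<forall>j\<ge>N. (LINT x|M. norm (G i x - G j x)) < e" if e: "e > 0" for e
  proof -
    \<comment> \<open>\<open>t \<le> d + t^2 / d\<close> trades squares for first powers: the
      constant contributes at most \<open>d * c = e / 2\<close>, the squares less than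
      \<open>(d * e / 2) / d = e / 2\<close>. The 1 in \<open>c\<close> keeps it positive.\<close>
    define d where "d = e / (2 * c)"
    have d: "d > 0" using e c by (simp add: d_def)
    have "d * e / 2 > 0" using d e by simp
    then obtain N where N: "\<And>i j. i \<ge> N \<Longrightarrow> j \<ge> N \<Longrightarrow> integral \<Omega> (\<lambda>x. (norm (G i x - G j x))\<^sup>2) < d * e / 2"
      using ca by meson
    have "(LINT x|M. norm (G i x - G j x)) < e" if ij: "i \<ge> N" "j \<ge> N" for i j
    proof -
      have cn: "continuous_on UNIV (\<lambda>M::real^'n^'n. (norm M)\<^sup>2)" by (intro continuous_intros)
      have i2: "(\<lambda>x. (norm (G i x - G j x))\<^sup>2) integrable_on \<Omega>"
        using testfn_near_integrable[OF vG[of i] vG[of j] cn, of 1 "-1"] by (simp add: absolutely_integrable_on_def)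
      have i1: "integrable M (\<lambda>x. norm (G i x - G j x))" using Gint by auto
      have "(LINT x|M. norm (G i x - G j x)) = integral \<Omega> (\<lambda>x. norm (G i x - G j x))"
        using lebesgue_integral_eq_integral[OF i1[unfolded M_def] \<Omega>s] by (simp add: M_def)
      also have "\<dots> \<le> integral \<Omega> (\<lambda>x. d + (norm (G i x - G j x))\<^sup>2 / d)"
      proof (rule integral_le)
        show "(\<lambda>x. norm (G i x - G j x)) integrable_on \<Omega>"
          by (rule integrable_on_lebesgue_on[OF i1[unfolded M_def] \<Omega>s])
        show "(\<lambda>x. d + (norm (G i x - G j x))\<^sup>2 / d) integrable_on \<Omega>"
          by (intro Henstock_Kurzweil_Integration.integrable_add integrable_on_const[OF \<Omega>m] integrable_on_divide i2)
        fix x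
        have "t \<le> d + t\<^sup>2 / d" if "t \<ge> 0" for t
        proof (cases "t \<le> d")
          case False
          hence "t * d \<le> t\<^sup>2" using that by (simp add: power2_eq_square mult_left_mono)
          hence "t \<le> t\<^sup>2 / d" using d by (simp add: field_simps)
          thus ?thesis using d by simp
        qed (use d in \<open>simp add: add_increasing2\<close>)
        thus "norm (G i x - G j x) \<le> d + (norm (G i x - G j x))\<^sup>2 / d" by simp
      qed
      also have "\<dots> = d * measure lebesgue \<Omega> + integral \<Omega> (\<lambda>x. (norm (G i x - G j x))\<^sup>2) / d"
        using lmeasure_integral[OF \<Omega>m] integral_mult_right[of \<Omega> d "\<lambda>_. 1"]
        by (simp add: Henstock_Kurzweil_Integration.integral_add[OF integrable_on_const[OF \<Omega>m] integrable_on_divide[OF i2]])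
      also have "\<dots> < e"
      proof -
        have "d * measure lebesgue \<Omega> \<le> d * c" using d by (intro mult_left_mono) (auto simp: c_def)
        also have "\<dots> = e / 2" using c by (simp add: d_def)
        finally have 1: "d * measure lebesgue \<Omega> \<le> e / 2" .
        have 2: "integral \<Omega> (\<lambda>x. (norm (G i x - G j x))\<^sup>2) / d < e / 2"
          using N[OF ij] d by (simp add: field_simps)
        show ?thesis using 1 2 by argo
      qed
      finally show ?thesis .
    qed
    thus ?thesis by blast
  qed
  obtain r where r: "strict_mono r" and ae: "AE x in M. Cauchy (\<lambda>i. G (r i) x)"
    by (rule cauchy_L1_AE_cauchy_subseq[OF Gint cauchy])
  obtain N where N: "N \<in> null_sets M" "\<And>x. x \<in> \<Omega> - N \<Longrightarrow> Cauchy (\<lambda>i. G (r i) x)"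
    using ae by (elim AE_E) (auto simp: M_def space_restrict_space null_sets_def)
  have Nn: "negligible N"
    using N(1) \<Omega>s by (simp add: M_def null_sets_restrict_space negligible_iff_null_sets)
  \<comment> \<open>With value 0 on \<open>N\<close> the sequence converges at every point of
    \<open>\<Omega>\<close>, so the bound on the limit holds everywhere there and not only almost
    everywhere.\<close>
  define H where "H k x = (if x \<in> N then 0 else G (r k) x)" for k x
  define G0 where "G0 x = lim (\<lambda>k. H k x)" for x
  have Hlim: "(\<lambda>k. H k x) \<longlonglongrightarrow> G0 x" if "x \<in> \<Omega>" for x
  proof -
    have "convergent (\<lambda>k. H k x)"
      using N(2)[of x] that by (cases "x \<in> N") (auto simp: H_def convergent_const Cauchy_convergent)
    thus ?thesis by (simp add: G0_def convergent_LIMSEQ_iff)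
  qed
  show ?thesis
  proof (rule that[of "\<lambda>k. v (r k)" "\<lambda>k. G (r k)" B G0 N])
    show "testfn_g \<Omega> (\<lambda>x. v (r k) x $ i) (\<lambda>x. G (r k) x $ i)" for k i by (rule testfn_nearD(1)[OF vG])
    show "\<bar>v (r k) x $ i - w x $ i\<bar> \<le> 1 / real (Suc k)" for k x i
    proof -
      have "1 / real (Suc (r k)) \<le> 1 / real (Suc k)" using seq_suble[OF r, of k] by (intro divide_left_mono) auto
      thus ?thesis using testfn_nearD(2)[OF vG[of "r k"], of x i] by simp
    qed
    show "norm (G (r k) x) \<le> B" for k x by (rule GB)
    show "G0 \<in> borel_measurable (lebesgue_on \<Omega>)"
    proof -
      have "H k \<in> borel_measurable M" for k
      proof -
        have [measurable]: "G (r k) \<in> borel_measurable M" "N \<in> sets M" using Gint N by auto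
        show ?thesis unfolding H_def by measurable
      qed
      thus ?thesis unfolding G0_def M_def by (rule borel_measurable_lim_metric)
    qed
    show "norm (G0 x) \<le> B" if "x \<in> \<Omega>" for x
    proof (rule tendsto_upperbound[OF tendsto_norm[OF Hlim[OF that]]])
      have "0 \<le> B" using order_trans[OF norm_ge_zero GB] .
      thus "\<forall>\<^sub>F k in sequentially. norm (H k x) \<le> B" using GB by (simp add: H_def)
    qed simp
    show "negligible N" by (rule Nn)
    show "(\<lambda>k. G (r k) x) \<longlonglongrightarrow> G0 x" if "x \<in> \<Omega> - N" for x
      using Hlim[of x] that by (simp add: H_def)
  qed
qed

section \<open>Lipschitz functions in the Orlicz-Sobolev space\<close>

text \<open>\<open>N_function\<close> constrains only nonnegative arguments; composing with
  \<open>max 0\<close> gives a function on the whole line that can be composed with measurable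
  functions and limits.\<close>

lemma N_function_continuous:
  assumes "N_function \<phi>"
  shows "continuous_on UNIV (\<lambda>t. \<phi> (max 0 t))"
proof (rule continuous_on_compose2[of "{0..}" \<phi>])
  show "continuous_on {0..} \<phi>" using assms by (simp add: N_function_def)
qed (auto intro!: continuous_intros)

lemma N_function_mono: "N_function \<phi> \<Longrightarrow> 0 \<le> s \<Longrightarrow> s \<le> t \<Longrightarrow> \<phi> s \<le> \<phi> t"
  unfolding N_function_def strict_mono_on_def by (cases "s = t") (auto intro: less_imp_le)

lemma N_function_nonneg: "N_function \<phi> \<Longrightarrow> 0 \<le> t \<Longrightarrow> 0 \<le> \<phi> t"
  using N_function_mono[of \<phi> 0 t] by (simp add: N_function_def)

lemma N_function_measurable:
  fixes f :: "real^'n \<Rightarrow> 'b::euclidean_space"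
  assumes "N_function \<phi>" "f \<in> borel_measurable (lebesgue_on \<Omega>)"
    and that: "s > 0"
  shows "(\<lambda>x. \<phi> (norm (f x) / s)) \<in> borel_measurable (lebesgue_on \<Omega>)"
proof -
  have [measurable]: "(\<lambda>t. \<phi> (max 0 t)) \<in> borel_measurable borel"
    by (rule borel_measurable_continuous_onI[OF N_function_continuous[OF assms(1)]])
  note [measurable] = assms(2)
  have "(\<lambda>x. \<phi> (max 0 (norm (f x) / s))) \<in> borel_measurable (lebesgue_on \<Omega>)" by measurable
  moreover have "max 0 (norm (f x) / s) = norm (f x) / s" for x using that by simp
  ultimately show ?thesis by simp
qed

lemma bounded_orlicz_integrable:
  fixes f :: "real^'n \<Rightarrow> 'b::euclidean_space"
  assumes "N_function \<phi>" "\<Omega> \<in> lmeasurable" "f \<in> borel_measurable (lebesgue_on \<Omega>)"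
    "\<And>x. x \<in> \<Omega> \<Longrightarrow> norm (f x) \<le> B" and s: "s > 0"
  shows "(\<lambda>x. \<phi> (norm (f x) / s)) integrable_on \<Omega>"
proof (rule measurable_bounded_by_integrable_imp_integrable[OF N_function_measurable[OF assms(1,3) s] integrable_on_const[OF assms(2)]])
  show "norm (\<phi> (norm (f x) / s)) \<le> \<phi> (B / s)" if "x \<in> \<Omega>" for x
  proof -
    have "norm (f x) / s \<le> B / s" using assms(4)[OF that] s by (intro divide_right_mono) auto
    moreover have "0 \<le> norm (f x) / s" using s by simp
    ultimately show ?thesis using N_function_mono[OF assms(1)] N_function_nonneg[OF assms(1)] by simp
  qed
  show "\<Omega> \<in> sets lebesgue" by (rule fmeasurableD[OF assms(2)])
qed

lemma bounded_in_orlicz: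
  fixes f :: "real^'n \<Rightarrow> 'b::euclidean_space"
  assumes "N_function \<phi>" "\<Omega> \<in> lmeasurable" "f \<in> borel_measurable (lebesgue_on \<Omega>)"
    "\<And>x. x \<in> \<Omega> \<Longrightarrow> norm (f x) \<le> B"
  shows "in_orlicz \<phi> \<Omega> f"
  unfolding in_orlicz_def
proof (intro conjI exI[of _ 1])
  show "(\<lambda>x. \<phi> (norm (f x) / 1)) integrable_on \<Omega>"
    by (rule bounded_orlicz_integrable[OF assms zero_less_one])
  show "f \<in> borel_measurable (lebesgue_on \<Omega>)" by (rule assms(3))
  show "(0::real) < 1" by simp
qed

lemma lux_cong:
  assumes "negligible {x \<in> \<Omega>. f x \<noteq> g x}"
  shows "lux \<phi> \<Omega> f = lux \<phi> \<Omega> g"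
proof -
  have "(\<lambda>x. \<phi> (norm (f x) / s)) integrable_on \<Omega> \<longleftrightarrow> (\<lambda>x. \<phi> (norm (g x) / s)) integrable_on \<Omega>" for s
    by (auto intro: integrable_spike[OF _ assms])
  moreover have "integral \<Omega> (\<lambda>x. \<phi> (norm (f x) / s)) = integral \<Omega> (\<lambda>x. \<phi> (norm (g x) / s))" for s
    by (rule integral_spike[OF assms]) auto
  ultimately show ?thesis unfolding lux_def by simp
qed

text \<open>At every scale \<open>e\<close> the modulars tend to 0 by dominated convergence, so
  eventually \<open>e\<close> belongs to the set whose infimum is \<open>lux\<close>. This also
  shows that the set is nonempty, without which its infimum would carry no information.\<close>

lemma lux_tendsto_0:
  fixes f :: "nat \<Rightarrow> real^'n \<Rightarrow> 'b::euclidean_space"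
  assumes \<phi>: "N_function \<phi>" and \<Omega>: "\<Omega> \<in> lmeasurable"
    and f: "\<And>k. f k \<in> borel_measurable (lebesgue_on \<Omega>)" "\<And>k x. x \<in> \<Omega> \<Longrightarrow> norm (f k x) \<le> B"
    and N: "negligible N" "\<And>x. x \<in> \<Omega> - N \<Longrightarrow> (\<lambda>k. f k x) \<longlonglongrightarrow> 0"
  shows "(\<lambda>k. lux \<phi> \<Omega> (f k)) \<longlonglongrightarrow> 0"
proof -
  have ev: "eventually (\<lambda>k. e \<in> {s. s > 0 \<and> (\<lambda>x. \<phi> (norm (f k x) / s)) integrable_on \<Omega>
                        \<and> integral \<Omega> (\<lambda>x. \<phi> (norm (f k x) / s)) \<le> 1}) sequentially" if e: "e > 0" for e
  proof -
    have int: "(\<lambda>x. \<phi> (norm (f k x) / e)) integrable_on \<Omega>" for k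
      by (rule bounded_orlicz_integrable[OF \<phi> \<Omega> f e])
    have "(\<lambda>k. integral \<Omega> (\<lambda>x. \<phi> (norm (f k x) / e))) \<longlonglongrightarrow> integral \<Omega> (\<lambda>x. \<phi> 0)"
    proof (rule dominated_convergence_ae(2)[OF int integrable_on_const[OF \<Omega>] N(1)])
      fix k x assume "x \<in> \<Omega>"
      hence "norm (f k x) / e \<le> B / e" using f(2) e by (intro divide_right_mono) auto
      moreover have "0 \<le> norm (f k x) / e" using e by simp
      ultimately show "norm (\<phi> (norm (f k x) / e)) \<le> \<phi> (B / e)"
        using N_function_mono[OF \<phi>] N_function_nonneg[OF \<phi>] by simp
    next
      fix x assume "x \<in> \<Omega> - N"
      hence "(\<lambda>k. norm (f k x) / e) \<longlonglongrightarrow> norm (0::'b) / e"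
        by (intro tendsto_divide tendsto_norm N(2)) (use e in auto)
      hence "(\<lambda>k. norm (f k x) / e) \<longlonglongrightarrow> 0" by simp
      from continuous_on_tendsto_compose[OF N_function_continuous[OF \<phi>] this]
      show "(\<lambda>k. \<phi> (norm (f k x) / e)) \<longlonglongrightarrow> \<phi> 0" using e by (simp add: max_absorb2)
    qed
    moreover have "\<phi> 0 = 0" using \<phi> by (simp add: N_function_def)
    ultimately have "(\<lambda>k. integral \<Omega> (\<lambda>x. \<phi> (norm (f k x) / e))) \<longlonglongrightarrow> 0" by simp
    hence "eventually (\<lambda>k. integral \<Omega> (\<lambda>x. \<phi> (norm (f k x) / e)) < 1) sequentially"
      by (rule order_tendstoD) simp
    thus ?thesis by eventually_elim (use int e in auto)
  qed
  show ?thesis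
  proof (rule tendstoI)
    fix e :: real assume e: "e > 0"
    have "e / 2 > 0" using e by simp
    from ev[OF this] show "eventually (\<lambda>k. dist (lux \<phi> \<Omega> (f k)) 0 < e) sequentially"
    proof eventually_elim
      case (elim k)
      define S where "S = {s. s > 0 \<and> (\<lambda>x. \<phi> (norm (f k x) / s)) integrable_on \<Omega>
                        \<and> integral \<Omega> (\<lambda>x. \<phi> (norm (f k x) / s)) \<le> 1}"
      have S: "e / 2 \<in> S" using elim unfolding S_def .
      have "bdd_below S" by (rule bdd_belowI[of _ 0]) (auto simp: S_def)
      hence "Inf S \<le> e / 2" by (rule cInf_lower[OF S])
      moreover have "0 \<le> Inf S" using S by (intro cInf_greatest) (blast, simp add: S_def)
      ultimately show ?case using e unfolding lux_def S_def[symmetric] by simp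
    qed
  qed
qed

lemma trace_abs_le: "\<bar>trace (M::real^'n^'n)\<bar> \<le> real CARD('n) * norm M"
proof -
  have "\<bar>trace M\<bar> \<le> (\<Sum>i\<in>UNIV. \<bar>M $ i $ i\<bar>)" unfolding trace_def by (rule sum_abs)
  also have "\<dots> \<le> (\<Sum>i\<in>(UNIV::'n set). norm M)" by (intro sum_mono matrix_entry_le)
  finally show ?thesis by simp
qed

lemma continuous_on_trace: "continuous_on S (\<lambda>M::real^'n^'n. trace M)"
  unfolding trace_def by (rule continuous_on_sum) (intro continuous_on_component continuous_on_id)

lemma loc_int_bounded:
  fixes h :: "real^'n \<Rightarrow> real"
  assumes "\<Omega> \<in> sets lebesgue" "h \<in> borel_measurable (lebesgue_on \<Omega>)" "\<And>x. x \<in> \<Omega> \<Longrightarrow> \<bar>h x\<bar> \<le> B"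
  shows "loc_int \<Omega> h"
  unfolding loc_int_def
proof (intro allI impI)
  fix K assume K: "compact K \<and> K \<subseteq> \<Omega>"
  hence Km: "K \<in> lmeasurable" by (simp add: lmeasurable_compact)
  show "h absolutely_integrable_on K"
  proof (rule measurable_bounded_by_integrable_imp_absolutely_integrable)
    show "h \<in> borel_measurable (lebesgue_on K)"
      by (rule measurable_restrict_mono[OF assms(2)]) (use K in simp)
    show "(\<lambda>x. B) integrable_on K" by (rule integrable_on_const[OF Km])
    show "K \<in> sets lebesgue" by (rule fmeasurableD[OF Km])
    show "norm (h x) \<le> B" if "x \<in> K" for x using assms(3)[of x] K that by auto
  qed
qed

text \<open>The approximating test functions pass to the limit in three places: in the integration
  by parts, which identifies \<open>G\<close> as weak gradient of \<open>w\<close>; in the two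
  Luxemburg norms of \<open>W0\<close>; and in the integral of the trace, which is 0 for each test
  function. The last limit is the divergence theorem needed for the discrete solution.\<close>

lemma lipschitz_W0:
  fixes w :: "real^'n \<Rightarrow> real^'n"
  assumes \<phi>: "N_function \<phi>" and \<Omega>: "open \<Omega>" "bounded \<Omega>"
    and L: "L-lipschitz_on UNIV w" and w0: "\<And>x. x \<notin> \<Omega> \<Longrightarrow> w x = 0"
  shows "W0 \<phi> \<Omega> w"
    and "\<exists>G B. G \<in> borel_measurable (lebesgue_on \<Omega>) \<and> (\<forall>x\<in>\<Omega>. norm (G x) \<le> B)
      \<and> negligible {x \<in> \<Omega>. wgrad \<Omega> w x \<noteq> G x} \<and> integral \<Omega> (\<lambda>x. trace (G x)) = 0"
proof -
  have \<Omega>m: "\<Omega> \<in> lmeasurable" by (rule lmeasurable_open[OF \<Omega>(2,1)])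
  hence \<Omega>s: "\<Omega> \<in> sets lebesgue" by (rule fmeasurableD)
  obtain v Gs B G N where v: "\<And>k i. testfn_g \<Omega> (\<lambda>x. v k x $ i) (\<lambda>x. Gs k x $ i)"
    "\<And>k x i. \<bar>v k x $ i - w x $ i\<bar> \<le> 1 / real (Suc k)"
    and GsB: "\<And>k x. norm (Gs k x) \<le> B" and Gm: "G \<in> borel_measurable (lebesgue_on \<Omega>)"
    and GB: "\<And>x. x \<in> \<Omega> \<Longrightarrow> norm (G x) \<le> B"
    and N: "negligible N" and lim: "\<And>x. x \<in> \<Omega> - N \<Longrightarrow> (\<lambda>k. Gs k x) \<longlonglongrightarrow> G x"
    by (rule lipschitz_gradient_approximation[OF \<Omega> L w0]) (assumption, rule that)
  note fv = testfn_matrix_compact_support[OF v(1)]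
  have wc: "continuous_on UNIV w" by (rule lipschitz_on_continuous_on[OF L])
  have cm: "f \<in> borel_measurable (lebesgue_on \<Omega>)" if "continuous_on UNIV f" for f :: "real^'n \<Rightarrow> 'c::euclidean_space"
    by (rule continuous_imp_measurable_on_sets_lebesgue[OF continuous_on_subset[OF that] \<Omega>s]) simp
  have wm: "w \<in> borel_measurable (lebesgue_on \<Omega>)" and vm: "v k \<in> borel_measurable (lebesgue_on \<Omega>)"
    and Gsm: "Gs k \<in> borel_measurable (lebesgue_on \<Omega>)" for k
    using cm[OF wc] cm[OF fv(1)] cm[OF fv(2)] by blast+
  have "bounded (w ` closure \<Omega>)"
    using compact_closure[of \<Omega>] \<Omega>(2) by (intro compact_imp_bounded compact_continuous_image continuous_on_subset[OF wc]) auto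
  then obtain Bw where Bw: "\<And>x. x \<in> \<Omega> \<Longrightarrow> norm (w x) \<le> Bw"
    unfolding bounded_iff using closure_subset by (metis imageI subsetD)
  have wlim: "(\<lambda>k. v k x $ i) \<longlonglongrightarrow> w x $ i" for x i
  proof -
    have "(\<lambda>k. v k x $ i - w x $ i) \<longlonglongrightarrow> 0"
    proof (rule Lim_null_comparison)
      show "\<forall>\<^sub>F k in sequentially. norm (v k x $ i - w x $ i) \<le> 1 / real (Suc k)" using v(2) by simp
      show "(\<lambda>k. 1 / real (Suc k)) \<longlonglongrightarrow> 0" using LIMSEQ_inverse_real_of_nat by (simp add: inverse_eq_divide)
    qed
    thus ?thesis by (simp add: LIM_zero_iff)
  qed
  have ent: "(\<lambda>x. G x $ i $ j) \<in> borel_measurable (lebesgue_on \<Omega>)" for i j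
    by (rule borel_measurable_continuous_on[OF _ Gm, of "\<lambda>M. M $ i $ j"]) (intro continuous_intros)
  have wgG: "weak_grad \<Omega> w G"
    unfolding weak_grad_def
  proof (intro conjI allI impI)
    fix i j
    show "loc_int \<Omega> (\<lambda>x. w x $ i)"
    proof (rule loc_int_bounded[OF \<Omega>s])
      show "(\<lambda>x. w x $ i) \<in> borel_measurable (lebesgue_on \<Omega>)" by (intro cm continuous_intros wc)
      show "\<bar>w x $ i\<bar> \<le> Bw" if "x \<in> \<Omega>" for x
        using Bw[OF that] component_le_norm_cart[of "w x" i] by linarith
    qed
    show "loc_int \<Omega> (\<lambda>x. G x $ i $ j)"
      by (rule loc_int_bounded[OF \<Omega>s ent, where B = B]) (use GB matrix_entry_le order_trans in blast)
  next
    fix \<psi> g i j assume t: "testfn_g \<Omega> \<psi> g"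
    obtain Bt where Bt: "Bt > 0" "\<And>x. \<bar>\<psi> x\<bar> \<le> Bt \<and> norm (g x) \<le> Bt" using testfn_g_bounded[OF t] by blast
    note c = testfn_g_facts(1,2)[OF t]
    have bi: "f integrable_on \<Omega>" if "f \<in> borel_measurable (lebesgue_on \<Omega>)" "\<And>x. x \<in> \<Omega> \<Longrightarrow> norm (f x) \<le> b"
      for f :: "real^'n \<Rightarrow> real" and b
      by (rule measurable_bounded_by_integrable_imp_integrable[OF that(1) integrable_on_const[OF \<Omega>m] that(2) \<Omega>s])
    have gB: "\<bar>g x $ j\<bar> \<le> Bt" for x using Bt(2)[of x] component_le_norm_cart[of "g x" j] by linarith
    have vB: "\<bar>v k x $ i\<bar> \<le> Bw + 1" if "x \<in> \<Omega>" for k x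
    proof -
      have "1 / real (Suc k) \<le> 1" by simp
      thus ?thesis using v(2)[of k x i] Bw[OF that] component_le_norm_cart[of "w x" i] by linarith
    qed
    have l1: "(\<lambda>k. integral \<Omega> (\<lambda>x. v k x $ i * g x $ j)) \<longlonglongrightarrow> integral \<Omega> (\<lambda>x. w x $ i * g x $ j)"
    proof (rule dominated_convergence)
      have b: "norm (v k x $ i * g x $ j) \<le> (Bw + 1) * Bt" if "x \<in> \<Omega>" for k x
        unfolding real_norm_def abs_mult using vB[OF that, of k] gB[of x] by (intro mult_mono) auto
      show "norm (v k x $ i * g x $ j) \<le> (Bw + 1) * Bt" if "x \<in> \<Omega>" for k x by (rule b[OF that])
      show "(\<lambda>x. v k x $ i * g x $ j) integrable_on \<Omega>" for k
        by (rule bi[OF _ b]) (intro cm continuous_intros fv(1) c)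
      show "(\<lambda>x. (Bw + 1) * Bt) integrable_on \<Omega>" by (rule integrable_on_const[OF \<Omega>m])
      show "(\<lambda>k. v k x $ i * g x $ j) \<longlonglongrightarrow> w x $ i * g x $ j" for x by (intro tendsto_mult_right wlim)
    qed
    have l2: "(\<lambda>k. integral \<Omega> (\<lambda>x. Gs k x $ i $ j * \<psi> x)) \<longlonglongrightarrow> integral \<Omega> (\<lambda>x. G x $ i $ j * \<psi> x)"
    proof (rule dominated_convergence_ae(2)[OF _ integrable_on_const[OF \<Omega>m] N])
      have b: "norm (Gs k x $ i $ j * \<psi> x) \<le> B * Bt" for k x
        unfolding real_norm_def abs_mult
        using order_trans[OF matrix_entry_le GsB] Bt(2)[of x] order_trans[OF norm_ge_zero GsB] by (intro mult_mono) auto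
      show "norm (Gs k x $ i $ j * \<psi> x) \<le> B * Bt" for k x by (rule b)
      show "(\<lambda>x. Gs k x $ i $ j * \<psi> x) integrable_on \<Omega>" for k
        by (rule bi[OF _ b]) (intro cm continuous_intros fv(2) c)
      show "(\<lambda>k. Gs k x $ i $ j * \<psi> x) \<longlonglongrightarrow> G x $ i $ j * \<psi> x" if "x \<in> \<Omega> - N" for x
        by (intro tendsto_mult_right tendsto_vec_nth lim that)
    qed
    have "integral \<Omega> (\<lambda>x. v k x $ i * g x $ j) = - integral \<Omega> (\<lambda>x. Gs k x $ i $ j * \<psi> x)" for k
      using weak_grad_testfn[OF v(1), unfolded weak_grad_def, THEN conjunct2, THEN conjunct2, rule_format, OF t] .
    with l1 have "(\<lambda>k. - integral \<Omega> (\<lambda>x. Gs k x $ i $ j * \<psi> x)) \<longlonglongrightarrow> integral \<Omega> (\<lambda>x. w x $ i * g x $ j)" by simp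
    from LIMSEQ_unique[OF this tendsto_minus[OF l2]]
    show "integral \<Omega> (\<lambda>x. w x $ i * g x $ j) = - integral \<Omega> (\<lambda>x. G x $ i $ j * \<psi> x)" .
  qed
  show "W0 \<phi> \<Omega> w"
    unfolding W0_def
  proof (intro conjI exI[of _ G] exI[of _ v] allI)
    show "in_orlicz \<phi> \<Omega> w" by (rule bounded_in_orlicz[OF \<phi> \<Omega>m wm Bw])
    show "in_orlicz \<phi> \<Omega> G" by (rule bounded_in_orlicz[OF \<phi> \<Omega>m Gm GB])
    show "weak_grad \<Omega> w G" by (rule wgG)
    show "testfn \<Omega> (\<lambda>x. v k x $ i)" for k i unfolding testfn_def using v(1) by blast
    have 1: "(\<lambda>k. lux \<phi> \<Omega> (\<lambda>x. v k x - w x)) \<longlonglongrightarrow> 0"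
    proof (rule lux_tendsto_0[OF \<phi> \<Omega>m _ _ negligible_empty])
      show "(\<lambda>x. v k x - w x) \<in> borel_measurable (lebesgue_on \<Omega>)" for k using vm wm by simp
      show "norm (v k x - w x) \<le> real CARD('n) * 1" for k x
      proof -
        have "norm (v k x - w x) \<le> (\<Sum>i\<in>UNIV. \<bar>(v k x - w x) $ i\<bar>)" by (rule norm_le_l1_cart)
        also have "\<dots> \<le> (\<Sum>i\<in>(UNIV::'n set). 1)"
        proof (rule sum_mono)
          fix i
          have "1 / real (Suc k) \<le> 1" by simp
          from order_trans[OF v(2)[of k x i] this] show "\<bar>(v k x - w x) $ i\<bar> \<le> 1" by simp
        qed
        finally show ?thesis by simp
      qed
      show "(\<lambda>k. v k x - w x) \<longlonglongrightarrow> 0" for x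
      proof -
        have "(\<lambda>k. v k x) \<longlonglongrightarrow> w x" by (rule vec_tendstoI[OF wlim])
        thus ?thesis by (simp add: LIM_zero_iff)
      qed
    qed
    have "(\<lambda>k. lux \<phi> \<Omega> (\<lambda>x. Gs k x - G x)) \<longlonglongrightarrow> 0"
    proof (rule lux_tendsto_0[OF \<phi> \<Omega>m _ _ N])
      show "(\<lambda>x. Gs k x - G x) \<in> borel_measurable (lebesgue_on \<Omega>)" for k using Gsm Gm by simp
      show "norm (Gs k x - G x) \<le> B + B" if "x \<in> \<Omega>" for k x
        using norm_triangle_ineq4[of "Gs k x" "G x"] GsB[of k x] GB[OF that] by linarith
      show "(\<lambda>k. Gs k x - G x) \<longlonglongrightarrow> 0" if "x \<in> \<Omega> - N" for x
        using lim[OF that] by (simp add: LIM_zero_iff)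
    qed
    moreover have "lux \<phi> \<Omega> (\<lambda>x. wgrad \<Omega> (v k) x - G x) = lux \<phi> \<Omega> (\<lambda>x. Gs k x - G x)" for k
      by (rule lux_cong, rule negligible_subset[OF wgrad_eq[OF \<Omega>(1) weak_grad_testfn[OF v(1)]]]) auto
    ultimately have 2: "(\<lambda>k. lux \<phi> \<Omega> (\<lambda>x. wgrad \<Omega> (v k) x - G x)) \<longlonglongrightarrow> 0" by simp
    show "(\<lambda>k. lux \<phi> \<Omega> (\<lambda>x. v k x - w x) + lux \<phi> \<Omega> (\<lambda>x. wgrad \<Omega> (v k) x - G x)) \<longlonglongrightarrow> 0"
      using tendsto_add[OF 1 2] by simp
  qed
  have int0: "integral \<Omega> (\<lambda>x. trace (Gs k x)) = 0" and inti: "(\<lambda>x. trace (Gs k x)) integrable_on \<Omega>" for k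
  proof -
    obtain K where K: "compact K" "K \<subseteq> \<Omega>" "\<And>x. x \<notin> K \<Longrightarrow> Gs k x = 0" using fv(3)[of k] by blast
    have i: "(\<lambda>x. Gs k x $ i $ i) integrable_on \<Omega>" for i
    proof -
      have "continuous_on UNIV (\<lambda>x. Gs k x $ i $ i)" by (intro continuous_intros fv(2))
      from compact_support_integral(1)[OF this K(1) _ K(2)] K(3) show ?thesis
        by (simp add: absolutely_integrable_on_def)
    qed
    show "(\<lambda>x. trace (Gs k x)) integrable_on \<Omega>" unfolding trace_def by (intro integrable_sum i) simp
    show "integral \<Omega> (\<lambda>x. trace (Gs k x)) = 0"
      unfolding trace_def by (subst integral_sum) (use i testfn_grad_integral[OF v(1)] in auto)
  qed
  have "(\<lambda>k. integral \<Omega> (\<lambda>x. trace (Gs k x))) \<longlonglongrightarrow> integral \<Omega> (\<lambda>x. trace (G x))"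
  proof (rule dominated_convergence_ae(2)[OF inti integrable_on_const[OF \<Omega>m] N])
    show "norm (trace (Gs k x)) \<le> real CARD('n) * B" for k x
      using order_trans[OF trace_abs_le mult_left_mono[OF GsB[of k x], of "real CARD('n)"]] by simp
    show "(\<lambda>k. trace (Gs k x)) \<longlonglongrightarrow> trace (G x)" if "x \<in> \<Omega> - N" for x
      by (rule continuous_on_tendsto_compose[OF continuous_on_trace[of UNIV] lim[OF that]]) simp_all
  qed
  hence "integral \<Omega> (\<lambda>x. trace (G x)) = 0" by (simp add: int0 LIMSEQ_const_iff)
  thus "\<exists>G B. G \<in> borel_measurable (lebesgue_on \<Omega>) \<and> (\<forall>x\<in>\<Omega>. norm (G x) \<le> B)
      \<and> negligible {x \<in> \<Omega>. wgrad \<Omega> w x \<noteq> G x} \<and> integral \<Omega> (\<lambda>x. trace (G x)) = 0"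
    using Gm GB wgrad_eq[OF \<Omega>(1) wgG] by blast
qed

section \<open>Triangulations\<close>

text \<open>From a point of the frontier lying inside the closure one moves by \<open>t\<close> in
  the direction \<open>e\<close>. The graph condition makes a whole ball there disjoint from
  \<open>\<Omega>\<close>, hence from its closure, a contradiction. The triangulation covers only
  the closure, and this places the interiors of its elements inside \<open>\<Omega>\<close>.\<close>

lemma lipschitz_domain_interior_closure:
  assumes "lipschitz_domain \<Omega>"
  shows "interior (closure \<Omega>) = \<Omega>"
proof
  have op: "open \<Omega>" using assms by (simp add: lipschitz_domain_def)
  show "\<Omega> \<subseteq> interior (closure \<Omega>)" by (rule interior_maximal[OF closure_subset op])
  show "interior (closure \<Omega>) \<subseteq> \<Omega>"
  proof (rule ccontr)
    assume "\<not> interior (closure \<Omega>) \<subseteq> \<Omega>"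
    then obtain x where x: "x \<in> interior (closure \<Omega>)" "x \<notin> \<Omega>" by blast
    hence "x \<in> frontier \<Omega>" using interior_subset op by (auto simp: frontier_def interior_open)
    then obtain e r L g where e: "norm e = 1" and r: "r > 0"
      and g: "\<And>y z. inner y e = 0 \<Longrightarrow> inner z e = 0 \<Longrightarrow> \<bar>g y - g z\<bar> \<le> L * norm (y - z)"
      and loc: "\<Omega> \<inter> ball x r = {w \<in> ball x r. inner (w - x) e < g ((w - x) - inner (w - x) e *\<^sub>R e)}"
      using assms unfolding lipschitz_domain_def by meson
    have ee: "inner e e = 1" using e by (simp add: dot_square_norm)
    have "x \<notin> {w \<in> ball x r. inner (w - x) e < g ((w - x) - inner (w - x) e *\<^sub>R e)}"
      using x(2) loc by blast
    hence g0: "g 0 \<le> 0" using r by simp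
    obtain \<delta> where \<delta>: "\<delta> > 0" "ball x \<delta> \<subseteq> interior (closure \<Omega>)"
      using x(1) open_interior open_contains_ball by blast
    define t where "t = min \<delta> r / 2"
    have t: "t > 0" "t < \<delta>" "t < r" using \<delta> r by (auto simp: t_def)
    define y where "y = x + t *\<^sub>R e"
    \<comment> \<open>The first bound keeps the ball inside \<open>ball x r\<close>. The second
      beats the graph: a perturbation \<open>z\<close> changes the height by at most
      \<open>norm z\<close> and the tangential part by at most \<open>2 * norm z\<close>. The
      absolute value is taken because the sign of \<open>L\<close> is not prescribed.\<close>
    define s where "s = min (r - t) (t / (2 * \<bar>L\<bar> + 2))"
    have s: "s > 0" "s \<le> r - t" "s * (2 * \<bar>L\<bar> + 2) \<le> t"
    proof -
      have p: "2 * \<bar>L\<bar> + 2 > 0" by (simp add: add_nonneg_pos)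
      show "s > 0" "s \<le> r - t" using t p by (auto simp: s_def)
      have "s \<le> t / (2 * \<bar>L\<bar> + 2)" by (simp add: s_def)
      thus "s * (2 * \<bar>L\<bar> + 2) \<le> t" using p by (simp add: pos_le_divide_eq)
    qed
    have far: "w \<notin> \<Omega>" if w: "w \<in> ball y s" for w
    proof
      assume "w \<in> \<Omega>"
      define z where "z = w - y"
      have z: "norm z < s" using w by (simp add: z_def dist_norm norm_minus_commute)
      have wx: "w - x = t *\<^sub>R e + z" by (simp add: z_def y_def)
      have "norm (w - x) < r" using norm_triangle_ineq[of "t *\<^sub>R e" z] z s(2) t(1) e unfolding wx by simp
      hence "w \<in> ball x r" by (simp add: dist_norm norm_minus_commute)
      hence lt: "inner (w - x) e < g ((w - x) - inner (w - x) e *\<^sub>R e)" using \<open>w \<in> \<Omega>\<close> loc by blast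
      have iw: "inner (w - x) e = t + inner z e" by (simp add: wx inner_add_left ee)
      have proj: "(w - x) - inner (w - x) e *\<^sub>R e = z - inner z e *\<^sub>R e"
        unfolding iw unfolding wx by (simp add: scaleR_add_left)
      have iz: "\<bar>inner z e\<bar> \<le> norm z" using Cauchy_Schwarz_ineq2[of z e] e by simp
      have "norm (z - inner z e *\<^sub>R e) \<le> norm z + norm (inner z e *\<^sub>R e)" by (rule norm_triangle_ineq4)
      also have "\<dots> \<le> 2 * norm z" using iz e by simp
      finally have pz: "norm (z - inner z e *\<^sub>R e) \<le> 2 * norm z" .
      have "\<bar>g (z - inner z e *\<^sub>R e) - g 0\<bar> \<le> L * norm (z - inner z e *\<^sub>R e - 0)"
        by (rule g) (simp_all add: inner_diff_left ee)
      also have "\<dots> \<le> \<bar>L\<bar> * (2 * norm z)" using pz by (intro mult_mono) auto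
      finally have "g (z - inner z e *\<^sub>R e) \<le> \<bar>L\<bar> * (2 * norm z)" using g0 by linarith
      with lt[unfolded proj, unfolded iw] have "t + inner z e < \<bar>L\<bar> * (2 * norm z)" by linarith
      hence "t < (2 * \<bar>L\<bar> + 1) * norm z" using iz by (simp add: algebra_simps abs_le_iff)
      also have "\<dots> \<le> (2 * \<bar>L\<bar> + 2) * s" using z s(1) by (intro mult_mono) auto
      finally show False using s(3) by (simp add: mult.commute)
    qed
    hence "ball y s \<inter> \<Omega> = {}" by blast
    hence "ball y s \<inter> closure \<Omega> = {}" by (simp add: open_Int_closure_eq_empty)
    moreover have "y \<in> ball y s" using s by simp
    moreover have "dist x y < \<delta>" using t e by (simp add: y_def dist_norm)
    hence "y \<in> closure \<Omega>" using \<delta>(2) interior_subset by (auto simp: subset_iff)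
    ultimately show False by blast
  qed
qed

lemma simplex_facts:
  fixes K :: "(real^'n) set"
  assumes "K = convex hull S" "\<not> affine_dependent S" "card S = CARD('n) + 1"
  shows "vertices K = S" "compact K" "convex K" "measure lebesgue K > 0" "finite S" "negligible (K - interior K)"
proof -
  show S: "finite S" using assms(2) aff_independent_finite by blast
  show "vertices K = S"
    unfolding vertices_def using extreme_point_of_convex_hull_affine_independent[OF assms(2)] assms(1) by auto
  show c: "compact K" "convex K" using S assms(1) by (auto simp: finite_imp_compact_convex_hull)
  have "interior K \<noteq> {}"
    using interior_convex_hull_eq_empty[of S] assms by auto
  hence nn: "\<not> negligible K" using negligible_convex_interior[OF c(2)] by simp
  have "K \<in> lmeasurable" using c by (simp add: lmeasurable_compact)
  hence "measure lebesgue K \<noteq> 0" using nn by (simp add: negligible_iff_measure0)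
  thus "measure lebesgue K > 0" using measure_nonneg[of lebesgue K] by linarith
  have "K - interior K \<subseteq> frontier K" using closure_subset by (auto simp: frontier_def)
  thus "negligible (K - interior K)" using negligible_convex_frontier[OF c(2)] negligible_subset by blast
qed

text \<open>Different elements share fewer than \<open>CARD('n) + 1\<close> vertices, so their
  intersection, the hull of the common ones, has empty interior and is negligible by
  convexity.\<close>

lemma triangulation_facts:
  fixes T :: "(real^'n) set set"
  assumes "triangulation T \<Omega>"
  shows "finite T" "\<Union>T = closure \<Omega>"
    "\<And>K. K \<in> T \<Longrightarrow> compact K \<and> measure lebesgue K > 0 \<and> negligible (K - interior K)"
    "\<And>K K'. K \<in> T \<Longrightarrow> K' \<in> T \<Longrightarrow> K \<noteq> K' \<Longrightarrow> negligible (K \<inter> K')"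
proof -
  have splx: "\<exists>S. K = convex hull S \<and> \<not> affine_dependent S \<and> card S = CARD('n) + 1" if "K \<in> T" for K
    using assms that by (auto simp: triangulation_def)
  show "finite T" "\<Union>T = closure \<Omega>" using assms by (auto simp: triangulation_def)
  show "compact K \<and> measure lebesgue K > 0 \<and> negligible (K - interior K)" if "K \<in> T" for K
    using splx[OF that] simplex_facts by metis
  show "negligible (K \<inter> K')" if K: "K \<in> T" "K' \<in> T" "K \<noteq> K'" for K K'
  proof -
    obtain S where S: "K = convex hull S" "\<not> affine_dependent S" "card S = CARD('n) + 1" using splx[OF K(1)] by blast
    obtain S' where S': "K' = convex hull S'" "\<not> affine_dependent S'" "card S' = CARD('n) + 1" using splx[OF K(2)] by blast
    note f = simplex_facts[OF S] and f' = simplex_facts[OF S']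
    have eq: "K \<inter> K' = convex hull (S \<inter> S')"
      using assms K(1,2) f(1) f'(1) unfolding triangulation_def by metis
    have "S \<noteq> S'" using K(3) S(1) S'(1) by auto
    hence "S \<inter> S' \<subset> S" using card_subset_eq[of S' S] f(5) f'(5) S(3) S'(3) by auto
    hence "card (S \<inter> S') < CARD('n) + 1" using psubset_card_mono[OF f(5)] S(3) by metis
    hence "interior (convex hull (S \<inter> S')) = {}"
      using f(5) by (intro empty_interior_convex_hull) auto
    thus ?thesis unfolding eq using negligible_convex_interior[OF convex_convex_hull] by blast
  qed
qed

lemma negligible_UN_finite:
  assumes "finite I" "\<And>i. i \<in> I \<Longrightarrow> negligible (S i)"
  shows "negligible (\<Union>i\<in>I. S i)"
  by (rule negligible_Union) (use assms in auto)

lemma triangulation_ae: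
  assumes "lipschitz_domain \<Omega>" "triangulation T \<Omega>"
  shows "negligible (\<Omega> - (\<Union>K\<in>T. interior K))" "\<And>K. K \<in> T \<Longrightarrow> interior K \<subseteq> \<Omega>"
proof -
  note f = triangulation_facts[OF assms(2)]
  have "negligible (\<Union>K\<in>T. K - interior K)"
    by (rule negligible_UN_finite[OF f(1) f(3)[THEN conjunct2, THEN conjunct2]])
  moreover have "\<Omega> - (\<Union>K\<in>T. interior K) \<subseteq> (\<Union>K\<in>T. K - interior K)"
    using closure_subset[of \<Omega>] unfolding f(2)[symmetric] by blast
  ultimately show "negligible (\<Omega> - (\<Union>K\<in>T. interior K))" using negligible_subset by blast
  fix K assume "K \<in> T"
  hence "interior K \<subseteq> interior (closure \<Omega>)" unfolding f(2)[symmetric] by (intro interior_mono) blast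
  thus "interior K \<subseteq> \<Omega>" using lipschitz_domain_interior_closure[OF assms(1)] by simp
qed

lemma integral_piecewise_constant:
  fixes g :: "real^'n \<Rightarrow> real"
  assumes "lipschitz_domain \<Omega>" "triangulation T \<Omega>" "negligible N"
    and g: "\<And>K x. K \<in> T \<Longrightarrow> x \<in> interior K \<Longrightarrow> x \<notin> N \<Longrightarrow> g x = t K"
  shows "integral \<Omega> g = (\<Sum>K\<in>T. measure lebesgue K * t K)"
proof -
  note f = triangulation_facts[OF assms(2)] and a = triangulation_ae[OF assms(1,2)]
  have 1: "(g has_integral measure lebesgue K * t K) K" if "K \<in> T" for K
  proof -
    have m: "K \<in> lmeasurable" using f(3)[OF that] by (simp add: lmeasurable_compact)
    have "((\<lambda>x. 1::real) has_integral measure lebesgue K) K"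
      unfolding lmeasure_integral[OF m] by (rule integrable_integral[OF integrable_on_const[OF m]])
    from has_integral_mult_right[OF this, of "t K"]
    have "((\<lambda>x. t K * 1) has_integral t K * measure lebesgue K) K" .
    hence "((\<lambda>x. t K) has_integral measure lebesgue K * t K) K" by (simp add: mult.commute)
    thus ?thesis
    proof (rule has_integral_spike[of "N \<union> (K - interior K)", rotated 2])
      show "negligible (N \<union> (K - interior K))" using f(3)[OF that] assms(3) by simp
      show "g x = t K" if "x \<in> K - (N \<union> (K - interior K))" for x
        using g[OF \<open>K \<in> T\<close>, of x] that by blast
    qed
  qed
  have "(g has_integral (\<Sum>K\<in>T. measure lebesgue K * t K)) (\<Union>K\<in>T. K)"
    by (rule has_integral_UN[OF f(1) 1]) (auto intro: pairwiseI f(4))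
  hence "(g has_integral (\<Sum>K\<in>T. measure lebesgue K * t K)) \<Omega>"
  proof (rule has_integral_spike_set_eq[THEN iffD1, rotated 2])
    have "(\<Union>K\<in>T. K) - \<Omega> \<subseteq> (\<Union>K\<in>T. K - interior K)" using a(2) by blast
    moreover have "negligible (\<Union>K\<in>T. K - interior K)"
      by (rule negligible_UN_finite[OF f(1) f(3)[THEN conjunct2, THEN conjunct2]])
    ultimately have "negligible ((\<Union>K\<in>T. K) - \<Omega>)" using negligible_subset by blast
    thus "negligible {x \<in> (\<Union>K\<in>T. K) - \<Omega>. g x \<noteq> 0}" by (rule negligible_subset) auto
    have "\<Omega> - (\<Union>K\<in>T. K) = {}" using f(2) closure_subset by auto
    hence "{x \<in> \<Omega> - (\<Union>K\<in>T. K). g x \<noteq> 0} = {}" by blast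
    thus "negligible {x \<in> \<Omega> - (\<Union>K\<in>T. K). g x \<noteq> 0}" by (simp only: negligible_empty)
  qed
  thus ?thesis by (rule integral_unique)
qed

section \<open>Quasi-optimality\<close>

text \<open>The indices bound the quotient
  \<open>t * deriv (deriv \<phi>) t / deriv \<phi> t\<close> by \<open>rm - 1\<close> and
  \<open>rp - 1\<close>; the latter is enlarged to \<open>nat \<lceil>rp\<rceil>\<close> to obtain a
  natural exponent. Clearing the denominator needs a positive derivative, which is shown
  first.\<close>

lemma unif_convex_N_power_growth:
  assumes "unif_convex_N \<phi> rm rp"
  shows "power_growth (deriv \<phi>) (deriv (deriv \<phi>)) (nat \<lceil>rp\<rceil>) (rm - 1)"
proof
  have N: "N_function \<phi>" and C2: "C2_pos \<phi>" and rm: "rm = Inf (index_set \<phi>)" "rm > 1"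
    and rp: "rp = Sup (index_set \<phi>)" and bdd: "bdd_below (index_set \<phi>)" "bdd_above (index_set \<phi>)"
    using assms by (auto simp: unif_convex_N_def)
  have d: "(\<phi> has_real_derivative deriv \<phi> t) (at t)" if "t > 0" for t
    using C2 that by (simp add: C2_pos_def DERIV_deriv_iff_real_differentiable)
  show "(deriv \<phi> has_real_derivative deriv (deriv \<phi>) t) (at t)" if "t > 0" for t
    using C2 that by (simp add: C2_pos_def DERIV_deriv_iff_real_differentiable)
  have idx: "rm - 1 \<le> t * deriv (deriv \<phi>) t / deriv \<phi> t" "t * deriv (deriv \<phi>) t / deriv \<phi> t \<le> rp - 1" if "t > 0" for t
  proof -
    have "t * deriv (deriv \<phi>) t / deriv \<phi> t + 1 \<in> index_set \<phi>" using that by (auto simp: index_set_def)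
    from cInf_lower[OF this bdd(1)] cSup_upper[OF this bdd(2)]
    show "rm - 1 \<le> t * deriv (deriv \<phi>) t / deriv \<phi> t" "t * deriv (deriv \<phi>) t / deriv \<phi> t \<le> rp - 1"
      by (simp_all add: rm(1) rp)
  qed
  show pos: "deriv \<phi> t > 0" if "t > 0" for t
  proof -
    have "\<not> deriv \<phi> t < 0"
    proof
      assume "deriv \<phi> t < 0"
      from DERIV_neg_dec_right[OF d[OF that] this] obtain e where
        e: "e > 0" "\<And>h. 0 < h \<Longrightarrow> h < e \<Longrightarrow> \<phi> (t + h) < \<phi> t" by blast
      have "\<phi> (t + e / 2) < \<phi> t" using e by simp
      moreover have "\<phi> t \<le> \<phi> (t + e / 2)" using that e by (intro N_function_mono[OF N]) auto
      ultimately show False by simp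
    qed
    \<comment> \<open>Division by zero yields 0, so a zero of the derivative would produce the index
      value 1, which is below \<open>rm\<close>.\<close>
    moreover have "deriv \<phi> t \<noteq> 0"
    proof
      assume "deriv \<phi> t = 0"
      thus False using idx(1)[OF that] rm(2) by simp
    qed
    ultimately show ?thesis by simp
  qed
  show "rm - 1 > 0" using rm by simp
  show "(rm - 1) * deriv \<phi> t \<le> t * deriv (deriv \<phi>) t" if "t > 0" for t
    using idx(1)[OF that] pos[OF that] by (simp add: pos_le_divide_eq)
  show "t * deriv (deriv \<phi>) t \<le> real (nat \<lceil>rp\<rceil>) * deriv \<phi> t" if "t > 0" for t
  proof -
    have "t * deriv (deriv \<phi>) t \<le> (rp - 1) * deriv \<phi> t"
      using idx(2)[OF that] pos[OF that] by (simp add: pos_divide_le_eq)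
    also have "\<dots> \<le> real (nat \<lceil>rp\<rceil>) * deriv \<phi> t"
      using pos[OF that] real_nat_ceiling_ge[of rp] by (intro mult_right_mono) auto
    finally show ?thesis .
  qed
qed

section \<open>Measurability and integrability of energies and stresses\<close>

lemma norm_transpose: "norm (transpose (M::real^'n^'n)) = norm M"
proof -
  have "(\<Sum>i\<in>UNIV. \<Sum>j\<in>UNIV. M $ j $ i * M $ j $ i) = (\<Sum>i\<in>UNIV. \<Sum>j\<in>UNIV. M $ i $ j * M $ i $ j)"
    by (rule sum.swap)
  hence "inner (transpose M) (transpose M) = inner M M"
    by (simp add: inner_vec_def transpose_def)
  thus ?thesis by (simp add: norm_eq_sqrt_inner)
qed

lemma norm_symm_le: "norm (symm (M::real^'n^'n)) \<le> norm M"
  using norm_triangle_ineq[of M "transpose M"] by (simp add: symm_def norm_transpose)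

lemma continuous_on_symm: "continuous_on S (symm :: real^'n^'n \<Rightarrow> real^'n^'n)"
proof -
  have eq: "symm = (\<lambda>M::real^'n^'n. (1/2) *\<^sub>R (M + (\<chi> i j. M $ j $ i)))"
    by (simp add: fun_eq_iff symm_def transpose_def)
  show ?thesis unfolding eq by (intro continuous_intros continuous_on_vec_lambda)
qed

context power_growth begin

lemma energy_mono:
  assumes "0 \<le> s" "s \<le> t"
  shows "d s * s \<le> d t * t"
proof (cases "s = 0")
  case True
  thus ?thesis using pos[of t] assms by (cases "t = 0") auto
next
  case False
  thus ?thesis using mono[of s t] pos[of t] assms by (intro mult_mono) auto
qed

text \<open>The mean value theorem on \<open>[r, 2 * r]\<close>, where \<open>2 * r = t / s\<close>,
  gives \<open>r * d r \<le> \<phi> (2 * r)\<close>; doubling then moves from \<open>r\<close> to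
  \<open>t = 2 * s * r\<close>. Membership in the Orlicz class at any scale \<open>s\<close> thus
  dominates the unscaled energy.\<close>

lemma energy_le_modular:
  assumes \<phi>: "N_function \<phi>" "\<And>t. t > 0 \<Longrightarrow> (\<phi> has_real_derivative d t) (at t)" and "s > 0" "0 \<le> t"
  shows "d t * t \<le> max 1 (2 * s) ^ N * (2 * s) * \<phi> (t / s)"
proof (cases "t = 0")
  case True
  thus ?thesis using \<phi>(1) by (simp add: N_function_def)
next
  case False
  hence t: "t > 0" using assms by simp
  define r where "r = t / (2 * s)"
  have r: "r > 0" "t = 2 * s * r" "t / s = 2 * r" using t \<open>s > 0\<close> by (auto simp: r_def field_simps)
  have "\<exists>z>r. z < 2 * r \<and> \<phi> (2 * r) - \<phi> r = (2 * r - r) * d z"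
    using r by (intro MVT2) (auto intro!: \<phi>(2))
  then obtain z where z: "z > r" "\<phi> (2 * r) - \<phi> r = r * d z" by auto
  have "r * d r \<le> r * d z" using mono[of r z] z r by (intro mult_left_mono) auto
  also have "\<dots> \<le> \<phi> (2 * r)" using z N_function_nonneg[OF \<phi>(1), of r] r by simp
  finally have 1: "r * d r \<le> \<phi> (2 * r)" .
  have "d t \<le> max 1 (2 * s) ^ N * d r"
    using r t \<open>s > 0\<close> by (intro scaling_le) (auto intro!: mult_right_mono)
  hence "d t * t \<le> max 1 (2 * s) ^ N * d r * t" using t by (intro mult_right_mono) auto
  also have "\<dots> = max 1 (2 * s) ^ N * (2 * s) * (r * d r)" using r(2) by simp
  also have "\<dots> \<le> max 1 (2 * s) ^ N * (2 * s) * \<phi> (2 * r)"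
    using 1 \<open>s > 0\<close> by (intro mult_left_mono) auto
  finally show ?thesis using r(3) by simp
qed

text \<open>This lets the growth \<open>K * deriv \<phi> (norm P)\<close> of the stress be bounded
  by the energy density plus a constant, which is integrable on a bounded domain.\<close>

lemma d_le_energy:
  assumes "t > 0"
  shows "d t \<le> d 1 + d t * t"
proof (cases "t \<le> 1")
  case True
  have "0 \<le> d t * t" using pos[OF assms] assms by simp
  thus ?thesis using mono[OF assms True] by linarith
next
  case False
  hence "d t * 1 \<le> d t * t" using pos[OF assms] by (intro mult_left_mono) auto
  thus ?thesis using pos[of 1] by linarith
qed

text \<open>Continuity of \<open>d\<close> is known only for positive arguments; the indicator is
  harmless for \<open>Fmap\<close>, which vanishes at 0.\<close>

lemma d_measurable: "(\<lambda>t. indicator {0<..} t *\<^sub>R d t) \<in> borel_measurable borel"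
proof (rule borel_measurable_continuous_on_indicator)
  show "continuous_on {0<..} d"
    using deriv by (intro continuous_at_imp_continuous_on ballI) (auto dest: DERIV_isCont)
qed simp

end

lemma Fmap_norm_sq:
  fixes Q :: "real^'n^'n"
  assumes "power_growth (deriv \<phi>) dd N a"
  shows "(norm (Fmap \<phi> Q))\<^sup>2 = deriv \<phi> (norm Q) * norm Q"
proof -
  interpret power_growth "deriv \<phi>" dd N a by fact
  show ?thesis using pos[of "norm Q"] by (auto simp: Fmap_def)
qed

lemma Fmap_measurable:
  assumes "power_growth (deriv \<phi>) dd N a"
  shows "Fmap \<phi> \<in> borel_measurable (borel :: (real^'n^'n) measure)"
proof -
  interpret power_growth "deriv \<phi>" dd N a by fact
  note [measurable] = d_measurable
  have eq: "Fmap \<phi> = (\<lambda>Q::real^'n^'n. (sqrt ((indicator {0<..} (norm Q) *\<^sub>R deriv \<phi> (norm Q)) * norm Q) / norm Q) *\<^sub>R Q)"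
    by (auto simp: Fmap_def fun_eq_iff)
  show ?thesis unfolding eq by measurable
qed

lemma orlicz_energy_integrable:
  fixes U :: "real^'n \<Rightarrow> real^'n^'n"
  assumes "unif_convex_N \<phi> rm rp" "\<Omega> \<in> sets lebesgue" "in_orlicz \<phi> \<Omega> U"
  obtains e where "e integrable_on \<Omega>" "\<And>x. x \<in> \<Omega> \<Longrightarrow> deriv \<phi> (norm (symm (U x))) * norm (symm (U x)) \<le> e x"
proof -
  interpret power_growth "deriv \<phi>" "deriv (deriv \<phi>)" "nat \<lceil>rp\<rceil>" "rm - 1"
    by (rule unif_convex_N_power_growth[OF assms(1)])
  have N: "N_function \<phi>" and C2: "C2_pos \<phi>" using assms(1) by (auto simp: unif_convex_N_def)
  have d: "(\<phi> has_real_derivative deriv \<phi> t) (at t)" if "t > 0" for t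
    using C2 that by (simp add: C2_pos_def DERIV_deriv_iff_real_differentiable)
  obtain s where s: "s > 0" "(\<lambda>x. \<phi> (norm (U x) / s)) integrable_on \<Omega>" using assms(3) by (auto simp: in_orlicz_def)
  show ?thesis
  proof (rule that)
    show "(\<lambda>x. max 1 (2 * s) ^ nat \<lceil>rp\<rceil> * (2 * s) * \<phi> (norm (U x) / s)) integrable_on \<Omega>"
      by (rule integrable_on_mult_right[OF s(2)])
    fix x
    show "deriv \<phi> (norm (symm (U x))) * norm (symm (U x)) \<le> max 1 (2 * s) ^ nat \<lceil>rp\<rceil> * (2 * s) * \<phi> (norm (U x) / s)"
      by (rule order_trans[OF energy_mono[OF norm_ge_zero norm_symm_le] energy_le_modular[OF N d s(1) norm_ge_zero]])
  qed
qed

context phi_operator begin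

text \<open>The test gradient \<open>R\<close> is bounded while \<open>P\<close> merely has finite
  energy, so \<open>A_growth\<close> and \<open>d_le_energy\<close> provide the dominating
  function.\<close>

lemma stress_integrable:
  fixes P R :: "real^'n \<Rightarrow> real^'n^'n"
  assumes \<Omega>: "\<Omega> \<in> lmeasurable"
    and P: "P \<in> borel_measurable (lebesgue_on \<Omega>)" "e integrable_on \<Omega>"
      "\<And>x. x \<in> \<Omega> \<Longrightarrow> deriv \<phi> (norm (P x)) * norm (P x) \<le> e x"
    and R: "R \<in> borel_measurable (lebesgue_on \<Omega>)" "\<And>x. x \<in> \<Omega> \<Longrightarrow> norm (R x) \<le> B"
  shows "(\<lambda>x. inner (A (P x)) (R x)) integrable_on \<Omega>"
proof (rule measurable_bounded_by_integrable_imp_integrable)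
  have "(\<lambda>x. A (P x)) \<in> borel_measurable (lebesgue_on \<Omega>)" by (rule borel_measurable_continuous_on[OF A_cont P(1)])
  thus "(\<lambda>x. inner (A (P x)) (R x)) \<in> borel_measurable (lebesgue_on \<Omega>)" using R(1) by (rule borel_measurable_inner)
  show "(\<lambda>x. K * (deriv \<phi> 1 + e x) * B) integrable_on \<Omega>"
    by (intro integrable_on_mult_left integrable_on_mult_right Henstock_Kurzweil_Integration.integrable_add
        integrable_on_const[OF \<Omega>] P(2))
  show "\<Omega> \<in> sets lebesgue" by (rule fmeasurableD[OF \<Omega>])
  fix x assume x: "x \<in> \<Omega>"
  have A: "norm (A (P x)) \<le> K * (deriv \<phi> 1 + e x)"
  proof (cases "P x = 0")
    case True
    have "0 \<le> e x" using P(3)[OF x] True by simp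
    thus ?thesis using True A_0 C_pos pos[of 1] by simp
  next
    case False
    have "norm (A (P x)) \<le> K * deriv \<phi> (norm (P x))" by (rule A_growth[OF False])
    also have "\<dots> \<le> K * (deriv \<phi> 1 + e x)"
      using d_le_energy[of "norm (P x)"] P(3)[OF x] False C_pos by (intro mult_left_mono) auto
    finally show ?thesis .
  qed
  have "norm (inner (A (P x)) (R x)) \<le> norm (A (P x)) * norm (R x)" by (simp add: Cauchy_Schwarz_ineq2)
  also have "\<dots> \<le> K * (deriv \<phi> 1 + e x) * B"
    using A R(2)[OF x] order_trans[OF norm_ge_zero A] by (intro mult_mono) auto
  finally show "norm (inner (A (P x)) (R x)) \<le> K * (deriv \<phi> 1 + e x) * B" .
qed

end

section \<open>Discrete velocities as divergence-free test functions\<close>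

lemma smoothing_facts:
  assumes \<Omega>: "open \<Omega>" "bounded \<Omega>" and sm: "smoothing T \<Omega> E" and \<phi>: "N_function \<phi>" and v: "v \<in> CR T"
  obtains G B N where "W0 \<phi> \<Omega> (E v)" "G \<in> borel_measurable (lebesgue_on \<Omega>)" "\<And>x. x \<in> \<Omega> \<Longrightarrow> norm (G x) \<le> B"
    "negligible N" "\<And>x. x \<in> \<Omega> - N \<Longrightarrow> wgrad \<Omega> (E v) x = G x" "integral \<Omega> (\<lambda>x. trace (G x)) = 0"
    "\<And>K x. K \<in> T \<Longrightarrow> x \<in> interior K \<Longrightarrow> x \<in> \<Omega> - N \<Longrightarrow> trace (G x) = trace (lingrad (v K))"
proof -
  have "(\<exists>L. L-lipschitz_on UNIV (E v)) \<and> (\<forall>x. x \<notin> \<Omega> \<longrightarrow> E v x = 0)"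
    using sm[unfolded smoothing_def, THEN conjunct2, THEN conjunct1] v by blast
  then obtain L where L: "L-lipschitz_on UNIV (E v)" and z: "\<And>x. x \<notin> \<Omega> \<Longrightarrow> E v x = 0" by blast
  have "AE x in lebesgue. \<forall>K\<in>T. x \<in> interior K \<longrightarrow> trace (wgrad \<Omega> (E v) x) = trace (lingrad (v K))"
    using sm[unfolded smoothing_def, THEN conjunct2, THEN conjunct2, THEN conjunct2, THEN conjunct1] v by blast
  then obtain N1 where N1: "{x \<in> space lebesgue. \<not> (\<forall>K\<in>T. x \<in> interior K \<longrightarrow> trace (wgrad \<Omega> (E v) x) = trace (lingrad (v K)))} \<subseteq> N1"
    "emeasure lebesgue N1 = 0" "N1 \<in> sets lebesgue" by (rule AE_E)
  have nN1: "negligible N1" using N1(2,3) by (simp add: negligible_iff_null_sets null_sets_def)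
  obtain G B where G: "G \<in> borel_measurable (lebesgue_on \<Omega>)" "\<And>x. x \<in> \<Omega> \<Longrightarrow> norm (G x) \<le> B"
    "negligible {x \<in> \<Omega>. wgrad \<Omega> (E v) x \<noteq> G x}" "integral \<Omega> (\<lambda>x. trace (G x)) = 0"
    using lipschitz_W0(2)[OF \<phi> \<Omega> L z] by blast
  show ?thesis
  proof (rule that[OF lipschitz_W0(1)[OF \<phi> \<Omega> L z] G(1,2) negligible_Un[OF nN1 G(3)] _ G(4)])
    show eq: "wgrad \<Omega> (E v) x = G x" if "x \<in> \<Omega> - (N1 \<union> {x \<in> \<Omega>. wgrad \<Omega> (E v) x \<noteq> G x})" for x
      using that by blast
    show "trace (G x) = trace (lingrad (v K))"
      if "K \<in> T" "x \<in> interior K" "x \<in> \<Omega> - (N1 \<union> {x \<in> \<Omega>. wgrad \<Omega> (E v) x \<noteq> G x})" for K x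
    proof -
      have "x \<notin> N1" using that(3) by blast
      hence "trace (wgrad \<Omega> (E v) x) = trace (lingrad (v K))" using N1(1) that(1,2) by auto
      thus ?thesis using eq[OF that(3)] by simp
    qed
  qed
qed

text \<open>The discrete divergence is itself an admissible pressure: \<open>E\<close> preserves it,
  and the divergence of \<open>E uh\<close> has integral zero. Testing with it makes a sum of its
  squares, weighted by the positive element volumes, vanish.\<close>

lemma method2_solution_in_Zh:
  assumes dom: "lipschitz_domain \<Omega>" and tri: "triangulation T \<Omega>" and sm: "smoothing T \<Omega> E"
    and \<phi>: "N_function \<phi>" and uh: "uh \<in> CR T" and div: "\<And>q. q \<in> S00 T \<Longrightarrow> divh_int T q uh = 0"
  shows "uh \<in> Zh T"
proof -
  have \<Omega>: "open \<Omega>" "bounded \<Omega>" using dom by (auto simp: lipschitz_domain_def)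
  note tf = triangulation_facts[OF tri]
  obtain G B N where "W0 \<phi> \<Omega> (E uh)" "G \<in> borel_measurable (lebesgue_on \<Omega>)" "\<And>x. x \<in> \<Omega> \<Longrightarrow> norm (G x) \<le> B"
    and N: "negligible N" and "\<And>x. x \<in> \<Omega> - N \<Longrightarrow> wgrad \<Omega> (E uh) x = G x"
    and G: "integral \<Omega> (\<lambda>x. trace (G x)) = 0"
    "\<And>K x. K \<in> T \<Longrightarrow> x \<in> interior K \<Longrightarrow> x \<in> \<Omega> - N \<Longrightarrow> trace (G x) = trace (lingrad (uh K))"
    by (rule smoothing_facts[OF \<Omega> sm \<phi> uh]) (rule that)
  have "trace (G x) = trace (lingrad (uh K))" if "K \<in> T" "x \<in> interior K" "x \<notin> N" for K x
    using G(2)[OF that(1,2)] triangulation_ae(2)[OF dom tri that(1)] that by blast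
  from integral_piecewise_constant[OF dom tri N this]
  have sum0: "(\<Sum>K\<in>T. measure lebesgue K * trace (lingrad (uh K))) = 0" using G(1) by simp
  define q where "q K = (if K \<in> T then trace (lingrad (uh K)) else 0)" for K
  have "q \<in> S00 T" using sum0 by (simp add: S00_def q_def)
  from div[OF this] have "(\<Sum>K\<in>T. measure lebesgue K * (trace (lingrad (uh K)) * trace (lingrad (uh K)))) = 0"
    by (simp add: divh_int_def q_def mult.assoc)
  moreover have "0 \<le> measure lebesgue K * (trace (lingrad (uh K)) * trace (lingrad (uh K)))" for K :: "(real^'a) set"
    by simp
  ultimately have "measure lebesgue K * (trace (lingrad (uh K)) * trace (lingrad (uh K))) = 0" if "K \<in> T" for K
    using that by (subst (asm) sum_nonneg_eq_0_iff[OF tf(1)]) blast+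
  hence "trace (lingrad (uh K)) = 0" if "K \<in> T" for K using that tf(3)[OF that] by force
  thus ?thesis using uh by (simp add: Zh_def)
qed

text \<open>The pointwise estimate is a hypothesis here, and the work is to integrate it.
  \<open>P\<close>, \<open>Q\<close> and \<open>R\<close> become measurable representatives of the
  symmetric gradients, with \<open>P\<close> of finite energy and \<open>Q\<close>, \<open>R\<close>
  bounded, so that the four stress integrals exist separately.\<close>

lemma quasi_optimality_integral:
  fixes A :: "real^'n^'n \<Rightarrow> real^'n^'n"
  assumes uc: "unif_convex_N \<phi> rm rp" and st: "phi_structure \<phi> A C0 C1"
    and dom: "lipschitz_domain \<Omega>" and tri: "triangulation T \<Omega>" and sm: "smoothing T \<Omega> E"
    and sol: "stokes_sol \<phi> A \<Omega> f u p" and m2: "method2 A \<Omega> T E f uh ph" and vh: "vh \<in> Zh T"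
    and B: "B > 0" and pt: "\<And>P Q R. (norm (Fmap \<phi> P - Fmap \<phi> Q))\<^sup>2 \<le> B * (norm (Fmap \<phi> P - Fmap \<phi> R))\<^sup>2 + D * inner (A P - A Q) (R - Q)"
  shows "integral \<Omega> (\<lambda>x. (norm (Fmap \<phi> (symm (wgrad \<Omega> u x)) - Fmap \<phi> (symm (wgrad \<Omega> (E uh) x))))\<^sup>2)
    \<le> B * integral \<Omega> (\<lambda>x. (norm (Fmap \<phi> (symm (wgrad \<Omega> u x)) - Fmap \<phi> (symm (wgrad \<Omega> (E vh) x))))\<^sup>2)"
proof -
  have \<Omega>: "open \<Omega>" "bounded \<Omega>" using dom by (auto simp: lipschitz_domain_def)
  have \<Omega>m: "\<Omega> \<in> lmeasurable" by (rule lmeasurable_open[OF \<Omega>(2,1)])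
  hence \<Omega>s: "\<Omega> \<in> sets lebesgue" by (rule fmeasurableD)
  have \<phi>: "N_function \<phi>" using uc by (simp add: unif_convex_N_def)
  have pg: "power_growth (deriv \<phi>) (deriv (deriv \<phi>)) (nat \<lceil>rp\<rceil>) (rm - 1)" by (rule unif_convex_N_power_growth[OF uc])
  interpret phi_operator \<phi> "nat \<lceil>rp\<rceil>" "rm - 1" A C0 C1
    using pg st by (simp add: phi_operator_def phi_operator_axioms_def)
  have uhCR: "uh \<in> CR T" using m2 by (simp add: method2_def)
  have uhZ: "uh \<in> Zh T"
    by (rule method2_solution_in_Zh[OF dom tri sm \<phi> uhCR]) (use m2 in \<open>simp add: method2_def\<close>)
  obtain U where U: "weak_grad \<Omega> u U" "in_orlicz \<phi> \<Omega> U" using sol by (auto simp: stokes_sol_def W0_def)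
  have Nu: "negligible {x \<in> \<Omega>. wgrad \<Omega> u x \<noteq> U x}" by (rule wgrad_eq[OF \<Omega>(1) U(1)])
  define P where "P x = symm (U x)" for x
  have Pm: "P \<in> borel_measurable (lebesgue_on \<Omega>)" unfolding P_def
    using U(2) by (intro borel_measurable_continuous_on[OF continuous_on_symm]) (simp add: in_orlicz_def)
  obtain eP where eP0: "eP integrable_on \<Omega>"
    "\<And>x. x \<in> \<Omega> \<Longrightarrow> deriv \<phi> (norm (symm (U x))) * norm (symm (U x)) \<le> eP x"
    by (rule orlicz_energy_integrable[OF uc \<Omega>s U(2)]) (rule that)
  note eP = eP0[folded P_def]
  \<comment> \<open>Used for \<open>uh\<close> and for \<open>vh\<close>; besides the equality of
    the stress integrals it delivers the bounded measurable representative.\<close>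
  have disc: "\<exists>R M N. R \<in> borel_measurable (lebesgue_on \<Omega>) \<and> (\<forall>x\<in>\<Omega>. norm (R x) \<le> M) \<and> negligible N
      \<and> (\<forall>x\<in>\<Omega> - N. symm (wgrad \<Omega> (E v) x) = R x)
      \<and> integral \<Omega> (\<lambda>x. inner (A (symm (wgrad \<Omega> u x))) (symm (wgrad \<Omega> (E v) x)))
        = integral \<Omega> (\<lambda>x. inner (A (symm (wgrad \<Omega> (E uh) x))) (symm (wgrad \<Omega> (E v) x)))"
    if v: "v \<in> Zh T" for v
  proof -
    have vCR: "v \<in> CR T" and v0: "\<And>K. K \<in> T \<Longrightarrow> trace (lingrad (v K)) = 0" using v by (auto simp: Zh_def)
    obtain G M N where G: "W0 \<phi> \<Omega> (E v)" "G \<in> borel_measurable (lebesgue_on \<Omega>)" "\<And>x. x \<in> \<Omega> \<Longrightarrow> norm (G x) \<le> M"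
      "negligible N" "\<And>x. x \<in> \<Omega> - N \<Longrightarrow> wgrad \<Omega> (E v) x = G x" "integral \<Omega> (\<lambda>x. trace (G x)) = 0"
      "\<And>K x. K \<in> T \<Longrightarrow> x \<in> interior K \<Longrightarrow> x \<in> \<Omega> - N \<Longrightarrow> trace (G x) = trace (lingrad (v K))"
      by (rule smoothing_facts[OF \<Omega> sm \<phi> vCR]) (rule that)
    have "integral \<Omega> (\<lambda>x. p x * trace (wgrad \<Omega> (E v) x)) = integral \<Omega> (\<lambda>x. 0)"
    proof (rule integral_spike[OF negligible_Un[OF G(4) triangulation_ae(1)[OF dom tri]]])
      fix x assume x: "x \<in> \<Omega> - (N \<union> (\<Omega> - (\<Union>K\<in>T. interior K)))"
      then obtain K where "K \<in> T" "x \<in> interior K" by blast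
      thus "0 = p x * trace (wgrad \<Omega> (E v) x)" using G(5)[of x] G(7)[of K x] v0[of K] x by auto
    qed
    moreover have "divh_int T ph v = 0" unfolding divh_int_def by (intro sum.neutral ballI) (simp add: v0)
    moreover have "integral \<Omega> (\<lambda>x. inner (A (symm (wgrad \<Omega> u x))) (symm (wgrad \<Omega> (E v) x)))
          - integral \<Omega> (\<lambda>x. p x * trace (wgrad \<Omega> (E v) x)) = f (E v)"
      using sol G(1) unfolding stokes_sol_def by blast
    moreover have "integral \<Omega> (\<lambda>x. inner (A (symm (wgrad \<Omega> (E uh) x))) (symm (wgrad \<Omega> (E v) x)))
                   - divh_int T ph v = f (E v)"
      using m2 vCR unfolding method2_def by blast
    ultimately have eq: "integral \<Omega> (\<lambda>x. inner (A (symm (wgrad \<Omega> u x))) (symm (wgrad \<Omega> (E v) x)))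
        = integral \<Omega> (\<lambda>x. inner (A (symm (wgrad \<Omega> (E uh) x))) (symm (wgrad \<Omega> (E v) x)))" by simp
    show ?thesis
    proof (intro exI conjI ballI)
      show "(\<lambda>x. symm (G x)) \<in> borel_measurable (lebesgue_on \<Omega>)"
        by (rule borel_measurable_continuous_on[OF continuous_on_symm G(2)])
      show "norm (symm (G x)) \<le> M" if "x \<in> \<Omega>" for x by (rule order_trans[OF norm_symm_le G(3)[OF that]])
      show "negligible N" by (rule G(4))
      show "symm (wgrad \<Omega> (E v) x) = symm (G x)" if "x \<in> \<Omega> - N" for x using G(5)[OF that] by simp
    qed (rule eq)
  qed
  obtain Q MQ NQ where Q: "Q \<in> borel_measurable (lebesgue_on \<Omega>)" "\<And>x. x \<in> \<Omega> \<Longrightarrow> norm (Q x) \<le> MQ" "negligible NQ"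
    "\<And>x. x \<in> \<Omega> - NQ \<Longrightarrow> symm (wgrad \<Omega> (E uh) x) = Q x"
    "integral \<Omega> (\<lambda>x. inner (A (symm (wgrad \<Omega> u x))) (symm (wgrad \<Omega> (E uh) x)))
        = integral \<Omega> (\<lambda>x. inner (A (symm (wgrad \<Omega> (E uh) x))) (symm (wgrad \<Omega> (E uh) x)))"
    using disc[OF uhZ] by blast
  obtain R MR NR where R: "R \<in> borel_measurable (lebesgue_on \<Omega>)" "\<And>x. x \<in> \<Omega> \<Longrightarrow> norm (R x) \<le> MR" "negligible NR"
    "\<And>x. x \<in> \<Omega> - NR \<Longrightarrow> symm (wgrad \<Omega> (E vh) x) = R x"
    "integral \<Omega> (\<lambda>x. inner (A (symm (wgrad \<Omega> u x))) (symm (wgrad \<Omega> (E vh) x)))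
        = integral \<Omega> (\<lambda>x. inner (A (symm (wgrad \<Omega> (E uh) x))) (symm (wgrad \<Omega> (E vh) x)))"
    using disc[OF vh] by blast
  define N where "N = {x \<in> \<Omega>. wgrad \<Omega> u x \<noteq> U x} \<union> NQ \<union> NR"
  have N: "negligible N" using Nu Q(3) R(3) by (simp add: N_def)
  have on: "symm (wgrad \<Omega> u x) = P x" "symm (wgrad \<Omega> (E uh) x) = Q x" "symm (wgrad \<Omega> (E vh) x) = R x"
    if "x \<in> \<Omega> - N" for x using that Q(4)[of x] R(4)[of x] by (auto simp: N_def P_def)
  have bounded_energy: "deriv \<phi> (norm X) * norm X \<le> deriv \<phi> M * M" if "norm X \<le> M" for X :: "real^'n^'n" and M
    by (rule energy_mono[OF norm_ge_zero that])
  have iPQ: "(\<lambda>x. inner (A (P x)) (Q x)) integrable_on \<Omega>" by (rule stress_integrable[OF \<Omega>m Pm eP Q(1,2)])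
  have iPR: "(\<lambda>x. inner (A (P x)) (R x)) integrable_on \<Omega>" by (rule stress_integrable[OF \<Omega>m Pm eP R(1,2)])
  have eQb: "deriv \<phi> (norm (Q x)) * norm (Q x) \<le> deriv \<phi> MQ * MQ" if "x \<in> \<Omega>" for x
    by (rule bounded_energy[OF Q(2)[OF that]])
  have iQQ: "(\<lambda>x. inner (A (Q x)) (Q x)) integrable_on \<Omega>"
    by (rule stress_integrable[OF \<Omega>m Q(1) integrable_on_const[OF \<Omega>m] eQb Q(1,2)])
  have iQR: "(\<lambda>x. inner (A (Q x)) (R x)) integrable_on \<Omega>"
    by (rule stress_integrable[OF \<Omega>m Q(1) integrable_on_const[OF \<Omega>m] eQb R(1,2)])
  have eQ: "integral \<Omega> (\<lambda>x. inner (A (P x)) (Q x)) = integral \<Omega> (\<lambda>x. inner (A (Q x)) (Q x))"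
  proof -
    have "integral \<Omega> (\<lambda>x. inner (A (P x)) (Q x)) = integral \<Omega> (\<lambda>x. inner (A (symm (wgrad \<Omega> u x))) (symm (wgrad \<Omega> (E uh) x)))"
      by (rule integral_spike[OF N]) (simp add: on)
    also note Q(5)
    also have "integral \<Omega> (\<lambda>x. inner (A (symm (wgrad \<Omega> (E uh) x))) (symm (wgrad \<Omega> (E uh) x))) = integral \<Omega> (\<lambda>x. inner (A (Q x)) (Q x))"
      by (rule integral_spike[OF N]) (simp add: on)
    finally show ?thesis .
  qed
  have eR: "integral \<Omega> (\<lambda>x. inner (A (P x)) (R x)) = integral \<Omega> (\<lambda>x. inner (A (Q x)) (R x))"
  proof -
    have "integral \<Omega> (\<lambda>x. inner (A (P x)) (R x)) = integral \<Omega> (\<lambda>x. inner (A (symm (wgrad \<Omega> u x))) (symm (wgrad \<Omega> (E vh) x)))"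
      by (rule integral_spike[OF N]) (simp add: on)
    also note R(5)
    also have "integral \<Omega> (\<lambda>x. inner (A (symm (wgrad \<Omega> (E uh) x))) (symm (wgrad \<Omega> (E vh) x))) = integral \<Omega> (\<lambda>x. inner (A (Q x)) (R x))"
      by (rule integral_spike[OF N]) (simp add: on)
    finally show ?thesis .
  qed
  \<comment> \<open>Four separately integrable terms, arranged so that \<open>eR\<close> and
    \<open>eQ\<close> cancel them in pairs; pointwise this is
    \<open>(A P - A Q) : (R - Q)\<close>.\<close>
  define t where "t x = (inner (A (P x)) (R x) - inner (A (P x)) (Q x)) - (inner (A (Q x)) (R x) - inner (A (Q x)) (Q x))" for x
  note i1 = Henstock_Kurzweil_Integration.integrable_diff[OF iPR iPQ]
  note i2 = Henstock_Kurzweil_Integration.integrable_diff[OF iQR iQQ]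
  have it: "t integrable_on \<Omega>" unfolding t_def by (rule Henstock_Kurzweil_Integration.integrable_diff[OF i1 i2])
  have t0: "integral \<Omega> t = 0"
    unfolding t_def Henstock_Kurzweil_Integration.integral_diff[OF i1 i2]
      Henstock_Kurzweil_Integration.integral_diff[OF iPR iPQ] Henstock_Kurzweil_Integration.integral_diff[OF iQR iQQ]
    using eQ eR by simp
  define y where "y x = (norm (Fmap \<phi> (P x) - Fmap \<phi> (R x)))\<^sup>2" for x
  define z where "z x = (norm (Fmap \<phi> (P x) - Fmap \<phi> (Q x)))\<^sup>2" for x
  have iy: "y integrable_on \<Omega>"
  proof (rule measurable_bounded_by_integrable_imp_integrable[OF _ _ _ \<Omega>s])
    note [measurable] = Fmap_measurable[OF pg] Pm R(1)
    show "y \<in> borel_measurable (lebesgue_on \<Omega>)" unfolding y_def by measurable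
    show "(\<lambda>x. 2 * eP x + 2 * (deriv \<phi> MR * MR)) integrable_on \<Omega>"
      by (intro Henstock_Kurzweil_Integration.integrable_add integrable_on_mult_right eP(1) integrable_on_const[OF \<Omega>m])
    fix x assume x: "x \<in> \<Omega>"
    have sq: "(norm (a - b))\<^sup>2 \<le> 2 * (norm a)\<^sup>2 + 2 * (norm b)\<^sup>2" for a b :: "real^'n^'n"
      unfolding parallelogram[of a b] by simp
    show "norm (y x) \<le> 2 * eP x + 2 * (deriv \<phi> MR * MR)"
      using sq[of "Fmap \<phi> (P x)" "Fmap \<phi> (R x)"] eP(2)[OF x] bounded_energy[OF R(2)[OF x]]
      unfolding Fmap_norm_sq[OF pg] y_def by simp
  qed
  \<comment> \<open>If \<open>z\<close> is not integrable, its integral is 0 by convention and the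
    bound is trivial; the case split replaces a proof of integrability.\<close>
  have le: "integral \<Omega> z \<le> B * integral \<Omega> y"
  proof (cases "z integrable_on \<Omega>")
    case True
    have "integral \<Omega> z \<le> integral \<Omega> (\<lambda>x. B * y x + D * t x)"
    proof (rule integral_le[OF True])
      show "(\<lambda>x. B * y x + D * t x) integrable_on \<Omega>"
        by (intro Henstock_Kurzweil_Integration.integrable_add integrable_on_mult_right iy it)
      fix x
      have "t x = inner (A (P x) - A (Q x)) (R x - Q x)" by (simp add: t_def inner_diff_left inner_diff_right)
      thus "z x \<le> B * y x + D * t x" using pt[of "P x" "Q x" "R x"] by (simp only: z_def y_def)
    qed
    also have "\<dots> = B * integral \<Omega> y"
      using t0 by (simp add: Henstock_Kurzweil_Integration.integral_add[OF integrable_on_mult_right[OF iy] integrable_on_mult_right[OF it]])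
    finally show ?thesis .
  next
    case False
    have "0 \<le> integral \<Omega> y" by (rule integral_nonneg_real) (simp add: y_def)
    thus ?thesis using B False by (simp add: not_integrable_integral)
  qed
  moreover have "integral \<Omega> z = integral \<Omega> (\<lambda>x. (norm (Fmap \<phi> (symm (wgrad \<Omega> u x)) - Fmap \<phi> (symm (wgrad \<Omega> (E uh) x))))\<^sup>2)"
    by (rule integral_spike[OF N]) (simp add: on z_def)
  moreover have "integral \<Omega> y = integral \<Omega> (\<lambda>x. (norm (Fmap \<phi> (symm (wgrad \<Omega> u x)) - Fmap \<phi> (symm (wgrad \<Omega> (E vh) x))))\<^sup>2)"
    by (rule integral_spike[OF N]) (simp add: on y_def)
  ultimately show ?thesis by simp
qed

theorem mainTheorem10:
  fixes rm rp C0 C1 :: real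
  shows "\<exists>C>0. \<forall>(\<phi>::real \<Rightarrow> real) (A::real^'n^'n \<Rightarrow> real^'n^'n) (\<Omega>::(real^'n) set) T E f u p uh ph.
     (CARD('n) = 2 \<or> CARD('n) = 3)
     \<and> unif_convex_N \<phi> rm rp \<and> phi_structure \<phi> A C0 C1
     \<and> lipschitz_domain \<Omega> \<and> triangulation T \<Omega> \<and> smoothing T \<Omega> E
     \<and> in_dual \<phi> \<Omega> f \<and> stokes_sol \<phi> A \<Omega> f u p \<and> method2 A \<Omega> T E f uh ph
     \<longrightarrow> L2norm \<Omega> (\<lambda>x. Fmap \<phi> (symm (wgrad \<Omega> u x)) - Fmap \<phi> (symm (wgrad \<Omega> (E uh) x)))
         \<le> C * (INF vh\<in>Zh T. L2norm \<Omega> (\<lambda>x. Fmap \<phi> (symm (wgrad \<Omega> u x)) - Fmap \<phi> (symm (wgrad \<Omega> (E vh) x))))"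
proof (cases "rm > 1 \<and> C0 > 0 \<and> C1 > 0")
  \<comment> \<open>The constant has to be named before \<open>\<phi>\<close> and \<open>A\<close>,
    whereas the positivity it relies on comes from their hypotheses. If positivity fails, no
    admissible \<open>\<phi>\<close> and \<open>A\<close> exist and any constant will do.\<close>
  case False
  have "\<not> (unif_convex_N \<phi> rm rp \<and> phi_structure \<phi> A C0 C1)" for \<phi> and A :: "real^'n^'n \<Rightarrow> real^'n^'n"
    using False by (auto simp: unif_convex_N_def phi_structure_def)
  thus ?thesis by (intro exI[of _ 1]) auto
next
  case True
  then obtain B D where B: "B > 0" and pt0: "\<forall>\<phi> (A :: real^'n^'n \<Rightarrow> real^'n^'n) P Q R.
    phi_operator \<phi> (nat \<lceil>rp\<rceil>) (rm - 1) A C0 C1 \<longrightarrow>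
    (norm (Fmap \<phi> P - Fmap \<phi> Q))\<^sup>2 \<le> B * (norm (Fmap \<phi> P - Fmap \<phi> R))\<^sup>2 + D * inner (A P - A Q) (R - Q)"
    using monotone_operator_quasi_optimality[where 'n = 'n, of "rm - 1" C0 C1 "nat \<lceil>rp\<rceil>"] by auto
  note pt = pt0[rule_format]
  show ?thesis
  proof (intro exI[of _ "sqrt B"] conjI allI impI, goal_cases)
    case 1
    show ?case using B by simp
  next
    case (2 \<phi> A \<Omega> T E f u p uh ph)
    hence uc: "unif_convex_N \<phi> rm rp" and st: "phi_structure \<phi> A C0 C1"
      and dom: "lipschitz_domain \<Omega>" and tri: "triangulation T \<Omega>" and sm: "smoothing T \<Omega> E"
      and sol: "stokes_sol \<phi> A \<Omega> f u p" and m2: "method2 A \<Omega> T E f uh ph" by blast+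
    have op: "phi_operator \<phi> (nat \<lceil>rp\<rceil>) (rm - 1) A C0 C1"
      using unif_convex_N_power_growth[OF uc] st by (simp add: phi_operator_def phi_operator_axioms_def)
    define err where "err v = L2norm \<Omega> (\<lambda>x. Fmap \<phi> (symm (wgrad \<Omega> u x)) - Fmap \<phi> (symm (wgrad \<Omega> (E v) x)))" for v
    have le: "err uh \<le> sqrt B * err vh" if "vh \<in> Zh T" for vh
      unfolding err_def L2norm_def real_sqrt_mult[symmetric]
      by (intro real_sqrt_le_mono quasi_optimality_integral[OF uc st dom tri sm sol m2 that B pt[OF op]])
    \<comment> \<open>Makes \<open>Zh T\<close> nonempty, which passing from a bound for every
      \<open>vh\<close> to the infimum requires.\<close>
    have "uh \<in> Zh T"
      by (rule method2_solution_in_Zh[OF dom tri sm, of \<phi>])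
        (use uc m2 in \<open>simp_all add: unif_convex_N_def method2_def\<close>)
    hence "err uh / sqrt B \<le> (INF vh\<in>Zh T. err vh)"
      using le B by (intro cINF_greatest) (auto simp: pos_divide_le_eq mult.commute)
    thus ?case using B unfolding err_def by (simp add: pos_divide_le_eq mult.commute)
  qed
qed

end
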